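(* Let $p(n)$ be the partition function and $u_n=\dfrac{p(n+1)p(n-1)}{p(n)^2}$. Let $\mu(n)=\frac{\pi}{6}\sqrt{24n-1}$ and set $x=\mu(n-1)$, $y=\mu(n)$, $z=\mu(n+1)$. Define $$f(n)=e^{x-2y+z}\,\frac{(x^{10}-x^9-1)\,y^{24}\,(z^{10}-z^9-1)}{x^{12}\,(y^{10}-y^9+1)^2\,z^{12}},\qquad g(n)=e^{x-2y+z}\,\frac{(x^{10}-x^9+1)\,y^{24}\,(z^{10}-z^9+1)}{x^{12}\,(y^{10}-y^9-1)^2\,z^{12}}.$$ Then for all integers $n\geq 1207$, $$f(n)<u_n<g(n).$$
   Context: $p(n)$ denotes the number of partitions of the positive integer $n$ (nonincreasing sequences of positive integers summing to $n$). *)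

theory Defs
  imports Complex_Main
begin

definition partitions :: "nat \<Rightarrow> nat list set" where
  "partitions n = {xs. sorted_wrt (\<ge>) xs \<and> (\<forall>k\<in>set xs. 0 < k) \<and> sum_list xs = n}"

definition part_num :: "nat \<Rightarrow> nat" where
  "part_num n = card (partitions n)"

definition u_ratio :: "nat \<Rightarrow> real" where
  "u_ratio n = real (part_num (n + 1)) * real (part_num (n - 1)) / (real (part_num n))\<^sup>2"

definition mu :: "nat \<Rightarrow> real" where
  "mu n = pi / 6 * sqrt (24 * real n - 1)"

definition f_bound :: "nat \<Rightarrow> real" where
  "f_bound n = (let x = mu (n - 1); y = mu n; z = mu (n + 1) in
     exp (x - 2 * y + z) *
       (((x ^ 10 - x ^ 9 - 1) * y ^ 24 * (z ^ 10 - z ^ 9 - 1)) /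
        (x ^ 12 * (y ^ 10 - y ^ 9 + 1)\<^sup>2 * z ^ 12)))"

definition g_bound :: "nat \<Rightarrow> real" where
  "g_bound n = (let x = mu (n - 1); y = mu n; z = mu (n + 1) in
     exp (x - 2 * y + z) *
       (((x ^ 10 - x ^ 9 + 1) * y ^ 24 * (z ^ 10 - z ^ 9 + 1)) /
        (x ^ 12 * (y ^ 10 - y ^ 9 - 1)\<^sup>2 * z ^ 12)))"

(* card of an infinite set is 0, so finiteness makes part_num the intended count. *)
lemma finite_partitions: "finite (partitions n)"
proof (rule finite_subset)
  have len: "length xs \<le> sum_list xs" if "\<forall>k\<in>set xs. 0 < k" for xs :: "nat list"
    using that by (induction xs) auto
  show "partitions n \<subseteq> {xs. set xs \<subseteq> {..n} \<and> length xs \<le> n}"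
    using len by (auto simp: partitions_def member_le_sum_list)
  show "finite {xs. set xs \<subseteq> {..n} \<and> length xs \<le> n}"
    by (rule finite_lists_length_le) simp
qed

end

theory Submission
  imports Defs "HOL-Complex_Analysis.Complex_Analysis" "HOL-Probability.Distributions"
begin

text \<open>
  Write \<open>q = exp (- 2 \<pi> t)\<close> with \<open>Re t > 0\<close>, so that \<open>\<Sum> p(n) q\<^sup>n = exp (\<Lambda> t)\<close> for the Lambert
  series \<open>\<Lambda>\<close>, and \<open>p(n)\<close> is the integral of \<open>exp (2 \<pi> n t + \<Lambda> t)\<close> over a vertical segment of length 1.
  Dedekind's inversion formula for \<open>\<Lambda> t - \<Lambda> (1 / t)\<close> comes from the partial fractions of \<open>coth\<close>: both
  sides contain the same symmetric double sum, and the order of summation accounts for \<open>ln t / 2\<close>.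
  On the segment \<open>Re t = \<pi> / (18 \<mu>)\<close> the neighbourhoods of the cusps \<open>0\<close> and \<open>1/2\<close> give integrals of
  \<open>\<surd>t exp (A t + B / t)\<close>, which have a primitive in terms of \<open>\<integral> exp (z\<^sup>2)\<close> and are therefore evaluated
  exactly up to their boundary terms; everywhere else \<open>\<bar>exp (\<Lambda> t)\<bar>\<close> is controlled by the modular
  invariance of \<open>\<bar>\<eta>\<bar>\<close>. Hence, for \<open>\<mu> \<ge> 89\<close>,
  \<open>p(n) = \<pi>\<^sup>2 / (6 \<surd>3) \<cdot> e\<^sup>\<mu> / \<mu>\<^sup>2 \<cdot> (1 - 1/\<mu> + (-1)\<^sup>n / \<surd>2 \<cdot> (1 - 2/\<mu>) e\<^bsup>-\<mu>/2\<^esup>) + O(e\<^bsup>\<mu>/3\<^esup>)\<close>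
  with implied constant 1. The threshold 1207 is essentially where \<open>e\<^bsup>-\<mu>/2\<^esup> / \<surd>2\<close> drops below
  \<open>\<mu>\<^bsup>-10\<^esup>\<close>, so the term of the cusp \<open>1/2\<close> is needed with its exact constant.
\<close>

section \<open>Partial fractions of the hyperbolic cotangent\<close>

text \<open>The abscissa \<open>y = pi / (18 * m)\<close> is the saddle point of the cusps with
  denominator 3, not of the two cusps that give the main terms. It balances the factor
  \<open>exp (A * y)\<close> of the kernel against the growth
  \<open>exp (pi / 12 * (1 / (9 * y)))\<close> of the generating function away from the cusps 0 and
  1/2: both equal \<open>exp (m / 6)\<close>, whence the error \<open>exp (m / 3)\<close>. Missing
  the saddle points of the cusps 0 and 1/2 is harmless, since their integrals are evaluated through
  a primitive and only the end points of the arcs enter the error. The obstacle is the lack of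
  slack: measured in units of m^(-10), the second cusp already takes up to 0.993 of the permitted 1
  at n = 1206, so its constant must be exact. This is why the transformation formulas at these two
  cusps keep the square root and the phase. Elsewhere only the modulus of the generating function
  matters, which spares the multiplier system of eta: \<open>eta_height\<close> and a coprime pair
  suffice.\<close>

lemma sinh_product_formula:
  fixes a :: real
  shows "(\<lambda>n. pi * a * (\<Prod>k=1..n. 1 + a\<^sup>2 / (real k)\<^sup>2)) \<longlonglongrightarrow> sinh (pi * a)"
proof -
  have "(\<lambda>n. of_real pi * (\<i> * of_real a) * (\<Prod>k=1..n. 1 - (\<i> * of_real a)^2 / of_nat k^2))
          \<longlonglongrightarrow> sin (of_real pi * (\<i> * of_real a))"
    by (rule sin_product_formula_complex)
  moreover have "of_real pi * (\<i> * of_real a) * (\<Prod>k=1..n. 1 - (\<i> * of_real a)^2 / of_nat k^2)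
      = \<i> * complex_of_real (pi * a * (\<Prod>k=1..n. 1 + a\<^sup>2 / (real k)\<^sup>2))" for n
    by (simp add: power_mult_distrib)
  moreover have "sin (of_real pi * (\<i> * of_real a)) = \<i> * complex_of_real (sinh (pi * a))"
  proof -
    have "sinh (complex_of_real x) = complex_of_real (sinh x)" for x
      by (simp add: sinh_def exp_of_real scaleR_conv_of_real flip: of_real_minus)
    from this[of "pi * a"] show ?thesis
      using sinh_conv_sin[of "complex_of_real (pi * a)"] by (simp add: mult_ac)
  qed
  ultimately have "(\<lambda>n. \<i> * complex_of_real (pi * a * (\<Prod>k=1..n. 1 + a\<^sup>2 / (real k)\<^sup>2)))
       \<longlonglongrightarrow> \<i> * complex_of_real (sinh (pi * a))" by (simp only:)
  from tendsto_mult[OF tendsto_const[of "-\<i>"] this]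
  have "(\<lambda>n. complex_of_real (pi * a * (\<Prod>k=1..n. 1 + a\<^sup>2 / (real k)\<^sup>2)))
       \<longlonglongrightarrow> complex_of_real (sinh (pi * a))" by (simp add: mult.assoc[symmetric])
  then show ?thesis by (simp only: tendsto_of_real_iff)
qed

lemma summable_inverse_squares_Suc: "summable (\<lambda>m. c / (real (Suc m))\<^sup>2)"
proof -
  have "summable (\<lambda>n. 1 / (real (Suc n))\<^sup>2)"
    using inverse_squares_sums by (simp add: sums_iff add_ac)
  from summable_mult[OF this, of c] show ?thesis by simp
qed

text \<open>Half the logarithmic derivative of the product for
  \<open>sinh (pi * x) / (pi * x)\<close>, taken term by term. The hyperbolic cotangent is rewritten
  as \<open>1 + 2 / (exp (2 * pi * a) - 1)\<close> because this is the shape of a Lambert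
  term.\<close>

lemma coth_partial_fractions:
  fixes a :: real
  assumes "a > 0"
  shows "(\<lambda>m. a / (a\<^sup>2 + (real (Suc m))\<^sup>2)) sums
           (pi / (exp (2 * pi * a) - 1) + pi / 2 - 1 / (2 * a))"
proof -
  define f where "f m x = ln (1 + x\<^sup>2 / (real (Suc m))\<^sup>2)" for m and x :: real
  define f' where "f' m x = 2 * x / (x\<^sup>2 + (real (Suc m))\<^sup>2)" for m and x :: real
  have sums_f: "(\<lambda>m. f m x) sums ln (sinh (pi * x) / (pi * x))" if "x > 0" for x
  proof -
    have pos: "sinh (pi * x) / (pi * x) > 0" using that by simp
    have "(\<lambda>n. (pi * x * (\<Prod>k=1..n. 1 + x\<^sup>2 / (real k)\<^sup>2)) / (pi * x))
        \<longlonglongrightarrow> sinh (pi * x) / (pi * x)"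
      by (intro tendsto_divide sinh_product_formula tendsto_const) (use that in auto)
    then have "(\<lambda>n. \<Prod>k=1..n. 1 + x\<^sup>2 / (real k)\<^sup>2) \<longlonglongrightarrow> sinh (pi * x) / (pi * x)"
      using that by simp
    then have "(\<lambda>n. ln (\<Prod>k=1..n. 1 + x\<^sup>2 / (real k)\<^sup>2)) \<longlonglongrightarrow> ln (sinh (pi * x) / (pi * x))"
      by (rule tendsto_ln) (use pos in auto)
    moreover have "ln (\<Prod>k=1..n. 1 + x\<^sup>2 / (real k)\<^sup>2) = (\<Sum>m<n. f m x)" for n
    proof -
      have "(\<Prod>k=1..n. 1 + x\<^sup>2 / (real k)\<^sup>2) = (\<Prod>m<n. 1 + x\<^sup>2 / (real (Suc m))\<^sup>2)"
        by (rule prod.reindex_bij_witness[of _ Suc "\<lambda>k. k - 1"]) auto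
      then show ?thesis
        unfolding f_def by (simp only:, subst ln_prod) (auto simp: add_nonneg_eq_0_iff)
    qed
    ultimately show ?thesis by (simp add: sums_def)
  qed
  \<comment> \<open>A bounded interval around \<open>a\<close> is chosen so that the numerators
    \<open>2 * x\<close> stay below \<open>4 * a\<close>, which gives a summable majorant
    independent of x.\<close>
  define S where "S = {0<..<2*a}"
  have deriv_f: "(f m has_field_derivative f' m x) (at x within S)" if "x \<in> S" for m x
  proof -
    have "x\<^sup>2 / (real (Suc m))\<^sup>2 \<ge> 0" by simp
    then have "1 + x\<^sup>2 / (real (Suc m))\<^sup>2 > 0" by linarith
    then show ?thesis unfolding f_def[abs_def] f'_def
      by (auto intro!: derivative_eq_intros simp: divide_simps power2_eq_square simp del: of_nat_Suc)
  qed
  have unif: "uniformly_convergent_on S (\<lambda>n x. \<Sum>i<n. f' i x)"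
  proof (rule Weierstrass_m_test')
    show "summable (\<lambda>m. 4 * a / (real (Suc m))\<^sup>2)" by (rule summable_inverse_squares_Suc)
    fix m x assume "x \<in> S"
    then have x: "0 < x" "x < 2 * a" by (auto simp: S_def)
    have "2 * x / (x\<^sup>2 + (real (Suc m))\<^sup>2) \<le> 4 * a / (real (Suc m))\<^sup>2"
      by (rule frac_le) (use x in auto)
    then show "norm (f' m x) \<le> 4 * a / (real (Suc m))\<^sup>2"
      using x by (simp add: f'_def)
  qed
  have a_S: "a \<in> S" "a \<in> interior S" using assms by (auto simp: S_def)
  have "((\<lambda>x. \<Sum>m. f m x) has_field_derivative (\<Sum>m. f' m a)) (at a)"
    by (rule has_field_derivative_series'(2)[OF _ deriv_f unif a_S(1) _ a_S(2)])
       (use sums_f[OF assms] in \<open>auto simp: S_def sums_iff\<close>)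
  then have D1: "((\<lambda>x. ln (sinh (pi * x) / (pi * x))) has_field_derivative (\<Sum>m. f' m a)) (at a)"
  proof (rule has_field_derivative_transform_within_open[where S = S])
    show "(\<Sum>m. f m x) = ln (sinh (pi * x) / (pi * x))" if "x \<in> S" for x
      using sums_f[of x] that by (auto simp: S_def sums_iff)
  qed (use a_S in \<open>auto simp: S_def\<close>)
  have D2: "((\<lambda>x. ln (sinh (pi * x) / (pi * x))) has_field_derivative
          (pi * cosh (pi * a) / sinh (pi * a) - 1 / a)) (at a)"
    using assms by (auto intro!: derivative_eq_intros simp: field_simps)
  have sh: "cosh (pi * a) / sinh (pi * a) = 2 / (exp (2 * pi * a) - 1) + 1"
  proof -
    have e: "exp (2 * pi * a) = exp (pi * a) * exp (pi * a)" by (simp flip: exp_add)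
    have g: "exp (pi * a) > 1" using assms by simp
    have g': "exp (pi * a) * exp (pi * a) > 1" using g less_1_mult by blast
    have "cosh (pi * a) / sinh (pi * a) = (exp (pi * a) * exp (pi * a) + 1) / (exp (pi * a) * exp (pi * a) - 1)"
      using g assms by (simp add: cosh_def sinh_def exp_minus divide_simps)
    then show ?thesis using g' assms unfolding e by (simp add: divide_simps)
  qed
  have "summable (\<lambda>m. f' m a)"
    using uniformly_convergent_imp_convergent[OF unif a_S(1)] by (simp add: summable_iff_convergent)
  moreover have "(\<Sum>m. f' m a) = pi * (2 / (exp (2 * pi * a) - 1) + 1) - 1 / a"
    using DERIV_unique[OF D1 D2] sh by (metis times_divide_eq_right)
  ultimately have "(\<lambda>m. f' m a / 2) sums ((pi * (2 / (exp (2 * pi * a) - 1) + 1) - 1 / a) / 2)"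
    by (intro sums_divide) (simp add: sums_iff)
  moreover have "f' m a / 2 = a / (a\<^sup>2 + (real (Suc m))\<^sup>2)" for m
    unfolding f'_def by (metis (no_types) divide_divide_eq_left mult.commute nonzero_mult_div_cancel_left times_divide_eq_right zero_neq_numeral)
  moreover have "(pi * (2 / (exp (2 * pi * a) - 1) + 1) - 1 / a) / 2 =
      pi / (exp (2 * pi * a) - 1) + pi / 2 - 1 / (2 * a)"
  proof -
    have "pi * (2 / E + 1) / 2 = pi / E + pi / 2" for E
      by (cases "E = 0") (simp_all add: field_simps)
    then show ?thesis by (simp only: diff_divide_distrib) (simp add: mult.commute)
  qed
  ultimately show ?thesis by simp
qed

section \<open>Inversion of the Lambert series on the positive axis\<close>

lemma arctan_ge_div:
  fixes x :: real
  assumes "x > 0"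
  shows "x / (1 + x\<^sup>2) \<le> arctan x"
proof -
  obtain c where c: "0 < c" "c < x" "arctan x - arctan 0 = (x - 0) * inverse (1 + c\<^sup>2)"
    using MVT2[of 0 x arctan "\<lambda>y. inverse (1 + y\<^sup>2)"] assms DERIV_arctan by auto
  have "x / (1 + x\<^sup>2) \<le> x / (1 + c\<^sup>2)"
    using c by (intro divide_left_mono add_left_mono power_mono mult_pos_pos add_pos_nonneg) auto
  with c show ?thesis by (simp add: divide_inverse)
qed

lemma arctan_over_antimono:
  fixes x y :: real
  assumes "0 < x" "x \<le> y"
  shows "arctan y / y \<le> arctan x / x"
proof (rule DERIV_nonpos_imp_nonincreasing[OF assms(2)])
  fix z assume z: "x \<le> z" "z \<le> y"
  then have "z > 0" using assms by simp
  have "((\<lambda>z. arctan z / z) has_real_derivative ((inverse (1 + z\<^sup>2) * z - arctan z * 1) / (z * z))) (at z)"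
    using \<open>z > 0\<close> by (intro derivative_intros DERIV_arctan) auto
  moreover have "(inverse (1 + z\<^sup>2) * z - arctan z * 1) / (z * z) \<le> 0"
    using arctan_ge_div[OF \<open>z > 0\<close>] by (intro divide_nonpos_nonneg) (auto simp: field_simps)
  ultimately show "\<exists>d. ((\<lambda>z. arctan z / z) has_real_derivative d) (at z) \<and> d \<le> 0" by blast
qed

text \<open>Up to a constant, \<open>K\<close> is the inverse tangent integral Ti_2. Continuity down
  to 0 is part of the conclusion because the Riemann sums below telescope to
  \<open>K 0\<close>.\<close>

lemma exists_arctan_over_primitive:
  fixes b :: real
  assumes "b > 0"
  obtains K where "continuous_on {0..b} K"
    "\<And>x. 0 < x \<Longrightarrow> x < b \<Longrightarrow> (K has_real_derivative arctan x / x) (at x)"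
proof -
  \<comment> \<open>The quotient \<open>arctan 0 / 0\<close> is 0 by convention, whereas the
    continuous extension has the value 1.\<close>
  define g where "g x = (if x = 0 then 1 else arctan x / x)" for x :: real
  have "isCont g x" for x
  proof (cases "x = 0")
    case True
    have lim: "((\<lambda>h. (arctan (0 + h) - arctan 0) / h) \<longlongrightarrow> 1) (at 0)"
      using DERIV_arctan[of 0] by (simp add: DERIV_def)
    have "(g \<longlongrightarrow> 1) (at 0)"
      by (rule Lim_transform_eventually[OF lim]) (auto simp: g_def eventually_at_filter)
    then show ?thesis using True by (simp add: isCont_def g_def)
  next
    case False
    have "isCont (\<lambda>x. arctan x / x) x" using False by (intro continuous_intros) auto
    moreover have "eventually (\<lambda>y. g y = arctan y / y) (nhds x)"
      using t1_space_nhds[OF False] by eventually_elim (auto simp: g_def)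
    ultimately show ?thesis by (simp add: isCont_cong)
  qed
  then have "continuous_on {0..b} g" by (simp add: continuous_at_imp_continuous_on)
  then obtain K where K: "\<And>x. x \<in> {0..b} \<Longrightarrow> (K has_vector_derivative g x) (at x within {0..b})"
    using antiderivative_continuous by blast
  show ?thesis
  proof
    show "continuous_on {0..b} K" using K by (meson continuous_on_vector_derivative)
    fix x assume "0 < x" "x < b"
    then show "(K has_real_derivative arctan x / x) (at x)"
      using K[of x] at_within_Icc_at[of 0 x b]
      by (simp add: has_real_derivative_iff_has_vector_derivative g_def)
  qed
qed

text \<open>The partial fraction series at \<open>k * t\<close> is cut at an index \<open>N\<close>
  that later also bounds k, so that the finite double sum extends over a square. Of the other terms,
  \<open>1 / (2 * real k)\<close> does not depend on t and drops out of a difference, while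
  \<open>1 / (real k)\<^sup>2\<close> builds up the value pi^2/6.\<close>

lemma lambert_series_truncation:
  fixes t :: real
  assumes "t > 0" "k > 0"
  shows "1 / (real k * (exp (2 * pi * real k * t) - 1)) =
     (\<Sum>m=1..N. t / ((real k * t)\<^sup>2 + (real m)\<^sup>2)) / pi + (\<Sum>m. t / ((real k * t)\<^sup>2 + (real (Suc N + m))\<^sup>2)) / pi
       - 1 / (2 * real k) + 1 / (real k)\<^sup>2 / (2 * pi * t)"
proof -
  define s where "s = pi / (exp (2 * pi * (real k * t)) - 1) + pi / 2 - 1 / (2 * (real k * t))"
  have kt: "real k * t > 0" using assms by simp
  have "(\<lambda>m. real k * t / ((real k * t)\<^sup>2 + (real (Suc m))\<^sup>2) / real k) sums (s / real k)"
    unfolding s_def by (intro sums_divide coth_partial_fractions kt)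
  then have sm: "(\<lambda>m. t / ((real k * t)\<^sup>2 + (real (Suc m))\<^sup>2)) sums (s / real k)"
    using assms by simp
  have "s / real k = (\<Sum>m. t / ((real k * t)\<^sup>2 + (real (Suc m))\<^sup>2))"
    using sm by (simp add: sums_iff)
  also have "\<dots> = (\<Sum>m. t / ((real k * t)\<^sup>2 + (real (Suc (m + N)))\<^sup>2)) + (\<Sum>m<N. t / ((real k * t)\<^sup>2 + (real (Suc m))\<^sup>2))"
    by (rule suminf_split_initial_segment) (use sm in \<open>simp add: sums_iff\<close>)
  also have "(\<Sum>m<N. t / ((real k * t)\<^sup>2 + (real (Suc m))\<^sup>2)) = (\<Sum>m=1..N. t / ((real k * t)\<^sup>2 + (real m)\<^sup>2))"
    by (rule sum.reindex_bij_witness[of _ "\<lambda>k. k - 1" Suc]) auto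
  finally have eq: "s / real k = (\<Sum>m. t / ((real k * t)\<^sup>2 + (real (Suc N + m))\<^sup>2)) + (\<Sum>m=1..N. t / ((real k * t)\<^sup>2 + (real m)\<^sup>2))"
    by (simp add: add_ac)
  have "exp (2 * pi * real k * t) - 1 > 0" using assms by simp
  then have "1 / (real k * (exp (2 * pi * real k * t) - 1)) = s / real k / pi - 1 / (2 * real k) + 1 / (real k)\<^sup>2 / (2 * pi * t)"
    using assms unfolding s_def by (simp add: divide_simps mult.assoc power2_eq_square) (simp add: algebra_simps)
  then show ?thesis unfolding eq by (simp add: add_divide_distrib)
qed

text \<open>Comparison with an integral: the summand decreases in its second variable y and has the
  primitive \<open>- arctan (real k * t / y) / real k\<close>, normalised to vanish at infinity.
  Both bounds are a step width times a value of \<open>arctan x / x\<close>, at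
  \<open>x = k * t / N\<close> or at \<open>x = k * t / Suc N\<close>, so the outer sum over k
  becomes a Riemann sum.\<close>

lemma inverse_quadratic_tail_bounds:
  fixes t :: real
  assumes "t > 0" "k > 0" "N > 0"
  shows "(\<Sum>m. t / ((real k * t)\<^sup>2 + (real (Suc N + m))\<^sup>2)) \<le> arctan (real k * t / real N) / real k" (is ?U)
    and "arctan (real k * t / real (Suc N)) / real k \<le> (\<Sum>m. t / ((real k * t)\<^sup>2 + (real (Suc N + m))\<^sup>2))" (is ?L)
proof -
  define d where "d y = t / ((real k * t)\<^sup>2 + y\<^sup>2)" for y
  define \<psi> where "\<psi> y = - arctan (real k * t / y) / real k" for y
  have der: "(\<psi> has_real_derivative d y) (at y)" if "y > 0" for y
  proof -
    have "y\<^sup>2 > 0" using that by simp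
    then have "(real k * t)\<^sup>2 + y\<^sup>2 \<noteq> 0" using zero_le_power2[of "real k * t"] by linarith
    moreover have "1 + (real k * t / y)\<^sup>2 \<noteq> 0" using zero_le_power2[of "real k * t / y"] by linarith
    ultimately have eq: "- (inverse (1 + (real k * t / y)\<^sup>2) * (real k * t * (- 1 / y\<^sup>2))) / real k = d y"
    proof -
      have "1 + (real k * t / y)\<^sup>2 = ((real k * t)\<^sup>2 + y\<^sup>2) / y\<^sup>2"
        using that by (simp add: field_simps)
      then have "- (inverse (1 + (real k * t / y)\<^sup>2) * (real k * t * (- 1 / y\<^sup>2))) / real k
         = (y\<^sup>2 / y\<^sup>2) * (real k / real k) * (t / ((real k * t)\<^sup>2 + y\<^sup>2))"
        by (simp only: inverse_divide) (simp add: mult_ac)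
      then show ?thesis using assms that by (simp add: d_def)
    qed
    have "((\<lambda>y. real k * t / y) has_real_derivative real k * t * (- 1 / y\<^sup>2)) (at y)"
      using that by (auto intro!: derivative_eq_intros simp: power2_eq_square)
    then have "(\<psi> has_real_derivative - (inverse (1 + (real k * t / y)\<^sup>2) * (real k * t * (- 1 / y\<^sup>2))) / real k) (at y)"
      unfolding \<psi>_def[abs_def] by (intro DERIV_cdivide DERIV_minus DERIV_chain2[OF DERIV_arctan])
    then show ?thesis by (simp only: eq)
  qed
  have step: "d (y + 1) \<le> \<psi> (y + 1) - \<psi> y \<and> \<psi> (y + 1) - \<psi> y \<le> d y" if "y > 0" for y
  proof -
    obtain c where c: "y < c" "c < y + 1" "\<psi> (y + 1) - \<psi> y = (y + 1 - y) * d c"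
    proof -
      have "\<exists>z>y. z < y + 1 \<and> \<psi> (y + 1) - \<psi> y = (y + 1 - y) * d z"
        by (rule MVT2) (use der \<open>y > 0\<close> in auto)
      then show thesis using that by blast
    qed
    have anti: "d b \<le> d a" if "0 < a" "a \<le> b" for a b
      unfolding d_def using that assms
      by (intro divide_left_mono add_left_mono power_mono mult_pos_pos add_nonneg_pos) auto
    show ?thesis using c anti[of y c] anti[of c "y+1"] that by auto
  qed
  have lim: "(\<lambda>m. \<psi> (real (a + m))) \<longlonglongrightarrow> 0" for a
  proof -
    have "(\<lambda>m. real k * t / real (a + m)) \<longlonglongrightarrow> 0"
      by (intro tendsto_divide_0[OF tendsto_const] filterlim_at_top_imp_at_infinity
           filterlim_compose[OF filterlim_real_sequentially]) (rule filterlim_subseq, simp add: strict_mono_def)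
    then have "(\<lambda>m. - arctan (real k * t / real (a + m)) / real k) \<longlonglongrightarrow> - arctan 0 / real k"
      by (intro tendsto_intros) (use assms in auto)
    then show ?thesis by (simp add: \<psi>_def)
  qed
  have tele: "(\<lambda>m. \<psi> (real (a + Suc m)) - \<psi> (real (a + m))) sums (0 - \<psi> (real (a + 0)))" for a
    by (rule telescope_sums[OF lim])
  have summ: "summable (\<lambda>m. d (real (Suc N + m)))"
  proof (rule summable_comparison_test)
    have "norm (d (real (Suc N + m))) \<le> t / (real (Suc m))\<^sup>2" for m
    proof -
      have "(real (Suc m))\<^sup>2 \<le> (real (Suc N + m))\<^sup>2" by (rule power_mono) auto
      also have "\<dots> \<le> (real k * t)\<^sup>2 + (real (Suc N + m))\<^sup>2" by simp
      finally have "t / ((real k * t)\<^sup>2 + (real (Suc N + m))\<^sup>2) \<le> t / (real (Suc m))\<^sup>2"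
        using assms by (intro divide_left_mono mult_pos_pos add_nonneg_pos) (auto simp del: of_nat_Suc)
      then show ?thesis using assms by (simp add: d_def)
    qed
    then show "\<exists>M. \<forall>m\<ge>M. norm (d (real (Suc N + m))) \<le> t / (real (Suc m))\<^sup>2" by blast
    show "summable (\<lambda>m. t / (real (Suc m))\<^sup>2)" by (rule summable_inverse_squares_Suc)
  qed
  have "(\<Sum>m. d (real (Suc N + m))) \<le> 0 - \<psi> (real (N + 0))"
    by (rule sums_le[OF _ summable_sums[OF summ] tele[of N]])
       (use step[of "real (N + m)" for m] assms in \<open>simp add: add_ac\<close>)
  then show ?U by (simp add: d_def \<psi>_def)
  have "0 - \<psi> (real (Suc N + 0)) \<le> (\<Sum>m. d (real (Suc N + m)))"
    by (rule sums_le[OF _ tele[of "Suc N"] summable_sums[OF summ]])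
       (use step[of "real (Suc N + m)" for m] in \<open>simp add: add_ac\<close>)
  then show ?L by (simp add: d_def \<psi>_def)
qed

text \<open>The double sum is a Riemann sum of \<open>arctan x / x\<close>; its monotonicity squeezes it between telescoping sums.\<close>

lemma inverse_quadratic_tails_limit:
  fixes t b :: real
  assumes t: "0 < t" "t < b" and contK: "continuous_on {0..b} K"
    and derK: "\<And>x. 0 < x \<Longrightarrow> x < b \<Longrightarrow> (K has_real_derivative arctan x / x) (at x)"
  shows "(\<lambda>N. \<Sum>k=1..N. \<Sum>m. t / ((real k * t)\<^sup>2 + (real (Suc N + m))\<^sup>2)) \<longlonglongrightarrow> K t - K 0"
proof (rule tendsto_sandwich)
  have mvt: "\<exists>c. x < c \<and> c < y \<and> K y - K x = (y - x) * (arctan c / c)" if "0 \<le> x" "x < y" "y < b" for x y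
  proof -
    have "continuous_on {x..y} K" using contK by (rule continuous_on_subset) (use that in auto)
    moreover have "K differentiable (at z)" if "x < z" "z < y" for z
      using derK[of z] that \<open>0 \<le> x\<close> \<open>y < b\<close> by (auto simp: real_differentiable_def)
    ultimately obtain l z where lz: "x < z" "z < y" "(K has_real_derivative l) (at z)" "K y - K x = (y - x) * l"
      using MVT[OF \<open>x < y\<close>] by blast
    moreover have "l = arctan z / z"
      using DERIV_unique[OF lz(3) derK[of z]] lz that by simp
    ultimately show ?thesis by blast
  qed
  show "\<forall>\<^sub>F N in sequentially. (\<Sum>k=1..N. \<Sum>m. t / ((real k * t)\<^sup>2 + (real (Suc N + m))\<^sup>2)) \<le> K t - K 0"
    using eventually_gt_at_top[of "0::nat"]
  proof eventually_elim
    fix N :: nat assume N: "N > 0"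
    have "(\<Sum>k=1..N. \<Sum>m. t / ((real k * t)\<^sup>2 + (real (Suc N + m))\<^sup>2)) \<le> (\<Sum>k=1..N. K (real k * t / real N) - K (real (k - 1) * t / real N))"
    proof (rule sum_mono)
      fix k assume "k \<in> {1..N}"
      then have k: "1 \<le> k" "k \<le> N" by auto
      have le: "real (k - 1) * t / real N < real k * t / real N" "real k * t / real N < b"
      proof -
        show "real (k - 1) * t / real N < real k * t / real N"
          using t N k by (intro divide_strict_right_mono mult_strict_right_mono) auto
        have "real k * t / real N \<le> real N * t / real N"
          using t N k by (intro divide_right_mono mult_right_mono) auto
        then show "real k * t / real N < b" using t N by simp
      qed
      obtain c where c: "real (k - 1) * t / real N < c" "c < real k * t / real N"
        "K (real k * t / real N) - K (real (k - 1) * t / real N) = (real k * t / real N - real (k - 1) * t / real N) * (arctan c / c)"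
        using mvt[OF _ le] t by auto
      have "c > 0" using c(1) t by (smt (verit) divide_nonneg_nonneg mult_nonneg_nonneg of_nat_0_le_iff)
      have "real k * t / real N - real (k - 1) * t / real N = t / real N"
        using k by (simp add: of_nat_diff diff_divide_distrib[symmetric] left_diff_distrib[symmetric])
      moreover have "arctan (real k * t / real N) / (real k * t / real N) \<le> arctan c / c"
        using c \<open>c > 0\<close> by (intro arctan_over_antimono) auto
      ultimately have "K (real k * t / real N) - K (real (k - 1) * t / real N) \<ge> t / real N * (arctan (real k * t / real N) / (real k * t / real N))"
        using t by (simp only: c(3)) (intro mult_left_mono, auto)
      also have "t / real N * (arctan (real k * t / real N) / (real k * t / real N)) = arctan (real k * t / real N) / real k"
        using t N k by simp
      finally show "(\<Sum>m. t / ((real k * t)\<^sup>2 + (real (Suc N + m))\<^sup>2)) \<le> K (real k * t / real N) - K (real (k - 1) * t / real N)"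
        using inverse_quadratic_tail_bounds(1)[of t k N] t N k by linarith
    qed
    also have "\<dots> = K (real N * t / real N) - K (real 0 * t / real N)"
      using sum_telescope''[of 0 N "\<lambda>k. K (real k * t / real N)"] N
      by (simp add: sum.atLeast_Suc_atMost atLeastSucAtMost_greaterThanAtMost)
    finally show "(\<Sum>k=1..N. \<Sum>m. t / ((real k * t)\<^sup>2 + (real (Suc N + m))\<^sup>2)) \<le> K t - K 0"
      using N by simp
  qed
  show "\<forall>\<^sub>F N in sequentially. K t - K (t / real (Suc N)) \<le> (\<Sum>k=1..N. \<Sum>m. t / ((real k * t)\<^sup>2 + (real (Suc N + m))\<^sup>2))"
    using eventually_gt_at_top[of "0::nat"]
  proof eventually_elim
    \<comment> \<open>For the lower bound the decreasing integrand is compared at left end points on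
      the mesh \<open>t / Suc N\<close>. Cell \<open>k\<close> reaches from \<open>k\<close> to
      \<open>Suc k\<close>, so the cell at the origin is lost and
      \<open>K (t / real (Suc N))\<close> stands in place of \<open>K 0\<close>.\<close>
    fix N :: nat assume N: "N > 0"
    have "(\<Sum>k=1..N. K (real (Suc k) * t / real (Suc N)) - K (real k * t / real (Suc N))) \<le> (\<Sum>k=1..N. \<Sum>m. t / ((real k * t)\<^sup>2 + (real (Suc N + m))\<^sup>2))"
    proof (rule sum_mono)
      fix k assume "k \<in> {1..N}"
      then have k: "1 \<le> k" "k \<le> N" by auto
      have le: "0 < real k * t / real (Suc N)" "real k * t / real (Suc N) < real (Suc k) * t / real (Suc N)" "real (Suc k) * t / real (Suc N) < b"
      proof -
        show "0 < real k * t / real (Suc N)" using t k by simp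
        show "real k * t / real (Suc N) < real (Suc k) * t / real (Suc N)"
          using t N k by (intro divide_strict_right_mono mult_strict_right_mono) auto
        have "real (Suc k) * t / real (Suc N) \<le> real (Suc N) * t / real (Suc N)"
          using t N k by (intro divide_right_mono mult_right_mono) auto
        then show "real (Suc k) * t / real (Suc N) < b" using t N by simp
      qed
      obtain c where c: "real k * t / real (Suc N) < c" "c < real (Suc k) * t / real (Suc N)"
        "K (real (Suc k) * t / real (Suc N)) - K (real k * t / real (Suc N)) = (real (Suc k) * t / real (Suc N) - real k * t / real (Suc N)) * (arctan c / c)"
        using mvt[OF _ le(2,3)] le(1) by (metis less_eq_real_def)
      have "real (Suc k) * t / real (Suc N) - real k * t / real (Suc N) = t / real (Suc N)"
        by (simp add: diff_divide_distrib[symmetric] left_diff_distrib[symmetric])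
      moreover have "arctan c / c \<le> arctan (real k * t / real (Suc N)) / (real k * t / real (Suc N))"
        using c le by (intro arctan_over_antimono) auto
      ultimately have "K (real (Suc k) * t / real (Suc N)) - K (real k * t / real (Suc N)) \<le> t / real (Suc N) * (arctan (real k * t / real (Suc N)) / (real k * t / real (Suc N)))"
        using t by (simp only: c(3)) (intro mult_left_mono, auto)
      also have "t / real (Suc N) * (arctan (real k * t / real (Suc N)) / (real k * t / real (Suc N))) = arctan (real k * t / real (Suc N)) / real k"
        using t N k by (simp del: of_nat_Suc)
      finally show "K (real (Suc k) * t / real (Suc N)) - K (real k * t / real (Suc N)) \<le> (\<Sum>m. t / ((real k * t)\<^sup>2 + (real (Suc N + m))\<^sup>2))"
        using inverse_quadratic_tail_bounds(2)[of t k N] t N k by linarith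
    qed
    also have "(\<Sum>k=1..N. K (real (Suc k) * t / real (Suc N)) - K (real k * t / real (Suc N))) = K (real (Suc N) * t / real (Suc N)) - K (t / real (Suc N))"
      using N by (subst sum_Suc_diff) auto
    finally show "K t - K (t / real (Suc N)) \<le> (\<Sum>k=1..N. \<Sum>m. t / ((real k * t)\<^sup>2 + (real (Suc N + m))\<^sup>2))"
      by (simp del: of_nat_Suc)
  qed
  have "(\<lambda>N. K (t / real (Suc N))) \<longlonglongrightarrow> K 0"
  proof (rule continuous_on_tendsto_compose[OF contK])
    show "(\<lambda>N. t / real (Suc N)) \<longlonglongrightarrow> 0"
      by (intro tendsto_divide_0[OF tendsto_const] filterlim_at_top_imp_at_infinity
           filterlim_compose[OF filterlim_real_sequentially] filterlim_Suc)
    have "t / real (Suc N) \<le> t" for N using t by (simp add: divide_le_eq del: of_nat_Suc)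
    then show "\<forall>\<^sub>F N in sequentially. t / real (Suc N) \<in> {0..b}"
      using t by (auto intro!: always_eventually intro: order.trans less_imp_le simp del: of_nat_Suc)
  qed (use t in auto)
  then show "(\<lambda>N. K t - K (t / real (Suc N))) \<longlonglongrightarrow> K t - K 0"
    by (intro tendsto_intros)
  show "(\<lambda>N. K t - K 0) \<longlonglongrightarrow> K t - K 0" by simp
qed

text \<open>The derivative of the left side, taken in x, is
  \<open>(arctan x + arctan (1 / x)) / x = pi / 2 / x\<close>, and both sides vanish at 1. This is
  the only source of the logarithm in the inversion formula.\<close>

lemma arctan_over_primitive_reflect:
  fixes t b :: real
  assumes t: "0 < t" "t < b" "1 / t < b"
    and derK: "\<And>x. 0 < x \<Longrightarrow> x < b \<Longrightarrow> (K has_real_derivative arctan x / x) (at x)"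
  shows "K t - K (1 / t) = pi / 2 * ln t"
proof -
  define S where "S = {1 / b<..<b}"
  have b: "b > 1"
  proof (rule ccontr)
    assume "\<not> b > 1"
    then have "t < 1" "1 / t < 1" using t by linarith+
    then show False using t by (simp add: field_simps)
  qed
  have "\<exists>c. \<forall>x\<in>S. K x - K (1 / x) - pi / 2 * ln x = c"
  proof (rule has_field_derivative_zero_constant)
    fix x assume "x \<in> S"
    have x: "0 < x" "x < b" "0 < 1 / x" "1 / x < b"
    proof -
      have lt: "1 / b < x" "x < b" using \<open>x \<in> S\<close> by (auto simp: S_def)
      have "0 < 1 / b" using b by simp
      with lt show x0: "0 < x" by linarith
      show "0 < 1 / x" using x0 by simp
      show "x < b" by (rule lt)
      show "1 / x < b" using lt b x0 by (simp add: field_simps)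
    qed
    have "((\<lambda>x. K x - K (1 / x) - pi / 2 * ln x) has_real_derivative
        (arctan x / x - (arctan (1 / x) / (1 / x)) * (- 1 / x\<^sup>2) - pi / 2 * (1 / x))) (at x)"
    proof (intro DERIV_diff DERIV_cmult)
      show "(K has_real_derivative arctan x / x) (at x)" using derK x by blast
      show "((\<lambda>x. K (1 / x)) has_real_derivative (arctan (1 / x) / (1 / x)) * (- 1 / x\<^sup>2)) (at x)"
      proof (rule DERIV_chain2[of K])
        show "(K has_real_derivative arctan (1 / x) / (1 / x)) (at (1 / x))" using derK x by blast
        show "((\<lambda>x. 1 / x) has_real_derivative - 1 / x\<^sup>2) (at x)"
          using x by (auto intro!: derivative_eq_intros simp: power2_eq_square)
      qed
      show "(ln has_real_derivative 1 / x) (at x)" using x by (auto intro!: derivative_eq_intros)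
    qed
    moreover have "arctan x / x - (arctan (1 / x) / (1 / x)) * (- 1 / x\<^sup>2) - pi / 2 * (1 / x) = 0"
      using x arctan_inverse[of x] by (simp add: power2_eq_square divide_simps)
    ultimately show "((\<lambda>x. K x - K (1 / x) - pi / 2 * ln x) has_real_derivative 0) (at x within S)"
      by (simp add: has_field_derivative_at_within)
  qed (simp add: S_def)
  moreover have "1 \<in> S" "t \<in> S" using b t by (auto simp: S_def field_simps)
  ultimately have "K t - K (1 / t) - pi / 2 * ln t = K 1 - K (1 / 1) - pi / 2 * ln 1" by metis
  then show ?thesis by simp
qed

section \<open>The inversion formula for real t\<close>

lemma summable_lambert_real:
  fixes t :: real
  assumes "t > 0"
  shows "summable (\<lambda>k. 1 / (real (Suc k) * (exp (2 * pi * real (Suc k) * t) - 1)))"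
proof (rule summable_comparison_test)
  show "summable (\<lambda>k. (1 / (2 * pi * t)) / (real (Suc k))\<^sup>2)" by (rule summable_inverse_squares_Suc)
  have "norm (1 / (real (Suc k) * (exp (2 * pi * real (Suc k) * t) - 1))) \<le> (1 / (2 * pi * t)) / (real (Suc k))\<^sup>2" for k
  proof -
    define x where "x = 2 * pi * real (Suc k) * t"
    have x: "x > 0" unfolding x_def using assms by simp
    have "x \<le> exp x - 1" using exp_ge_add_one_self[of x] by linarith
    then have "1 / (real (Suc k) * (exp x - 1)) \<le> 1 / (real (Suc k) * x)"
      using x by (intro divide_left_mono mult_left_mono mult_pos_pos) auto
    also have "\<dots> = (1 / (2 * pi * t)) / (real (Suc k))\<^sup>2"
      using assms by (simp add: x_def power2_eq_square)
    finally show ?thesis using x unfolding x_def[symmetric] by simp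
  qed
  then show "\<exists>N. \<forall>k\<ge>N. norm (1 / (real (Suc k) * (exp (2 * pi * real (Suc k) * t) - 1))) \<le> (1 / (2 * pi * t)) / (real (Suc k))\<^sup>2"
    by blast
qed

text \<open>The partial sums at t and 1/t are subtracted before N tends to infinity. The harmonic
  sums, divergent on their own, cancel, and so do the square double sums, which are interchanged by
  swapping the two indices. What survives are the tails, giving \<open>ln t / 2\<close>, and the
  part with pi^2/6.\<close>

theorem lambert_inversion_real:
  fixes t :: real
  assumes "t > 0"
  shows "(\<Sum>k. 1 / (real (Suc k) * (exp (2 * pi * real (Suc k) * t) - 1))) =
         (\<Sum>k. 1 / (real (Suc k) * (exp (2 * pi * real (Suc k) * (1 / t)) - 1))) +
           pi / 12 * (1 / t - t) + ln t / 2"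
proof -
  define s where "s t k = 1 / (real k * (exp (2 * pi * real k * t) - 1))" for t k
  define D where "D t N = (\<Sum>k=1..N. \<Sum>m=1..N. t / ((real k * t)\<^sup>2 + (real m)\<^sup>2))" for t :: real and N
  define R where "R t N = (\<Sum>k=1..N. \<Sum>m. t / ((real k * t)\<^sup>2 + (real (Suc N + m))\<^sup>2))" for t :: real and N
  define Z where "Z N = (\<Sum>k=1..N. 1 / (real k)\<^sup>2)" for N
  have S: "(\<Sum>k=1..N. s t k) = D t N / pi + R t N / pi - (\<Sum>k=1..N. 1 / (2 * real k)) + Z N / (2 * pi * t)"
    if "t > 0" for t N
  proof -
    have "(\<Sum>k=1..N. s t k) = (\<Sum>k=1..N. (\<Sum>m=1..N. t / ((real k * t)\<^sup>2 + (real m)\<^sup>2)) / pi + (\<Sum>m. t / ((real k * t)\<^sup>2 + (real (Suc N + m))\<^sup>2)) / pi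
       - 1 / (2 * real k) + 1 / (real k)\<^sup>2 / (2 * pi * t))"
      unfolding s_def by (intro sum.cong refl lambert_series_truncation that) auto
    then show ?thesis
      by (simp add: D_def R_def Z_def sum.distrib sum_subtractf sum_divide_distrib)
  qed
  have D: "D (1 / t) N = D t N" for N
  proof -
    have "D (1 / t) N = (\<Sum>k=1..N. \<Sum>m=1..N. t / ((real m * t)\<^sup>2 + (real k)\<^sup>2))"
      unfolding D_def
    proof (intro sum.cong refl)
      fix k m assume "k \<in> {1..N}" "m \<in> {1..N}"
      then have "0 < (real k * (1/t))\<^sup>2 + (real m)\<^sup>2" "0 < (real m * t)\<^sup>2 + (real k)\<^sup>2"
        using assms by (auto intro!: add_pos_nonneg)
      then show "1 / t / ((real k * (1/t))\<^sup>2 + (real m)\<^sup>2) = t / ((real m * t)\<^sup>2 + (real k)\<^sup>2)"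
        using assms by (simp add: field_simps power2_eq_square)
    qed
    then show ?thesis unfolding D_def by (subst sum.swap)
  qed
  obtain b where b: "t < b" "1 / t < b" using gt_ex[of "max t (1 / t)"] by auto
  with assms have "b > 0" by linarith
  then obtain K where K: "continuous_on {0..b} K"
    "\<And>x. 0 < x \<Longrightarrow> x < b \<Longrightarrow> (K has_real_derivative arctan x / x) (at x)"
    using exists_arctan_over_primitive by blast
  have "R t \<longlonglongrightarrow> K t - K 0" "R (1 / t) \<longlonglongrightarrow> K (1 / t) - K 0"
    unfolding R_def[abs_def] by (rule inverse_quadratic_tails_limit[OF _ _ K]; use assms b in simp)+
  moreover have "Z \<longlonglongrightarrow> pi\<^sup>2 / 6"
  proof -
    have "Z N = (\<Sum>k<N. 1 / (real k + 1)\<^sup>2)" for N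
      unfolding Z_def by (rule sum.reindex_bij_witness[of _ Suc "\<lambda>k. k - 1"]) (auto simp: of_nat_diff)
    then have "Z = (\<lambda>N. \<Sum>k<N. 1 / (real k + 1)\<^sup>2)" by blast
    then show ?thesis using inverse_squares_sums by (simp add: sums_def add.commute)
  qed
  ultimately have "(\<lambda>N. (R t N - R (1 / t) N) / pi + Z N * (1 / (2 * pi) * (1 / t - t))) \<longlonglongrightarrow>
     ((K t - K 0) - (K (1 / t) - K 0)) / pi + pi\<^sup>2 / 6 * (1 / (2 * pi) * (1 / t - t))"
    by (intro tendsto_intros) auto
  moreover have "(R t N - R (1 / t) N) / pi + Z N * (1 / (2 * pi) * (1 / t - t)) = (\<Sum>k=1..N. s t k) - (\<Sum>k=1..N. s (1 / t) k)" for N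
  proof -
    have "Z N / (2 * pi * t) - Z N / (2 * pi * (1 / t)) = Z N * (1 / (2 * pi) * (1 / t - t))"
      using assms by (simp add: right_diff_distrib)
    then show ?thesis
      using S[of t N] S[of "1 / t" N] assms by (simp add: D diff_divide_distrib)
  qed
  moreover have "((K t - K 0) - (K (1 / t) - K 0)) / pi + pi\<^sup>2 / 6 * (1 / (2 * pi) * (1 / t - t)) = pi / 12 * (1 / t - t) + ln t / 2"
  proof -
    have "((K t - K 0) - (K (1 / t) - K 0)) / pi = ln t / 2"
      using arctan_over_primitive_reflect[OF assms b K(2)] by (simp add: algebra_simps)
    then show ?thesis by (simp only:) (simp add: power2_eq_square)
  qed
  ultimately have lim1: "(\<lambda>N. (\<Sum>k=1..N. s t k) - (\<Sum>k=1..N. s (1 / t) k)) \<longlonglongrightarrow> pi / 12 * (1 / t - t) + ln t / 2"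
    by simp
  have lim2: "(\<lambda>N. \<Sum>k=1..N. s x k) \<longlonglongrightarrow> (\<Sum>k. s x (Suc k))" if "x > 0" for x
  proof -
    have "(\<Sum>k=1..N. s x k) = (\<Sum>k<N. s x (Suc k))" for N
      by (rule sum.reindex_bij_witness[of _ Suc "\<lambda>k. k - 1"]) auto
    then show ?thesis
      using summable_LIMSEQ[OF summable_lambert_real[OF that]] by (simp add: s_def)
  qed
  have "(\<Sum>k. s t (Suc k)) - (\<Sum>k. s (1 / t) (Suc k)) = pi / 12 * (1 / t - t) + ln t / 2"
    by (rule LIMSEQ_unique[OF tendsto_diff[OF lim2[OF assms] lim2[of "1 / t"]] lim1]) (use assms in auto)
  then show ?thesis by (simp add: s_def)
qed

section \<open>The Lambert series on the right half-plane\<close>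

text \<open>With q = exp (-2 pi t) the terms are q^k / (k (1 - q^k)). The series is a single-valued
  logarithm of the generating function on the whole right half-plane, so the logarithmic identity
  itself can be continued analytically from the positive axis.\<close>

definition lambert :: "complex \<Rightarrow> complex" where
  "lambert t = (\<Sum>k. 1 / (of_nat (Suc k) * (exp (2 * of_real pi * of_nat (Suc k) * t) - 1)))"

lemma norm_lambert_term_le:
  fixes t :: complex
  assumes "0 < y" "y \<le> Re t"
  shows "norm (1 / (of_nat (Suc k) * (exp (2 * of_real pi * of_nat (Suc k) * t) - 1))) \<le>
           1 / (real (Suc k) * (exp (2 * pi * real (Suc k) * y) - 1))"
proof -
  have "exp (2 * pi * real (Suc k) * y) \<le> exp (2 * pi * real (Suc k) * Re t)"
    using assms by (simp del: of_nat_Suc)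
  also have "\<dots> = norm (exp (2 * of_real pi * of_nat (Suc k) * t))"
    by (simp only: norm_exp_eq_Re) simp
  finally have "exp (2 * pi * real (Suc k) * y) - 1 \<le> norm (exp (2 * of_real pi * of_nat (Suc k) * t) - 1)"
    using norm_triangle_ineq2[of "exp (2 * of_real pi * of_nat (Suc k) * t)" 1]
    unfolding norm_one by linarith
  moreover have "exp (2 * pi * real (Suc k) * y) - 1 > 0" using assms by (simp del: of_nat_Suc)
  ultimately show ?thesis
    unfolding norm_divide norm_mult norm_of_nat norm_one
    by (intro divide_left_mono mult_left_mono mult_pos_pos) (auto simp del: of_nat_Suc)
qed

lemma sums_lambert:
  assumes "Re t > 0"
  shows "(\<lambda>k. 1 / (of_nat (Suc k) * (exp (2 * of_real pi * of_nat (Suc k) * t) - 1))) sums lambert t"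
  unfolding lambert_def
  by (intro summable_sums summable_comparison_test[OF _ summable_lambert_real[OF assms]])
     (use norm_lambert_term_le[OF assms order_refl] in blast)

lemma exp_lambert_denom_nonzero:
  assumes "Re t > 0"
  shows "exp (2 * of_real pi * of_nat (Suc k) * t) - 1 \<noteq> (0 :: complex)"
proof -
  have "norm (exp (2 * of_real pi * of_nat (Suc k) * t)) > 1"
    using assms by (simp only: norm_exp_eq_Re) (simp del: of_nat_Suc)
  then show ?thesis by (metis eq_iff_diff_eq_0 less_irrefl norm_one)
qed

lemma open_right_half_plane: "open {t. 0 < Re t}"
  by (simp add: open_halfspace_Re_gt)

lemma holomorphic_lambert: "lambert holomorphic_on {t. Re t > 0}"
proof (rule holomorphic_uniform_sequence[OF open_right_half_plane])
  fix n
  show "(\<lambda>t. \<Sum>k<n. 1 / (of_nat (Suc k) * (exp (2 * of_real pi * of_nat (Suc k) * t) - 1)))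
          holomorphic_on {t. 0 < Re t}"
    using exp_lambert_denom_nonzero by (intro holomorphic_intros) (auto simp del: of_nat_Suc)
next
  fix t :: complex assume t: "t \<in> {t. 0 < Re t}"
  \<comment> \<open>On the closed ball of this radius real parts stay at least \<open>d\<close>, so
    the real series at \<open>d\<close> is a uniform majorant.\<close>
  define d where "d = Re t / 2"
  have d: "d > 0" using t by (simp add: d_def)
  have Re_ge: "d \<le> Re z" if "z \<in> cball t d" for z
  proof -
    have "Re t - Re z \<le> d"
      using that abs_Re_le_cmod[of "t - z"] by (auto simp: dist_norm)
    then show ?thesis by (simp add: d_def)
  qed
  have "uniform_limit (cball t d) (\<lambda>n z. \<Sum>k<n. 1 / (of_nat (Suc k) * (exp (2 * of_real pi * of_nat (Suc k) * z) - 1))) lambert sequentially"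
    unfolding lambert_def
    by (rule Weierstrass_m_test[OF norm_lambert_term_le summable_lambert_real[OF d]])
       (use d Re_ge in auto)
  moreover have "cball t d \<subseteq> {t. 0 < Re t}" using Re_ge d by force
  ultimately show "\<exists>d>0. cball t d \<subseteq> {t. 0 < Re t} \<and> uniform_limit (cball t d)
     (\<lambda>n z. \<Sum>k<n. 1 / (of_nat (Suc k) * (exp (2 * of_real pi * of_nat (Suc k) * z) - 1))) lambert sequentially"
    using d by blast
qed

lemma lambert_of_real:
  "lambert (of_real x) = of_real (\<Sum>k. 1 / (real (Suc k) * (exp (2 * pi * real (Suc k) * x) - 1)))"
  if "x > 0"
proof -
  have "(\<lambda>k. complex_of_real (1 / (real (Suc k) * (exp (2 * pi * real (Suc k) * x) - 1)))) sums
     of_real (\<Sum>k. 1 / (real (Suc k) * (exp (2 * pi * real (Suc k) * x) - 1)))"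
    by (intro sums_of_real summable_sums summable_lambert_real that)
  moreover have "complex_of_real (1 / (real (Suc k) * (exp (2 * pi * real (Suc k) * x) - 1))) =
      1 / (of_nat (Suc k) * (exp (2 * of_real pi * of_nat (Suc k) * of_real x) - 1))" for k
    by (simp flip: exp_of_real)
  ultimately have "(\<lambda>k. 1 / (of_nat (Suc k) * (exp (2 * of_real pi * of_nat (Suc k) * complex_of_real x) - 1))) sums
     of_real (\<Sum>k. 1 / (real (Suc k) * (exp (2 * pi * real (Suc k) * x) - 1)))" by (simp only:)
  from sums_unique2[OF _ this] show ?thesis using sums_lambert[of "of_real x"] that by simp
qed

lemma Re_inverse_pos:
  assumes "Re t > 0"
  shows "Re (1 / t) > 0"
  using assms by (simp add: Re_divide divide_pos_pos add_pos_nonneg)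

text \<open>Identity theorem: both sides are holomorphic on the right half-plane, where the
  principal \<open>Ln\<close> has no cut, and they agree on the positive axis, which accumulates at
  1.\<close>

theorem lambert_inversion:
  assumes "Re t > 0"
  shows "lambert t = lambert (1 / t) + of_real (pi / 12) * (1 / t - t) + Ln t / 2"
proof -
  define g where "g t = lambert t - (lambert (1 / t) + of_real (pi / 12) * (1 / t - t) + Ln t / 2)" for t
  let ?S = "{t. Re t > 0}"
  have "g t = 0"
  proof (rule analytic_continuation[where f = g and S = ?S and U = "complex_of_real ` {0<..}" and \<xi> = 1])
    have "(lambert \<circ> (\<lambda>t. 1 / t)) holomorphic_on ?S"
      by (rule holomorphic_on_compose_gen[OF _ holomorphic_lambert])
         (auto intro!: holomorphic_intros simp: Re_inverse_pos)
    then have "(\<lambda>t. lambert (1 / t)) holomorphic_on ?S" by (simp add: o_def)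
    then show "g holomorphic_on ?S"
      unfolding g_def[abs_def] using holomorphic_lambert
      by (intro holomorphic_intros) (auto simp: complex_nonpos_Reals_iff)
    show "open ?S" by (rule open_right_half_plane)
    show "connected ?S" by (intro convex_connected convex_halfspace_Re_gt)
    show "complex_of_real ` {0<..} \<subseteq> ?S" by auto
    show "1 \<in> ?S" by simp
    show "1 islimpt complex_of_real ` {0<..}"
    proof (rule islimptI)
      fix T :: "complex set" assume T: "1 \<in> T" "open T"
      then obtain e where e: "e > 0" "ball 1 e \<subseteq> T" by (meson openE)
      have "complex_of_real (1 + e / 2) \<in> ball 1 e"
        using e by (simp add: dist_norm norm_divide)
      moreover have "complex_of_real (1 + e / 2) \<noteq> 1" using e by simp
      ultimately show "\<exists>y\<in>complex_of_real ` {0<..}. y \<in> T \<and> y \<noteq> 1"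
        using e by (intro bexI[of _ "complex_of_real (1 + e / 2)"] imageI) (auto simp del: of_real_add)
    qed
    fix z assume "z \<in> complex_of_real ` {0<..}"
    then obtain x where x: "x > 0" "z = of_real x" by auto
    have "lambert (1 / z) = lambert (of_real (1 / x))" using x by simp
    then show "g z = 0"
      using lambert_inversion_real[OF x(1)] lambert_of_real[OF x(1)] lambert_of_real[of "1 / x"] x
      by (simp add: g_def Ln_of_real)
  qed (use assms in simp)
  then show ?thesis by (simp add: g_def)
qed

lemma lambert_add_ii: "lambert (t + \<i>) = lambert t"
proof -
  have "exp (2 * of_real pi * of_nat (Suc k) * (t + \<i>)) = exp (2 * of_real pi * of_nat (Suc k) * t)" for k
  proof -
    have "exp (2 * of_real pi * of_nat (Suc k) * (t + \<i>)) = exp (2 * of_real pi * of_nat (Suc k) * t + \<i> * (of_int (int (Suc k)) * (of_real pi * 2)))"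
      by (simp add: algebra_simps)
    also have "\<dots> = exp (2 * of_real pi * of_nat (Suc k) * t)"
      by (rule exp_plus_2pin)
    finally show ?thesis .
  qed
  then show ?thesis by (simp only: lambert_def)
qed

lemma lambert_add_int_ii: "lambert (t + of_int j * \<i>) = lambert t"
proof (induction j rule: int_induct[where k = 0])
  case (step1 i)
  then show ?case using lambert_add_ii[of "t + of_int i * \<i>"] by (simp add: algebra_simps)
next
  case (step2 i)
  then show ?case using lambert_add_ii[of "t + of_int (i - 1) * \<i>"] by (simp add: algebra_simps)
qed simp

lemma exp_minus_2pi_le:
  assumes "1 / 2 \<le> x"
  shows "exp (- (2 * pi * x)) \<le> 1 / 8"
proof -
  have "3 \<le> 2 * pi * x"
    using pi_gt3 assms mult_mono[of 3 pi 1 "2 * x"] by simp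
  then have "exp 3 \<le> exp (2 * pi * x)" by simp
  moreover have "exp (3::real) = exp 1 ^ 3" by (simp flip: exp_of_nat_mult)
  moreover have "(2::real) ^ 3 \<le> exp 1 ^ 3"
    using exp_ge_add_one_self[of 1] by (intro power_mono) auto
  ultimately have "8 \<le> exp (2 * pi * x)" by simp
  then show ?thesis unfolding exp_minus by (simp add: field_simps)
qed

text \<open>Dropping the factor 1/k and bounding 1 - Q^k below by 1 - Q leaves a geometric series
  with value Q / (1 - Q)^2, which is at most 64 Q / 49 for Q \<le> 1/8.\<close>

lemma norm_lambert_le:
  assumes "1 / 2 \<le> Re t"
  shows "norm (lambert t) \<le> 2 * exp (- (2 * pi * Re t))"
proof -
  define Q where "Q = exp (- (2 * pi * Re t))"
  have Q: "0 < Q" "Q \<le> 1 / 8"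
    using exp_minus_2pi_le[OF assms] by (auto simp: Q_def)
  have term_le: "1 / (real (Suc k) * (exp (2 * pi * real (Suc k) * Re t) - 1)) \<le> Q / (1 - Q) * Q ^ k" for k
  proof -
    have e: "exp (2 * pi * real (Suc k) * Re t) = 1 / Q ^ Suc k"
    proof -
      have "exp (2 * pi * real (Suc k) * Re t) = exp (2 * pi * Re t) ^ Suc k"
        by (simp only: exp_of_nat_mult[symmetric]) (simp add: mult_ac)
      then show ?thesis by (simp only: Q_def exp_minus power_inverse inverse_eq_divide[symmetric] inverse_inverse_eq)
    qed
    have QS: "Q ^ Suc k \<le> Q" using Q power_decreasing[of 1 "Suc k" Q] by simp
    have QS': "0 < Q ^ Suc k" "Q ^ Suc k < 1" using Q QS by (simp, linarith)
    have "1 / (real (Suc k) * (exp (2 * pi * real (Suc k) * Re t) - 1)) \<le> 1 / (1 * (1 / Q ^ Suc k - 1))"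
      unfolding e using QS'
      by (intro divide_left_mono mult_right_mono mult_pos_pos) (simp_all del: power_Suc)
    also have "\<dots> = Q ^ Suc k / (1 - Q ^ Suc k)"
    proof -
      have "1 - Q ^ Suc k \<noteq> 0" "Q ^ Suc k \<noteq> 0" using QS' by linarith+
      then show ?thesis by (simp add: divide_simps del: power_Suc)
    qed
    also have "\<dots> \<le> Q ^ Suc k / (1 - Q)"
      using Q QS QS' by (intro divide_left_mono mult_pos_pos) (simp_all del: power_Suc)
    finally show ?thesis by simp
  qed
  have geo: "(\<lambda>k. Q / (1 - Q) * Q ^ k) sums (Q / (1 - Q) * (1 / (1 - Q)))"
    by (intro sums_mult geometric_sums) (use Q in auto)
  have "norm (lambert t) \<le> (\<Sum>k. Q / (1 - Q) * Q ^ k)"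
  proof -
    have t: "Re t > 0" using assms by simp
    have "norm (\<Sum>k. 1 / (of_nat (Suc k) * (exp (2 * of_real pi * of_nat (Suc k) * t) - 1))) \<le> (\<Sum>k. Q / (1 - Q) * Q ^ k)"
      by (rule norm_suminf_le) (use norm_lambert_term_le[OF t order_refl] term_le geo in \<open>auto intro: order_trans simp: sums_iff\<close>)
    then show ?thesis by (simp only: lambert_def)
  qed
  also have "\<dots> = Q / (1 - Q) * (1 / (1 - Q))" using geo by (simp add: sums_iff)
  also have "\<dots> \<le> Q / (7 / 8) * (1 / (7 / 8))"
    using Q by (intro mult_mono divide_left_mono) auto
  also have "\<dots> \<le> 2 * Q" using Q by simp
  finally show ?thesis by (simp add: Q_def)
qed

text \<open>The decay rate 2 pi is the point: on the arcs around the cusps it outweighs the growth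
  \<open>exp (pi / 12 * Re t)\<close> of the factor that multiplies this difference.\<close>

lemma norm_exp_lambert_minus_one_le:
  assumes "1 / 2 \<le> Re t"
  shows "norm (exp (lambert t) - 1) \<le> 3 * exp (- (2 * pi * Re t))"
proof -
  define Q where "Q = exp (- (2 * pi * Re t))"
  have Q: "Q \<ge> 0" "Q \<le> 1 / 8" using exp_minus_2pi_le[OF assms] by (auto simp: Q_def)
  have l: "norm (lambert t) \<le> 2 * Q" using norm_lambert_le[OF assms] by (simp add: Q_def)
  have "norm (exp (lambert t) - 1) \<le> exp \<bar>Re (lambert t)\<bar> * norm (lambert t)"
    using Taylor_exp[of "lambert t" 0] by simp
  also have "\<dots> \<le> exp (1 / 4) * (2 * Q)"
    using l Q abs_Re_le_cmod[of "lambert t"] by (intro mult_mono) auto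
  also have "\<dots> \<le> 3 / 2 * (2 * Q)"
    using Q exp_bound_lemma[of "1 / 4 :: real"] by (intro mult_right_mono) auto
  finally show ?thesis by (simp add: Q_def)
qed

section \<open>Partition numbers as Fourier coefficients\<close>

definition bounded_partitions :: "nat \<Rightarrow> nat \<Rightarrow> nat list set" where
  "bounded_partitions M n = {xs \<in> partitions n. \<forall>k\<in>set xs. k \<le> M}"

lemma finite_bounded_partitions: "finite (bounded_partitions M n)"
  using finite_partitions[of n] by (rule finite_subset[rotated]) (auto simp: bounded_partitions_def)

lemma bounded_partitions_0: "bounded_partitions 0 n = (if n = 0 then {[]} else {})"
proof -
  have "xs \<in> bounded_partitions 0 n \<longleftrightarrow> xs = [] \<and> n = 0" for xs
    by (cases xs) (auto simp: bounded_partitions_def partitions_def)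
  then show ?thesis by auto
qed

text \<open>The lists are nonincreasing, so a part equal to the maximum \<open>Suc M\<close>, if
  there is one, stands at the head and can be removed.\<close>

lemma bounded_partitions_Suc:
  "bounded_partitions (Suc M) n = bounded_partitions M n \<union>
     (if Suc M \<le> n then Cons (Suc M) ` bounded_partitions (Suc M) (n - Suc M) else {})"
  (is "?L = ?R")
proof (intro equalityI subsetI)
  fix xs assume xs: "xs \<in> ?L"
  show "xs \<in> ?R"
  proof (cases "xs \<in> bounded_partitions M n")
    case False
    then have "Suc M \<in> set xs"
      using xs by (auto simp: bounded_partitions_def le_Suc_eq)
    then obtain z zs where z: "xs = z # zs" by (cases xs) auto
    have "z = Suc M"
      using xs \<open>Suc M \<in> set xs\<close> unfolding z bounded_partitions_def partitions_def by force
    then show ?thesis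
      using xs unfolding z bounded_partitions_def partitions_def by auto
  qed simp
next
  fix xs assume "xs \<in> ?R"
  then show "xs \<in> ?L"
    by (auto simp: bounded_partitions_def partitions_def le_Suc_eq split: if_splits)
qed

lemma card_bounded_partitions_Suc:
  "card (bounded_partitions (Suc M) n) = card (bounded_partitions M n) +
     (if Suc M \<le> n then card (bounded_partitions (Suc M) (n - Suc M)) else 0)"
proof -
  have "bounded_partitions M n \<inter> (Cons (Suc M) ` bounded_partitions (Suc M) (n - Suc M)) = {}"
    by (auto simp: bounded_partitions_def)
  moreover have "card (Cons (Suc M) ` bounded_partitions (Suc M) (n - Suc M)) =
      card (bounded_partitions (Suc M) (n - Suc M))"
    by (rule card_image) simp
  ultimately show ?thesis
    by (subst bounded_partitions_Suc) (simp add: card_Un_disjoint finite_bounded_partitions)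
qed

lemma bounded_partitions_eq: "n \<le> M \<Longrightarrow> bounded_partitions M n = partitions n"
  unfolding bounded_partitions_def partitions_def
  by (auto dest: member_le_sum_list)

section \<open>Fourier coefficients of the finite Euler products\<close>

definition euler_prod :: "nat \<Rightarrow> complex \<Rightarrow> complex" where
  "euler_prod M t = (\<Prod>m=1..M. 1 / (1 - exp (- (2 * of_real pi * of_nat m * t))))"

lemma norm_exp_neg_lt_1:
  assumes "Re t > 0" "m > 0"
  shows "norm (exp (- (2 * of_real pi * of_nat m * t))) < 1"
  using assms by (simp only: norm_exp_eq_Re) simp

lemma exp_neg_neq_1:
  assumes "Re t > 0" "m > 0"
  shows "1 - exp (- (2 * of_real pi * of_nat m * t)) \<noteq> 0"
  using norm_exp_neg_lt_1[OF assms] by (metis eq_iff_diff_eq_0 less_irrefl norm_one)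

text \<open>The frequency \<open>j\<close> is an integer because the recurrence has to be followed
  down to negative indices. The starting point \<open>a\<close> of the period is free so that an arc
  around a cusp need not be cut in two.\<close>

definition euler_coeff :: "real \<Rightarrow> real \<Rightarrow> nat \<Rightarrow> int \<Rightarrow> complex" where
  "euler_coeff a y M j = integral {a..a + 1} (\<lambda>x. exp (2 * of_real pi * of_int j * Complex y x) * euler_prod M (Complex y x))"

lemma continuous_on_euler_prod:
  assumes "y > 0"
  shows "continuous_on S (\<lambda>x. euler_prod M (Complex y x))"
  unfolding euler_prod_def using assms
  by (intro continuous_intros ballI exp_neg_neq_1) auto

text \<open>With q = exp (-2 pi (M+1) t), the new factor satisfies 1 / (1 - q) = 1 + q / (1 - q),
  and multiplication by q lowers the frequency by M + 1. This is the recurrence of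
  \<open>card_bounded_partitions_Suc\<close>.\<close>

lemma euler_coeff_Suc:
  assumes "y > 0"
  shows "euler_coeff a y (Suc M) j = euler_coeff a y M j + euler_coeff a y (Suc M) (j - int (Suc M))"
proof -
  let ?g = "\<lambda>(M::nat) (j::int) x. exp (2 * of_real pi * of_int j * Complex y x) * euler_prod M (Complex y x)"
  have int: "?g M j integrable_on {a..a + 1}" for M j
    by (intro integrable_continuous_interval continuous_intros continuous_on_euler_prod assms)
  have "?g (Suc M) j x = ?g M j x + ?g (Suc M) (j - int (Suc M)) x" for x
  proof -
    define q where "q = exp (- (2 * of_real pi * of_nat (Suc M) * Complex y x))"
    define P where "P = euler_prod M (Complex y x)"
    have q: "1 - q \<noteq> 0" unfolding q_def by (rule exp_neg_neq_1) (use assms in auto)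
    have e: "exp (2 * of_real pi * of_int (j - int (Suc M)) * Complex y x) = exp (2 * of_real pi * of_int j * Complex y x) * q"
      unfolding q_def exp_add[symmetric] by (rule arg_cong[of _ _ exp]) (simp add: algebra_simps)
    have P: "euler_prod (Suc M) (Complex y x) = P / (1 - q)"
      by (simp add: euler_prod_def P_def q_def prod.nat_ivl_Suc')
    show ?thesis unfolding e P P_def[symmetric] using q by (simp add: field_simps)
  qed
  then show ?thesis
    unfolding euler_coeff_def using integral_add[OF int[of j M] int[of "j - int (Suc M)" "Suc M"]] by simp
qed

lemma euler_coeff_0:
  assumes "y > 0"
  shows "euler_coeff a y 0 j = (if j = 0 then 1 else 0)"
proof (cases "j = 0")
  case True
  then show ?thesis by (simp add: euler_coeff_def euler_prod_def)
next
  case False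
  define c where "c = 2 * of_real pi * of_int j * \<i>"
  have c: "c \<noteq> 0" using False by (simp add: c_def)
  define G where "G x = exp (2 * of_real pi * of_int j * Complex y x) / c" for x
  have "((\<lambda>x. exp (2 * of_real pi * of_int j * Complex y x)) has_integral (G (a + 1) - G a)) {a..a+1}"
  proof (rule fundamental_theorem_of_calculus)
    fix x :: real
    have "((\<lambda>x. Complex y x) has_vector_derivative \<i>) (at x within {a..a+1})"
      unfolding has_vector_derivative_complex_iff by (auto intro!: derivative_eq_intros)
    then have "((\<lambda>x. 2 * of_real pi * of_int j * Complex y x) has_vector_derivative c) (at x within {a..a+1})"
      unfolding c_def by (rule has_vector_derivative_mult_right)
    from field_vector_diff_chain_within[OF this, of exp "exp (2 * of_real pi * of_int j * Complex y x)"]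
    have "((\<lambda>x. exp (2 * of_real pi * of_int j * Complex y x)) has_vector_derivative
       (c * exp (2 * of_real pi * of_int j * Complex y x))) (at x within {a..a+1})"
      by (simp add: o_def DERIV_exp has_field_derivative_at_within)
    from has_vector_derivative_divide[OF this, of c]
    show "(G has_vector_derivative exp (2 * of_real pi * of_int j * Complex y x)) (at x within {a..a+1})"
      unfolding G_def[abs_def] using c by simp
  qed simp
  moreover have "G (a + 1) = G a"
  proof -
    have "2 * of_real pi * of_int j * Complex y (a + 1) = 2 * of_real pi * of_int j * Complex y a + \<i> * (of_int j * (of_real pi * 2))"
    proof -
      have "Complex y (a + 1) = Complex y a + \<i>" by (simp add: complex_eq_iff)
      then show ?thesis by (simp only: distrib_left) (simp add: mult_ac)
    qed
    then show ?thesis by (simp add: G_def)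
  qed
  ultimately show ?thesis using False by (simp add: euler_coeff_def euler_prod_def integral_unique)
qed

lemma euler_coeff_bound:
  assumes "y > 0"
  obtains B where "\<And>j. norm (euler_coeff a y M j) \<le> B * exp (2 * pi * of_int j * y)"
proof -
  have "compact ((\<lambda>x. euler_prod M (Complex y x)) ` {a..a+1})"
    by (intro compact_continuous_image continuous_on_euler_prod assms) simp
  then obtain B where B: "\<And>x. x \<in> {a..a+1} \<Longrightarrow> norm (euler_prod M (Complex y x)) \<le> B"
    by (meson bounded_iff compact_imp_bounded imageI)
  have "norm (euler_coeff a y M j) \<le> B * exp (2 * pi * of_int j * y)" for j
  proof -
    have "norm (euler_coeff a y M j) \<le> B * exp (2 * pi * of_int j * y) * (a + 1 - a)"
      unfolding euler_coeff_def
    proof (rule integral_bound)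
      show "continuous_on {a..a+1} (\<lambda>x. exp (2 * of_real pi * of_int j * Complex y x) * euler_prod M (Complex y x))"
        by (intro continuous_intros continuous_on_euler_prod assms)
      fix x assume "x \<in> {a..a+1}"
      from mult_right_mono[OF B[OF this], of "exp (2 * pi * of_int j * y)"]
      show "norm (exp (2 * of_real pi * of_int j * Complex y x) * euler_prod M (Complex y x)) \<le> B * exp (2 * pi * of_int j * y)"
        by (simp add: norm_mult mult.commute)
    qed simp
    then show ?thesis by simp
  qed
  then show ?thesis using that by blast
qed

text \<open>Both sides satisfy the same recurrence in \<open>j\<close> with step \<open>M\<close>, and the integral tends to 0 as \<open>j \<rightarrow> -\<infinity>\<close>.\<close>

lemma euler_coeff_eq:
  assumes "y > 0"
  shows "euler_coeff a y M j = (if j < 0 then 0 else of_nat (card (bounded_partitions M (nat j))))"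
proof (induction M arbitrary: j)
  case 0
  then show ?case by (simp add: euler_coeff_0[OF assms] bounded_partitions_0)
next
  case (Suc M)
  define b :: "nat \<Rightarrow> int \<Rightarrow> complex"
    where "b M j = (if j < 0 then 0 else of_nat (card (bounded_partitions M (nat j))))" for M j
  have b: "b (Suc M) j = b M j + b (Suc M) (j - int (Suc M))" for j
  proof -
    have "nat (j - int (Suc M)) = nat j - Suc M" by linarith
    then show ?thesis by (auto simp: b_def card_bounded_partitions_Suc[of M "nat j"])
  qed
  define \<delta> where "\<delta> j = euler_coeff a y (Suc M) j - b (Suc M) j" for j
  have step: "\<delta> j = \<delta> (j - int (Suc M))" for j
    using Suc[of j] euler_coeff_Suc[OF assms, of a M j] b[of j] by (simp add: \<delta>_def b_def)
  have iter: "\<delta> j = \<delta> (j - int N * int (Suc M))" for N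
  proof (induction N)
    case (Suc N)
    then show ?case using step[of "j - int N * int (Suc M)"] by (simp add: algebra_simps)
  qed simp
  obtain B where B: "\<And>j. norm (euler_coeff a y (Suc M) j) \<le> B * exp (2 * pi * of_int j * y)"
    using euler_coeff_bound[OF assms] by blast
  define r where "r = exp (- (2 * pi * y))"
  have r: "0 < r" "r < 1" using assms by (auto simp: r_def)
  have "norm (\<delta> j) \<le> (B * exp (2 * pi * of_int j * y)) * r ^ N" if N: "N > nat j" for N
  proof -
    \<comment> \<open>As \<open>Suc M\<close> is at least 1, \<open>N > nat j\<close> already pushes
      the shifted index below 0, where the counting side is 0 by definition and only the integral
      remains.\<close>
    have "int N * 1 \<le> int N * int (Suc M)" by (intro mult_left_mono) auto
    then have neg: "j - int N * int (Suc M) < 0" using N by linarith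
    have B0: "0 \<le> B" using order_trans[OF norm_ge_zero B[of 0]] by simp
    have "norm (\<delta> j) = norm (euler_coeff a y (Suc M) (j - int N * int (Suc M)))"
      using iter[of N] neg by (simp add: \<delta>_def b_def)
    also have "\<dots> \<le> B * exp (2 * pi * of_int (j - int N * int (Suc M)) * y)" by (rule B)
    also have "\<dots> \<le> B * exp (2 * pi * of_int (j - int N) * y)"
    proof -
      have "real_of_int (j - int N * int (Suc M)) \<le> of_int (j - int N)"
        unfolding of_int_le_iff using \<open>int N * 1 \<le> int N * int (Suc M)\<close> by simp
      then have "2 * pi * of_int (j - int N * int (Suc M)) * y \<le> 2 * pi * of_int (j - int N) * y"
        using assms by (intro mult_right_mono mult_left_mono) auto
      then show ?thesis using B0 by (intro mult_left_mono) auto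
    qed
    also have "\<dots> = (B * exp (2 * pi * of_int j * y)) * r ^ N"
      by (simp add: r_def exp_of_nat_mult[symmetric] exp_add[symmetric]) (simp add: algebra_simps)
    finally show ?thesis .
  qed
  then have "eventually (\<lambda>N. norm (\<delta> j) \<le> (B * exp (2 * pi * of_int j * y)) * r ^ N) sequentially"
    by (intro eventually_mono[OF eventually_gt_at_top[of "nat j"]])
  moreover have "(\<lambda>N. (B * exp (2 * pi * of_int j * y)) * r ^ N) \<longlonglongrightarrow> (B * exp (2 * pi * of_int j * y)) * 0"
    by (intro tendsto_intros LIMSEQ_power_zero) (use r in auto)
  ultimately have "norm (\<delta> j) \<le> 0"
    by (intro tendsto_le[OF _ _ tendsto_const]) auto
  then show ?case by (simp add: \<delta>_def b_def)
qed

text \<open>Each \<open>- Ln (1 - q ^ m)\<close> is expanded as a power series and the finite sum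
  over m is moved inside. The inner geometric sum turns the k-th coefficient into a Lambert term
  with the correcting factor 1 - q^(k M).\<close>

lemma euler_prod_eq_exp:
  assumes "Re t > 0"
  shows "(\<lambda>k. (1 - exp (- (2 * of_real pi * of_nat (Suc k) * t)) ^ M) /
            (of_nat (Suc k) * (exp (2 * of_real pi * of_nat (Suc k) * t) - 1))) sums
         (\<Sum>m=1..M. - Ln (1 - exp (- (2 * of_real pi * of_nat m * t))))"
    and "euler_prod M t = exp (\<Sum>m=1..M. - Ln (1 - exp (- (2 * of_real pi * of_nat m * t))))"
proof -
  define q where "q = exp (- (2 * of_real pi * t))"
  have qm: "exp (- (2 * of_real pi * of_nat m * t)) = q ^ m" for m
    by (simp add: q_def exp_of_nat_mult[symmetric] mult_ac)
  have ln: "(\<lambda>k. (q ^ m) ^ Suc k / of_nat (Suc k)) sums (- Ln (1 - q ^ m))" if "m > 0" for m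
  proof -
    have "norm (- (q ^ m)) < 1" using norm_exp_neg_lt_1[OF assms that] by (simp add: qm)
    from sums_minus[OF Ln_series'[OF this]]
    have "(\<lambda>k. (q ^ m) ^ k / of_nat k) sums (- Ln (1 - q ^ m))" by simp
    \<comment> \<open>The term with index 0 is \<open>1 / 0 = 0\<close>, so the shifted series has
      the same sum.\<close>
    from sums_Suc_iff[THEN iffD2, of "\<lambda>k. (q ^ m) ^ k / of_nat k"] this show ?thesis
      by (simp add: sums_Suc_iff del: of_nat_Suc power_Suc)
  qed
  have "(\<lambda>k. \<Sum>m=1..M. (q ^ m) ^ Suc k / of_nat (Suc k)) sums (\<Sum>m=1..M. - Ln (1 - q ^ m))"
    by (intro sums_sum ln) auto
  moreover have "(\<Sum>m=1..M. (q ^ m) ^ Suc k / of_nat (Suc k)) = (1 - (q ^ Suc k) ^ M) / (of_nat (Suc k) * (exp (2 * of_real pi * of_nat (Suc k) * t) - 1))" for k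
  proof -
    define x where "x = q ^ Suc k"
    have x: "1 - x \<noteq> 0" "x \<noteq> 0"
      using exp_neg_neq_1[OF assms, of "Suc k"] by (auto simp: x_def qm q_def simp del: of_nat_Suc power_Suc)
    have e: "exp (2 * of_real pi * of_nat (Suc k) * t) = 1 / x"
      unfolding x_def qm[symmetric] exp_minus by (simp add: inverse_eq_divide)
    have "(\<Sum>m=1..M. (q ^ m) ^ Suc k) = (\<Sum>m=1..M. x ^ m)"
      by (simp add: x_def power_mult[symmetric] mult.commute del: power_Suc)
    also have "\<dots> = (\<Sum>m<M. x ^ Suc m)"
      by (rule sum.reindex_bij_witness[of _ Suc "\<lambda>k. k - 1"]) auto
    also have "\<dots> = x * (\<Sum>m<M. x ^ m)" by (simp add: sum_distrib_left)
    also have "\<dots> = x * ((1 - x ^ M) / (1 - x))" using x by (subst sum_gp_strict) auto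
    also have "\<dots> = (1 - x ^ M) / (1 / x - 1)" using x by (simp add: field_simps)
    finally show ?thesis unfolding e x_def[symmetric]
      by (simp add: sum_divide_distrib[symmetric] del: of_nat_Suc)
  qed
  ultimately show "(\<lambda>k. (1 - exp (- (2 * of_real pi * of_nat (Suc k) * t)) ^ M) /
            (of_nat (Suc k) * (exp (2 * of_real pi * of_nat (Suc k) * t) - 1))) sums
         (\<Sum>m=1..M. - Ln (1 - exp (- (2 * of_real pi * of_nat m * t))))"
    unfolding qm by simp
  show "euler_prod M t = exp (\<Sum>m=1..M. - Ln (1 - exp (- (2 * of_real pi * of_nat m * t))))"
    unfolding exp_sum[OF finite_atLeastAtMost] euler_prod_def
    by (rule prod.cong) (use exp_neg_neq_1[OF assms] in \<open>auto simp: exp_minus inverse_eq_divide exp_Ln\<close>)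
qed

text \<open>The series of the logarithm \<open>S M\<close> differs from that of
  \<open>lambert t\<close> by the factors \<open>q k ^ M\<close>. Since
  \<open>norm (q k) \<le> r < 1\<close> for all k at once, the difference is at most
  \<open>r ^ M * L\<close>. The first bound depends on t only through \<open>Re t\<close> and thus
  serves as a majorant along a vertical line.\<close>

lemma euler_prod_approx:
  assumes "Re t > 0"
  defines "L \<equiv> (\<Sum>k. 1 / (real (Suc k) * (exp (2 * pi * real (Suc k) * Re t) - 1)))"
  shows "norm (euler_prod M t) \<le> exp (2 * L)" "(\<lambda>M. euler_prod M t) \<longlonglongrightarrow> exp (lambert t)"
proof -
  define S where "S M = (\<Sum>m=1..M. - Ln (1 - exp (- (2 * of_real pi * of_nat m * t))))" for M
  define a where "a k = 1 / (of_nat (Suc k) * (exp (2 * of_real pi * of_nat (Suc k) * t) - 1))" for k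
  define q where "q k = exp (- (2 * of_real pi * of_nat (Suc k) * t))" for k
  define r where "r = exp (- (2 * pi * Re t))"
  have r: "0 < r" "r < 1" using assms by (auto simp: r_def)
  have q: "norm (q k) \<le> r" for k
  proof -
    have "Re t * 1 \<le> Re t * real (Suc k)" using assms by (intro mult_left_mono) auto
    then show ?thesis unfolding q_def r_def norm_exp_eq_Re by (simp add: algebra_simps)
  qed
  have S: "(\<lambda>k. (1 - q k ^ M) * a k) sums S M" for M
    using euler_prod_eq_exp(1)[OF assms(1), of M] by (simp add: S_def q_def a_def)
  have lam: "a sums lambert t" using sums_lambert[OF assms(1)] by (simp add: a_def[abs_def])
  have abs_a: "norm (a k) \<le> 1 / (real (Suc k) * (exp (2 * pi * real (Suc k) * Re t) - 1))" for k
    unfolding a_def by (rule norm_lambert_term_le[OF assms(1) order_refl])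
  note sL = summable_lambert_real[OF assms(1)]
  have diff: "norm (lambert t - S M) \<le> r ^ M * L" for M
  proof -
    have d: "(\<lambda>k. q k ^ M * a k) sums (lambert t - S M)"
      using sums_diff[OF lam S[of M]] by (simp add: algebra_simps)
    have "norm (\<Sum>k. q k ^ M * a k) \<le> (\<Sum>k. r ^ M * (1 / (real (Suc k) * (exp (2 * pi * real (Suc k) * Re t) - 1))))"
    proof (rule norm_suminf_le)
      show "norm (q k ^ M * a k) \<le> r ^ M * (1 / (real (Suc k) * (exp (2 * pi * real (Suc k) * Re t) - 1)))" for k
        unfolding norm_mult norm_power using r by (intro mult_mono power_mono q abs_a) auto
    qed (intro summable_mult sL)
    also have "\<dots> = r ^ M * L" unfolding L_def by (rule suminf_mult[OF sL])
    finally show ?thesis using d by (simp add: sums_iff)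
  qed
  have normlam: "norm (lambert t) \<le> L"
    using norm_suminf_le[OF abs_a sL] lam by (simp add: sums_iff L_def)
  have L0: "0 \<le> L" using normlam norm_ge_zero order_trans by blast
  have "norm (S M) \<le> L + r ^ M * L"
    using diff[of M] normlam norm_triangle_ineq4[of "lambert t" "lambert t - S M"] by simp
  also have "\<dots> \<le> L + 1 * L" using r L0 by (intro add_left_mono mult_right_mono power_le_one) auto
  finally have "norm (S M) \<le> 2 * L" by simp
  then have "Re (S M) \<le> 2 * L" using complex_Re_le_cmod order_trans by blast
  then show "norm (euler_prod M t) \<le> exp (2 * L)"
    using euler_prod_eq_exp(2)[OF assms(1), of M] by (simp add: S_def)
  have "(\<lambda>M. r ^ M * L) \<longlonglongrightarrow> 0 * L"
    by (intro tendsto_intros LIMSEQ_power_zero) (use r in auto)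
  then have g0: "(\<lambda>M. r ^ M * L) \<longlonglongrightarrow> 0" by simp
  have "(\<lambda>M. lambert t - S M) \<longlonglongrightarrow> 0"
    by (rule Lim_null_comparison[OF _ g0]) (use diff in \<open>simp add: always_eventually\<close>)
  then have "(\<lambda>M. lambert t - (lambert t - S M)) \<longlonglongrightarrow> lambert t - 0" by (intro tendsto_intros)
  then have "(\<lambda>M. exp (S M)) \<longlonglongrightarrow> exp (lambert t)" by (intro tendsto_exp) simp
  then show "(\<lambda>M. euler_prod M t) \<longlonglongrightarrow> exp (lambert t)"
    using euler_prod_eq_exp(2)[OF assms(1)] by (simp add: S_def)
qed

lemma continuous_on_lambert:
  assumes "y > 0"
  shows "continuous_on S (\<lambda>x. lambert (Complex y x))"
proof -
  have "continuous_on S (\<lambda>x. Complex y x)" by (intro continuous_intros)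
  moreover have "(\<lambda>x. Complex y x) ` S \<subseteq> {t. Re t > 0}" using assms by auto
  ultimately show ?thesis
    using continuous_on_compose2[OF holomorphic_on_imp_continuous_on[OF holomorphic_lambert]] by simp
qed

text \<open>For \<open>n \<le> M\<close> the coefficient of the finite product already equals p(n),
  so the limit in \<open>M\<close> is needed only on the integral side. No power series for the
  partition numbers has to be summed.\<close>

theorem part_num_integral:
  assumes "y > 0"
  shows "of_nat (part_num n) =
    integral {a..a + 1} (\<lambda>x. exp (2 * of_real pi * of_nat n * Complex y x) * exp (lambert (Complex y x)))"
proof -
  let ?g = "\<lambda>M x. exp (2 * of_real pi * of_nat n * Complex y x) * euler_prod M (Complex y x)"
  define L where "L = (\<Sum>k. 1 / (real (Suc k) * (exp (2 * pi * real (Suc k) * y) - 1)))"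
  have lim: "(\<lambda>M. integral {a..a+1} (?g M)) \<longlonglongrightarrow>
     integral {a..a + 1} (\<lambda>x. exp (2 * of_real pi * of_nat n * Complex y x) * exp (lambert (Complex y x)))"
  proof (rule dominated_convergence)
    show "?g M integrable_on {a..a+1}" for M
      by (intro integrable_continuous_interval continuous_intros continuous_on_euler_prod assms)
    show "(\<lambda>x. exp (2 * pi * real n * y) * exp (2 * L)) integrable_on {a..a+1}"
      by (rule integrable_const_ivl)
    show "norm (?g M x) \<le> exp (2 * pi * real n * y) * exp (2 * L)" if "x \<in> {a..a+1}" for M x
      using euler_prod_approx(1)[of "Complex y x" M] assms by (simp add: norm_mult L_def)
    show "(\<lambda>M. ?g M x) \<longlonglongrightarrow> exp (2 * of_real pi * of_nat n * Complex y x) * exp (lambert (Complex y x))" if "x \<in> {a..a+1}" for x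
      using euler_prod_approx(2)[of "Complex y x"] assms by (intro tendsto_intros) auto
  qed
  have "integral {a..a+1} (?g M) = of_nat (part_num n)" if "n \<le> M" for M
    using euler_coeff_eq[OF assms, of a M "int n"] bounded_partitions_eq[OF that]
    by (simp add: euler_coeff_def part_num_def)
  then have "(\<lambda>M. integral {a..a+1} (?g M)) \<longlonglongrightarrow> of_nat (part_num n)"
    by (intro tendsto_eventually) (auto simp: eventually_at_top_linorder)
  from LIMSEQ_unique[OF this lim] show ?thesis .
qed

section \<open>Modular behaviour\<close>

text \<open>This is \<open>- ln \<bar>\<eta>\<bar> - ln (Im \<tau>) / 4\<close> at \<open>\<tau> = \<i> t\<close>, which is invariant under the modular group.\<close>

definition eta_height :: "complex \<Rightarrow> real" where
  "eta_height t = Re (lambert t) + pi / 12 * Re t - ln (Re t) / 4"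

lemma Re_inverse_eq: "Re (1 / t) = Re t / (norm t)\<^sup>2"
  by (simp add: Re_divide cmod_power2)

text \<open>The term \<open>ln (norm t) / 2\<close> from the inversion formula is matched by
  \<open>ln (Re (1 / t)) = ln (Re t) - 2 * ln (norm t)\<close>; the terms with
  \<open>pi / 12\<close> change places.\<close>

lemma eta_height_inverse:
  assumes "Re t > 0"
  shows "eta_height (1 / t) = eta_height t"
proof -
  have t: "t \<noteq> 0" using assms by auto
  then have nt: "norm t > 0" by simp
  have "Re (lambert t) = Re (lambert (1 / t)) + pi / 12 * (Re (1 / t) - Re t) + ln (norm t) / 2"
    using arg_cong[OF lambert_inversion[OF assms], of Re] t by simp
  moreover have "ln (Re (1 / t)) = ln (Re t) - 2 * ln (norm t)"
    unfolding Re_inverse_eq using assms nt by (simp add: ln_div ln_realpow)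
  ultimately show ?thesis unfolding eta_height_def by (simp add: algebra_simps add_divide_distrib diff_divide_distrib)
qed

lemma eta_height_add_int: "eta_height (t + of_int j * \<i>) = eta_height t"
  by (simp add: eta_height_def lambert_add_int_ii)

text \<open>After a translation to \<open>\<bar>Im t\<bar> \<le> 1/2\<close>, each inversion at least doubles \<open>Re t\<close> as long as \<open>Re t < 1/2\<close>.\<close>

lemma modular_reduction:
  assumes "1 / 2 / 2 ^ n \<le> Re t"
  shows "\<exists>c d t'. coprime c d \<and> 1 / 2 \<le> Re t' \<and> eta_height t' = eta_height t \<and>
           Re t' = Re t / (norm (of_int c * (\<i> * t) + of_int d))\<^sup>2"
  using assms
proof (induction n arbitrary: t)
  case 0
  then show ?case by (intro exI[of _ 0] exI[of _ 1] exI[of _ t]) auto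
next
  case (Suc n)
  have pos: "Re t > 0" using Suc.prems by (smt (verit) zero_less_divide_iff zero_less_power)
  show ?case
  proof (cases "1 / 2 \<le> Re t")
    case True
    then show ?thesis by (intro exI[of _ 0] exI[of _ 1] exI[of _ t]) auto
  next
    case False
    define j where "j = round (Im t)"
    define t0 where "t0 = t + of_int (- j) * \<i>"
    have Re0: "Re t0 = Re t" by (simp add: t0_def)
    have Im0: "\<bar>Im t0\<bar> \<le> 1 / 2"
      using of_int_round_abs_le[of "Im t"] by (simp add: t0_def j_def abs_minus_commute)
    have t0: "t0 \<noteq> 0" using Re0 pos by auto
    have "(Im t0)\<^sup>2 \<le> (1 / 2)\<^sup>2" using Im0 by (simp add: abs_le_square_iff[symmetric])
    moreover have "(Re t0)\<^sup>2 \<le> (1 / 2)\<^sup>2" using Re0 pos False by (intro power_mono) auto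
    ultimately have norm0: "(norm t0)\<^sup>2 \<le> 1 / 2" unfolding cmod_power2 power_divide by simp
    have Re1: "Re (1 / t0) = Re t / (norm t0)\<^sup>2" by (simp add: Re_inverse_eq Re0)
    have "1 / 2 / 2 ^ n \<le> 2 * Re t" using Suc.prems by simp
    also have "2 * Re t = Re t / (1 / 2)" by simp
    also have "\<dots> \<le> Re t / (norm t0)\<^sup>2"
      using pos t0 norm0 by (intro divide_left_mono) auto
    finally have "1 / 2 / 2 ^ n \<le> Re (1 / t0)" by (simp only: Re1)
    from Suc.IH[OF this] obtain c d t' where IH: "coprime c d" "1 / 2 \<le> Re t'"
      "eta_height t' = eta_height (1 / t0)"
      "Re t' = Re (1 / t0) / (norm (of_int c * (\<i> * (1 / t0)) + of_int d))\<^sup>2" by blast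
    \<comment> \<open>The pair (c, d) is the lower row of the modular matrix acting on
      \<open>\<i> * t\<close>. Composing with the translation by -j and the inversion replaces it by
      (d, d j - c), which is again coprime.\<close>
    have "norm t0 * norm (of_int c * (\<i> * (1 / t0)) + of_int d) = norm (\<i> * (t0 * (of_int c * (\<i> * (1 / t0)) + of_int d)))"
      by (simp add: norm_mult)
    also have "\<i> * (t0 * (of_int c * (\<i> * (1 / t0)) + of_int d)) = of_int d * (\<i> * t) + of_int (d * j - c)"
      using t0 by (simp add: distrib_left) (simp add: t0_def algebra_simps)
    finally have "Re t' = Re t / (norm (of_int d * (\<i> * t) + of_int (d * j - c)))\<^sup>2"
      unfolding IH(4) Re1 by (simp add: power_mult_distrib[symmetric])
    moreover have "coprime d (d * j - c)"
    proof -
      have "coprime c d" by (rule IH)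
      moreover have "gcd d (d * j - c) = gcd d c"
        by (metis gcd_add_mult gcd_neg2 minus_diff_eq diff_conv_add_uminus mult.commute add.commute uminus_add_conv_diff)
      ultimately show ?thesis by (simp add: coprime_iff_gcd_eq_1 gcd.commute)
    qed
    moreover have "eta_height t' = eta_height t"
      unfolding IH(3) using eta_height_inverse[of t0] Re0 pos eta_height_add_int[of t "- j"] by (simp add: t0_def)
    ultimately show ?thesis using IH(2) by blast
  qed
qed

text \<open>Invariance of \<open>eta_height\<close> contributes the fourth root of y / Re t', which
  is at most (2 y)^(1/4). Since y \<le> 1/100 \<le> 1/(32 e), this absorbs the loss exp (1/4) from
  \<open>lambert t'\<close> and leaves the factor 1/2, which makes room for the error of the major
  arcs.\<close>

lemma norm_exp_lambert_le_of_reduced: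
  assumes y: "0 < y" "y \<le> 1 / 100"
    and t: "Re t = y" and t': "1 / 2 \<le> Re t'" "Re t' \<le> Y" "eta_height t' = eta_height t"
  shows "norm (exp (lambert t)) \<le> exp (pi / 12 * (Y - y)) / 2"
proof -
  have "norm (lambert t') \<le> 2 * (1 / 8)"
    using norm_lambert_le[OF t'(1)] exp_minus_2pi_le[OF t'(1)] by linarith
  then have lam: "Re (lambert t') \<le> 1 / 4" using complex_Re_le_cmod[of "lambert t'"] by linarith
  have ln2: "- ln (Re t') \<le> ln 2"
    using t'(1) ln_le_cancel_iff[of "1 / 2" "Re t'"] by (simp add: ln_div)
  have ly: "ln y \<le> - 1 - 5 * ln 2"
  proof -
    have "exp (1::real) \<le> 3" using exp_le by simp
    then have "exp 1 * 32 * y \<le> 3 * 32 * (1 / 100)" using y by (intro mult_mono) auto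
    then have "y \<le> 1 / (exp 1 * 32)" by (simp add: field_simps)
    then have "ln y \<le> ln (1 / (exp 1 * 32))" using y by simp
    also have "\<dots> = - 1 - ln (2 ^ 5)" by (simp add: ln_div ln_mult)
    also have "ln (2 ^ 5) = 5 * ln (2::real)" by (subst ln_realpow) auto
    finally show ?thesis .
  qed
  have "Re (lambert t) = Re (lambert t') + pi / 12 * (Re t' - y) - ln (Re t') / 4 + ln y / 4"
    using t'(3) t unfolding eta_height_def by (simp add: right_diff_distrib)
  also have "\<dots> \<le> pi / 12 * (Y - y) - ln 2"
  proof -
    have "pi / 12 * (Re t' - y) \<le> pi / 12 * (Y - y)" using t'(2) by (intro mult_left_mono) auto
    then show ?thesis using lam ln2 ly by linarith
  qed
  finally have "exp (Re (lambert t)) \<le> exp (pi / 12 * (Y - y) - ln 2)" by simp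
  then show ?thesis by (simp add: exp_diff)
qed

text \<open>The hypotheses keep the point outside the horocycles at the cusps with denominators 1
  and 2, that is, a modular image with lower row |c| = 1 or |c| = 2 has real part at most 1/2. The
  row c = 0 leaves the real part y unchanged, and |c| \<ge> 3 gives at most 1 / (9 y), which
  therefore is the worst case.\<close>

lemma norm_exp_lambert_minor_arc:
  assumes y: "0 < y" "y \<le> 1 / 100"
    and int: "\<And>j::int. 2 * y - y\<^sup>2 \<le> (x - of_int j)\<^sup>2"
    and half: "\<And>j::int. odd j \<Longrightarrow> y / 2 - y\<^sup>2 \<le> (x - of_int j / 2)\<^sup>2"
  shows "norm (exp (lambert (Complex y x))) \<le> exp (pi / 12 * (1 / (9 * y) - y)) / 2"
proof -
  obtain n where "(1 / 2) ^ n < y" using real_arch_pow_inv[OF y(1), of "1 / 2"] by auto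
  then have "1 / 2 / 2 ^ n \<le> Re (Complex y x)" using y by (simp add: power_divide field_simps)
  from modular_reduction[OF this] obtain c d t' where
    red: "coprime c d" "1 / 2 \<le> Re t'" "eta_height t' = eta_height (Complex y x)"
      "Re t' = y / (norm (of_int c * (\<i> * Complex y x) + of_int d))\<^sup>2" by auto
  have nrm: "(norm (of_int c * (\<i> * Complex y x) + of_int d))\<^sup>2 = (of_int d - of_int c * x)\<^sup>2 + (of_int c * y)\<^sup>2"
    by (simp add: cmod_power2)
  have y9: "1 / 2 \<le> 1 / (9 * y)" using y by (simp add: field_simps)
  have bound: "Re t' \<le> 1 / 2" if "2 * y \<le> (of_int d - of_int c * x)\<^sup>2 + (of_int c * y)\<^sup>2"
  proof -
    have "y / ((of_int d - of_int c * x)\<^sup>2 + (of_int c * y)\<^sup>2) \<le> y / (2 * y)"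
      using that y by (intro divide_left_mono mult_pos_pos) auto
    then show ?thesis using y by (simp add: red(4) nrm)
  qed
  have "Re t' \<le> 1 / (9 * y)"
  proof -
    consider "c = 0" | "\<bar>c\<bar> = 1" | "\<bar>c\<bar> = 2" | "\<bar>c\<bar> \<ge> 3" by linarith
    then show ?thesis
    proof cases
      case 1
      then have "\<bar>d\<bar> = 1" using red(1) by simp
      then have "(of_int d :: real)\<^sup>2 = 1" by (metis of_int_abs of_int_1 power2_abs one_power2)
      then have "Re t' = y" using 1 by (simp add: red(4) nrm)
      then show ?thesis using y y9 by linarith
    next
      case 2
      then have "c\<^sup>2 = 1" by (metis one_power2 power2_abs)
      then have c2: "(of_int c :: real)\<^sup>2 = 1" by (metis of_int_1 of_int_power)
      then have "(of_int d - of_int c * x)\<^sup>2 = (x - of_int (c * d))\<^sup>2"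
      proof -
        have "(of_int d - of_int c * x)\<^sup>2 = (of_int c :: real)\<^sup>2 * (of_int d - of_int c * x)\<^sup>2" using c2 by simp
        also have "\<dots> = (of_int c * of_int d - (of_int c)\<^sup>2 * x)\<^sup>2"
          by (simp add: power_mult_distrib[symmetric] algebra_simps power2_eq_square)
        finally show ?thesis using c2 by (simp add: power2_commute)
      qed
      then show ?thesis using int[of "c * d"] bound y9 c2 by (simp add: power_mult_distrib)
    next
      case 3
      then have "even c" by presburger
      \<comment> \<open>Coprimality makes the centre d/c a proper half-integer, so the second
        hypothesis is the one that applies.\<close>
      then have "odd d" using red(1) by (meson coprime_common_divisor odd_one)
      define s where "s = sgn c"
      have s: "c = 2 * s" "s\<^sup>2 = 1" using 3 unfolding s_def by (auto simp: sgn_if abs_if split: if_splits)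
      then have s2: "(of_int s :: real)\<^sup>2 = 1" by (metis of_int_1 of_int_power)
      have "odd s" using s(2) by (metis even_power odd_one zero_less_numeral)
      then have "odd (s * d)" using \<open>odd d\<close> by simp
      have "(of_int d - of_int c * x)\<^sup>2 = 4 * (x - of_int (s * d) / 2)\<^sup>2"
      proof -
        have "(of_int d - of_int c * x)\<^sup>2 = (of_int s :: real)\<^sup>2 * (of_int d - of_int c * x)\<^sup>2" using s2 by simp
        also have "\<dots> = (of_int s * of_int d - 2 * (of_int s)\<^sup>2 * x)\<^sup>2"
          by (simp add: s(1) power_mult_distrib[symmetric] algebra_simps power2_eq_square)
        also have "\<dots> = 4 * (x - of_int (s * d) / 2)\<^sup>2"
          unfolding s2 by (simp add: power2_eq_square algebra_simps)
        finally show ?thesis .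
      qed
      moreover have "(of_int c * y)\<^sup>2 = 4 * y\<^sup>2" using s2 by (simp add: s(1) power_mult_distrib)
      ultimately show ?thesis using half[OF \<open>odd (s * d)\<close>] bound y9 by simp
    next
      case 4
      then have "3\<^sup>2 \<le> \<bar>c\<bar>\<^sup>2" by (intro power_mono) auto
      then have "9 \<le> c\<^sup>2" by simp
      then have "real_of_int 9 \<le> of_int (c\<^sup>2)" by (simp only: of_int_le_iff)
      then have "9 \<le> (of_int c :: real)\<^sup>2" by simp
      then have "9 * y\<^sup>2 \<le> (of_int d - of_int c * x)\<^sup>2 + (of_int c * y)\<^sup>2"
        using mult_right_mono[of 9 "(of_int c :: real)\<^sup>2" "y\<^sup>2"]
        by (simp add: power_mult_distrib add_increasing)
      then have "y / ((of_int d - of_int c * x)\<^sup>2 + (of_int c * y)\<^sup>2) \<le> y / (9 * y\<^sup>2)"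
        using y by (intro divide_left_mono mult_pos_pos) (auto intro: less_le_trans[of 0 "9 * y\<^sup>2"])
      also have "y / (9 * y\<^sup>2) = 1 / (9 * y)" using y by (simp add: power2_eq_square)
      finally show ?thesis by (simp only: red(4) nrm)
    qed
  qed
  from norm_exp_lambert_le_of_reduced[OF y _ red(2) this red(3)] show ?thesis by simp
qed

section \<open>Exact transformation at the cusps 0 and 1/2\<close>

lemma exp_lambert_inversion:
  assumes "Re t > 0"
  shows "exp (lambert t) = csqrt t * exp (of_real (pi / 12) * (1 / t - t)) * exp (lambert (1 / t))"
proof -
  have "csqrt t = exp (Ln t / 2)" using assms by (intro csqrt_exp_Ln) auto
  then show ?thesis
    by (subst lambert_inversion[OF assms]) (simp add: exp_add mult_ac)
qed

text \<open>The cusp is sent to infinity by an inversion, the translation by \<open>2 * \<i>\<close>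
  and a second inversion. No root of unity survives: the product of the two square roots has the
  extra phase \<open>exp (\<i> * of_real (pi / 4))\<close>, and the constant part of the two
  exponents removes it. Hence the sign (-1)^n of the second term stems from
  \<open>exp (2 * of_real pi * of_nat n * t)\<close> alone.\<close>

lemma exp_lambert_half_cusp:
  assumes "Re w > 0"
  shows "exp (lambert (w + \<i> / 2)) = csqrt (2 * w) * exp (of_real (pi / 12) * (1 / (4 * w) - w)) *
           exp (lambert (1 / (4 * w) - \<i> / 2))"
proof -
  define t where "t = w + \<i> / 2"
  define s where "s = 1 / t + 2 * \<i>"
  have w: "w \<noteq> 0" and t0: "t \<noteq> 0" and Ret: "Re t > 0" using assms by (auto simp: t_def complex_eq_iff)
  have Res: "Re s > 0" using Re_inverse_pos[OF Ret] by (simp add: s_def)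
  have s0: "s \<noteq> 0" using Res by auto
  have ts: "t * s = 2 * \<i> * w" using t0 by (simp add: s_def distrib_left) (simp add: t_def algebra_simps)
  have inv_s: "1 / s = 1 / (4 * w) - \<i> / 2"
  proof -
    have "1 / s = t / (t * s)" using t0 by simp
    also have "\<dots> = t / (2 * \<i> * w)" by (simp only: ts)
    also have "\<dots> = 1 / (4 * w) - \<i> / 2" using w by (simp add: t_def field_simps)
    finally show ?thesis .
  qed
  have "exp (lambert t) = csqrt t * exp (of_real (pi / 12) * (1 / t - t)) * exp (lambert s)"
    using exp_lambert_inversion[OF Ret] lambert_add_int_ii[of "1 / t" 2] by (simp add: s_def)
  also have "exp (lambert s) = csqrt s * exp (of_real (pi / 12) * (1 / s - s)) * exp (lambert (1 / s))"
    by (rule exp_lambert_inversion[OF Res])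
  also have "csqrt t * exp (of_real (pi / 12) * (1 / t - t)) * (csqrt s * exp (of_real (pi / 12) * (1 / s - s)) * exp (lambert (1 / s)))
    = (csqrt t * csqrt s) * exp (of_real (pi / 12) * (1 / t - t) + of_real (pi / 12) * (1 / s - s)) * exp (lambert (1 / s))"
    by (simp add: exp_add mult_ac)
  also have "of_real (pi / 12) * (1 / t - t) + of_real (pi / 12) * (1 / s - s) = of_real (pi / 12) * (1 / (4 * w) - w) - \<i> * of_real (pi / 4)"
    unfolding inv_s by (simp add: s_def t_def algebra_simps)
  also have "csqrt t * csqrt s = exp (\<i> * of_real (pi / 4)) * csqrt (2 * w)"
  proof -
    have "csqrt t * csqrt s = exp (Ln t / 2 + Ln s / 2)" using t0 s0 by (simp add: csqrt_exp_Ln exp_add)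
    also have "Ln t / 2 + Ln s / 2 = \<i> * of_real (pi / 4) + Ln (2 * w) / 2"
    proof -
      \<comment> \<open>The product \<open>t * s = 2 * \<i> * w\<close> determines
        \<open>Ln t + Ln s\<close> up to a multiple of \<open>2 * pi * \<i>\<close>. Three imaginary
        parts smaller than pi/2 in modulus and the constant pi/2 add up to less than 2 pi, so the
        multiple is 0.\<close>
      have im: "\<bar>Im (Ln t)\<bar> < pi / 2" "\<bar>Im (Ln s)\<bar> < pi / 2" "\<bar>Im (Ln (2 * w))\<bar> < pi / 2"
        using Re_Ln_pos_lt Ret Res assms t0 s0 w by auto
      have "exp (Ln t + Ln s) = exp (\<i> * of_real (pi / 2) + Ln (2 * w))"
      proof -
        have "exp (\<i> * of_real (pi / 2)) = \<i>" by (metis cis_conv_exp cis_pi_half)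
        then show ?thesis using t0 s0 w ts unfolding exp_add by (simp add: mult.assoc)
      qed
      then obtain n :: int where n: "Ln t + Ln s = \<i> * of_real (pi / 2) + Ln (2 * w) + complex_of_real (real_of_int (2 * n) * pi) * \<i>"
        unfolding exp_eq by blast
      from arg_cong[OF n, of Im] have "Im (Ln t) + Im (Ln s) = pi / 2 + Im (Ln (2 * w)) + 2 * of_int n * pi"
        by simp
      then have *: "2 * of_int n * pi = Im (Ln t) + Im (Ln s) - pi / 2 - Im (Ln (2 * w))" by simp
      have "\<bar>2 * of_int n * pi\<bar> < 2 * pi" using im unfolding * by linarith
      then have "\<bar>real_of_int n\<bar> < 1" by (simp add: abs_mult)
      then have "n = 0" by linarith
      then have "(Ln t + Ln s) / 2 = (\<i> * of_real (pi / 2) + Ln (2 * w)) / 2" using n by simp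
      then show ?thesis by (simp add: add_divide_distrib)
    qed
    also have "exp (\<i> * of_real (pi / 4) + Ln (2 * w) / 2) = exp (\<i> * of_real (pi / 4)) * csqrt (2 * w)"
      using w by (simp add: exp_add csqrt_exp_Ln)
    finally show ?thesis .
  qed
  also have "exp (\<i> * of_real (pi / 4)) * csqrt (2 * w) * exp (of_real (pi / 12) * (1 / (4 * w) - w) - \<i> * of_real (pi / 4)) * exp (lambert (1 / s))
    = csqrt (2 * w) * exp (of_real (pi / 12) * (1 / (4 * w) - w)) * exp (lambert (1 / s))"
    by (simp add: exp_diff)
  finally show ?thesis unfolding t_def[symmetric] inv_s .
qed

section \<open>A primitive of the Gaussian\<close>

lemma gaussian_integral_le:
  assumes "0 \<le> S"
  shows "integral {0..S} (\<lambda>s. exp (- s\<^sup>2)) \<le> sqrt pi / 2"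
proof -
  have int: "integrable lborel (\<lambda>x. indicator {0..} x *\<^sub>R exp (- x\<^sup>2) :: real)"
    "(\<integral>x. indicator {0..} x *\<^sub>R exp (- x\<^sup>2) \<partial>lborel) = sqrt pi / 2"
    using gaussian_moment_0 by (auto simp: has_bochner_integral_iff)
  then have HI: "((\<lambda>x. indicator {0..} x *\<^sub>R exp (- x\<^sup>2)) has_integral sqrt pi / 2) (UNIV :: real set)"
    using has_integral_integral_lborel by metis
  have "((\<lambda>x. if x \<in> {0..} then exp (- x\<^sup>2) else 0) has_integral sqrt pi / 2) (UNIV :: real set)"
    using HI by (rule has_integral_eq[rotated]) (auto simp: indicator_def)
  then have "((\<lambda>x. exp (- x\<^sup>2)) has_integral sqrt pi / 2) {0::real..}"
    by (simp only: has_integral_restrict_UNIV)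
  then show ?thesis
    by (intro has_integral_subset_le[of "{0..S}" "{0..}" "\<lambda>x. exp (- x\<^sup>2)"] integrable_integral integrable_continuous_interval continuous_intros) auto
qed

lemma gaussian_integral_tendsto:
  "((\<lambda>S. integral {0..S} (\<lambda>s. exp (- s\<^sup>2))) \<longlongrightarrow> sqrt pi / 2) at_top"
proof -
  have "((\<lambda>S. \<integral>x. indicator {..S} x *\<^sub>R (indicator {0..} x *\<^sub>R exp (- x\<^sup>2)) \<partial>lborel) \<longlongrightarrow> (\<integral>x. indicator {0..} x *\<^sub>R exp (- x\<^sup>2) \<partial>lborel :: real)) at_top"
    using gaussian_moment_0
    by (intro tendsto_integral_at_top[where M = lborel and f = "\<lambda>x. indicator {0..} x *\<^sub>R exp (- x\<^sup>2) :: real"])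
       (simp_all add: has_bochner_integral_iff)
  moreover have "(\<integral>x. indicator {0..} x *\<^sub>R exp (- x\<^sup>2) \<partial>lborel) = sqrt pi / 2"
    using gaussian_moment_0 by (auto simp: has_bochner_integral_iff)
  moreover have "(\<integral>x. indicator {..S} x *\<^sub>R (indicator {0..} x *\<^sub>R exp (- x\<^sup>2)) \<partial>lborel) = integral {0..S} (\<lambda>s. exp (- s\<^sup>2))" for S :: real
  proof -
    have "(\<integral>x. indicator {..S} x *\<^sub>R (indicator {0..} x *\<^sub>R exp (- x\<^sup>2)) \<partial>lborel) = (\<integral>x\<in>{0..S}. exp (- x\<^sup>2) \<partial>lborel)"
      unfolding set_lebesgue_integral_def
      by (intro Bochner_Integration.integral_cong) (auto simp: indicator_def)
    also have "\<dots> = integral {0..S} (\<lambda>s. exp (- s\<^sup>2))"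
      by (intro set_borel_integral_eq_integral borel_integrable_atLeastAtMost' continuous_intros)
    finally show ?thesis .
  qed
  ultimately show ?thesis by (simp only:)
qed

text \<open>The function \<open>E\<close> is sqrt(pi)/2 times the imaginary error function. Going
  vertically upwards from z with \<open>0 \<le> Im z\<close>, the integrand has modulus at most
  \<open>exp (Re (z\<^sup>2)) * exp (- s\<^sup>2)\<close>, and the Gaussian integral sqrt(pi)/2 is
  at most 1.\<close>

lemma gaussian_primitive:
  obtains E :: "complex \<Rightarrow> complex" where
    "\<And>z. (E has_field_derivative exp (z\<^sup>2)) (at z)"
    "\<And>z. 0 \<le> Im z \<Longrightarrow> norm (E z - \<i> * of_real (sqrt pi / 2)) \<le> exp (Re (z\<^sup>2))"
    "\<And>z. E (- z) = - E z"
proof -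
  have "(\<lambda>z. exp (z\<^sup>2)) holomorphic_on UNIV" by (intro holomorphic_intros)
  then obtain E0 :: "complex \<Rightarrow> complex" where "\<And>z. z \<in> UNIV \<Longrightarrow> (E0 has_field_derivative exp (z\<^sup>2)) (at z within UNIV)"
    by (rule holomorphic_convex_primitive'[OF convex_UNIV open_UNIV]) (rule that)
  then have E0: "(E0 has_field_derivative exp (z\<^sup>2)) (at z)" for z by simp
  define E where "E z = E0 z - E0 0" for z
  have E_deriv: "(E has_field_derivative exp (z\<^sup>2)) (at z)" for z
    unfolding E_def by (auto intro!: derivative_eq_intros E0)
  have E_0: "E 0 = 0" by (simp add: E_def)
  have E_line: "E (a + c * of_real T) - E a = integral {0..T} (\<lambda>s. c * exp ((a + c * of_real s)\<^sup>2))" if "T \<ge> 0" for a c T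
  proof -
    have "((\<lambda>s. c * exp ((a + c * of_real s)\<^sup>2)) has_integral (E (a + c * of_real T) - E (a + c * of_real 0))) {0..T}"
    proof (rule fundamental_theorem_of_calculus[OF that])
      fix s assume "s \<in> {0..T}"
      have "((\<lambda>s. a + c * of_real s) has_vector_derivative c) (at s within {0..T})"
        by (auto intro!: derivative_eq_intros)
      from field_vector_diff_chain_within[OF this, of E] E_deriv
      show "((\<lambda>s. E (a + c * of_real s)) has_vector_derivative c * exp ((a + c * of_real s)\<^sup>2)) (at s within {0..T})"
        by (auto simp: o_def intro: has_field_derivative_at_within)
    qed
    from integral_unique[OF this] show ?thesis by simp
  qed
  have odd: "E (- z) = - E z" for z
  proof -
    have "\<exists>k. \<forall>z\<in>UNIV. E (- z) + E z = k"
    proof (rule has_field_derivative_zero_constant)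
      fix z :: complex
      have "((\<lambda>z. E (- z)) has_field_derivative exp ((- z)\<^sup>2) * (- 1)) (at z)"
        by (rule DERIV_chain2[OF E_deriv]) (auto intro!: derivative_eq_intros)
      from DERIV_add[OF this E_deriv[of z]]
      show "((\<lambda>z. E (- z) + E z) has_field_derivative 0) (at z within UNIV)" by simp
    qed simp
    then have "E (- z) + E z = E (- 0) + E 0" by (metis UNIV_I)
    then show ?thesis by (simp add: E_0 eq_neg_iff_add_eq_0)
  qed
  have tail: "norm (E z - \<i> * of_real (sqrt pi / 2)) \<le> exp (Re (z\<^sup>2))" if z: "0 \<le> Im z" for z
  proof -
    have vert: "norm (E (z + \<i> * of_real S) - E z) \<le> exp (Re (z\<^sup>2))" if "S \<ge> 0" for S
    proof -
      have "norm (E (z + \<i> * of_real S) - E z) \<le> integral {0..S} (\<lambda>s. exp (Re (z\<^sup>2)) * exp (- s\<^sup>2))"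
        unfolding E_line[OF that]
      proof (rule integral_norm_bound_integral)
        show "norm (\<i> * exp ((z + \<i> * of_real s)\<^sup>2)) \<le> exp (Re (z\<^sup>2)) * exp (- s\<^sup>2)" if "s \<in> {0..S}" for s
        proof -
          have "Re ((z + \<i> * of_real s)\<^sup>2) = Re (z\<^sup>2) - s\<^sup>2 - 2 * s * Im z"
            by (simp add: power2_eq_square algebra_simps)
          also have "\<dots> \<le> Re (z\<^sup>2) - s\<^sup>2" using that z by simp
          finally show ?thesis by (simp add: norm_mult exp_add[symmetric])
        qed
      qed (intro integrable_continuous_interval continuous_intros)+
      also have "\<dots> = exp (Re (z\<^sup>2)) * integral {0..S} (\<lambda>s. exp (- s\<^sup>2))" by simp
      also have "\<dots> \<le> exp (Re (z\<^sup>2)) * 1"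
      proof -
        have "sqrt pi \<le> sqrt 4" using pi_less_4 by (intro real_sqrt_le_mono) simp
        then show ?thesis using gaussian_integral_le[OF that] by (intro mult_left_mono) auto
      qed
      finally show ?thesis by simp
    qed
    have lim1: "((\<lambda>S. E (\<i> * of_real S)) \<longlongrightarrow> \<i> * of_real (sqrt pi / 2)) at_top"
    proof (rule Lim_transform_eventually)
      show "((\<lambda>S. \<i> * of_real (integral {0..S} (\<lambda>s. exp (- s\<^sup>2)))) \<longlongrightarrow> \<i> * complex_of_real (sqrt pi / 2)) at_top"
        by (intro tendsto_intros gaussian_integral_tendsto)
      show "eventually (\<lambda>S. \<i> * of_real (integral {0..S} (\<lambda>s. exp (- s\<^sup>2))) = E (\<i> * of_real S)) at_top"
        using eventually_ge_at_top[of "0::real"]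
      proof eventually_elim
        case (elim S)
        have "((\<lambda>s. exp (- s\<^sup>2)) has_integral (integral {0..S} (\<lambda>s. exp (- s\<^sup>2)))) {0..S}"
          by (intro integrable_integral integrable_continuous_interval continuous_intros)
        then have "((\<lambda>s. complex_of_real (exp (- s\<^sup>2))) has_integral of_real (integral {0..S} (\<lambda>s. exp (- s\<^sup>2)))) {0..S}"
          by (rule has_integral_of_real)
        then have "((\<lambda>s. \<i> * complex_of_real (exp (- s\<^sup>2))) has_integral \<i> * of_real (integral {0..S} (\<lambda>s. exp (- s\<^sup>2)))) {0..S}"
          by (rule has_integral_mult_right)
        moreover have "complex_of_real (exp (- s\<^sup>2)) = exp ((0 + \<i> * of_real s)\<^sup>2)" for s
          by (simp add: power_mult_distrib flip: exp_of_real)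
        ultimately have "((\<lambda>s. \<i> * exp ((0 + \<i> * of_real s)\<^sup>2)) has_integral \<i> * of_real (integral {0..S} (\<lambda>s. exp (- s\<^sup>2)))) {0..S}"
          by (simp only:)
        from integral_unique[OF this] E_line[OF elim, of 0 "\<i>"] E_0 show ?case
          by (simp only: add_0 diff_zero)
      qed
    qed
    \<comment> \<open>The segment joining the imaginary axis to the ray above z contributes O(exp
      (-S)) at height S, so both rays lead to the same limit.\<close>
    have lim2: "((\<lambda>S. E (z + \<i> * of_real S) - E (\<i> * of_real S)) \<longlongrightarrow> 0) at_top"
    proof (rule Lim_null_comparison)
      show "eventually (\<lambda>S. norm (E (z + \<i> * of_real S) - E (\<i> * of_real S)) \<le> norm z * exp ((norm z)\<^sup>2) * exp (- S)) at_top"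
        using eventually_ge_at_top[of "1::real"]
      proof eventually_elim
        case (elim S)
        have "norm (E (\<i> * of_real S + z * of_real 1) - E (\<i> * of_real S)) \<le> norm z * exp ((norm z)\<^sup>2) * exp (- S) * (1 - 0)"
          unfolding E_line[of 1, OF zero_le_one]
        proof (rule integral_bound)
          show "norm (z * exp ((\<i> * of_real S + z * of_real s)\<^sup>2)) \<le> norm z * exp ((norm z)\<^sup>2) * exp (- S)" if "s \<in> {0..1}" for s
          proof -
            have "Re ((\<i> * of_real S + z * of_real s)\<^sup>2) = s\<^sup>2 * Re (z\<^sup>2) - S\<^sup>2 - 2 * s * S * Im z"
              by (simp add: power2_eq_square algebra_simps)
            also have "\<dots> \<le> s\<^sup>2 * (norm z)\<^sup>2 - S\<^sup>2 - 0"
            proof -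
              have "Re (z\<^sup>2) \<le> (norm z)\<^sup>2" by (metis complex_Re_le_cmod norm_power)
              then show ?thesis using that z elim by (intro diff_mono mult_left_mono) auto
            qed
            also have "\<dots> \<le> 1 * (norm z)\<^sup>2 - S"
            proof -
              have "s\<^sup>2 \<le> 1" using that by (simp add: power_le_one)
              then have "s\<^sup>2 * (norm z)\<^sup>2 \<le> 1 * (norm z)\<^sup>2" by (intro mult_right_mono) auto
              moreover have "S \<le> S\<^sup>2" using elim by (simp add: power2_eq_square)
              ultimately show ?thesis by linarith
            qed
            finally have "exp (Re ((\<i> * of_real S + z * of_real s)\<^sup>2)) \<le> exp ((norm z)\<^sup>2) * exp (- S)"
              by (simp flip: exp_add)
            then show ?thesis unfolding norm_mult norm_exp_eq_Re mult.assoc by (intro mult_left_mono) auto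
          qed
        qed (auto intro!: continuous_intros)
        then show ?case by (simp add: add.commute)
      qed
      have "((\<lambda>S. norm z * exp ((norm z)\<^sup>2) * exp (- S)) \<longlongrightarrow> norm z * exp ((norm z)\<^sup>2) * 0) at_top"
        by (intro tendsto_intros filterlim_compose[OF exp_at_bot] filterlim_uminus_at_bot_at_top)
      then show "((\<lambda>S. norm z * exp ((norm z)\<^sup>2) * exp (- S)) \<longlongrightarrow> 0) at_top" by simp
    qed
    have "((\<lambda>S. (E (z + \<i> * of_real S) - E (\<i> * of_real S)) + E (\<i> * of_real S) - E z) \<longlongrightarrow> 0 + \<i> * of_real (sqrt pi / 2) - E z) at_top"
      by (intro tendsto_intros lim1 lim2)
    then have "((\<lambda>S. norm (E (z + \<i> * of_real S) - E z)) \<longlongrightarrow> norm (\<i> * of_real (sqrt pi / 2) - E z)) at_top"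
      by (intro tendsto_norm) simp
    then have "norm (\<i> * of_real (sqrt pi / 2) - E z) \<le> exp (Re (z\<^sup>2))"
      by (rule tendsto_upperbound) (use vert in \<open>auto intro: eventually_mono[OF eventually_ge_at_top[of 0]]\<close>)
    then show ?thesis by (simp add: norm_minus_commute)
  qed
  show ?thesis using that[OF E_deriv tail odd] .
qed

section \<open>The saddle point integral\<close>

text \<open>
  With \<open>r = \<surd>t\<close>, the exponent is \<open>u\<^sup>2 + 2 \<beta> = v\<^sup>2 - 2 \<beta>\<close> for \<open>u = \<surd>A r - \<surd>B / r\<close> and
  \<open>v = \<surd>A r + \<surd>B / r\<close>, so that a primitive \<open>E\<close> of \<open>exp (z\<^sup>2)\<close> yields the primitive \<open>H\<close>.
\<close>

lemma saddle_integral: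
  fixes A B y X :: real
  assumes pos: "A > 0" "B > 0" "y > 0" "X > 0"
  defines "\<beta> \<equiv> sqrt (A * B)"
  defines "h \<equiv> \<lambda>t. csqrt t * exp (of_real A * t + of_real B / t)"
  defines "R \<equiv> y\<^sup>2 + X\<^sup>2"
  shows "norm (integral {-X..X} (\<lambda>x. h (Complex y x)) -
            of_real (sqrt pi / (2 * A * sqrt A) * (2 * \<beta> - 1) * exp (2 * \<beta>))) \<le>
         exp (A * y + B * y / R) / A * (2 * sqrt (sqrt R) + 3 * (2 * \<beta> + 1) / sqrt A)"
proof -
  obtain E :: "complex \<Rightarrow> complex" where
    E_deriv: "\<And>z. (E has_field_derivative exp (z\<^sup>2)) (at z)" and
    E_tail: "\<And>z. 0 \<le> Im z \<Longrightarrow> norm (E z - \<i> * of_real (sqrt pi / 2)) \<le> exp (Re (z\<^sup>2))" and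
    E_odd: "\<And>z. E (- z) = - E z"
    using gaussian_primitive by blast
  define a where "a = complex_of_real (sqrt A)"
  define b where "b = complex_of_real (sqrt B)"
  have a2: "a\<^sup>2 = of_real A" and b2: "b\<^sup>2 = of_real B" and a0: "a \<noteq> 0"
    using pos by (auto simp: a_def b_def simp flip: of_real_power)
  have ab: "a * b = of_real \<beta>" by (simp add: a_def b_def \<beta>_def real_sqrt_mult)
  have \<beta>: "\<beta> \<ge> 0" using pos by (simp add: \<beta>_def)
  define Q where "Q t = exp (of_real A * t + of_real B / t)" for t :: complex
  define u where "u t = a * csqrt t - b / csqrt t" for t
  define v where "v t = a * csqrt t + b / csqrt t" for t
  \<comment> \<open>With \<open>r = csqrt t\<close>, the coefficients of \<open>E (u t)\<close> and
    \<open>E (v t)\<close> are those for which their derivatives cancel the surplus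
    \<open>Q t * (1 / (2 * r) - B / (t * r))\<close> in the derivative of \<open>r * Q t\<close>.
    What is left is \<open>A * r * Q t\<close>.\<close>
  define H where "H t = (csqrt t * Q t + (of_real ((2 * \<beta> - 1) * exp (2 * \<beta>)) * E (u t)
      - of_real ((2 * \<beta> + 1) * exp (- 2 * \<beta>)) * E (v t)) / (2 * a)) / of_real A" for t
  have Qu: "exp ((u t)\<^sup>2) = Q t * of_real (exp (- 2 * \<beta>))" and Qv: "exp ((v t)\<^sup>2) = Q t * of_real (exp (2 * \<beta>))" if "t \<noteq> 0" for t
  proof -
    have r: "csqrt t \<noteq> 0" using that by simp
    have "(u t)\<^sup>2 = a\<^sup>2 * (csqrt t)\<^sup>2 + b\<^sup>2 / (csqrt t)\<^sup>2 - 2 * (a * b)"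
      using r by (simp add: u_def power2_eq_square field_simps)
    also have "\<dots> = of_real A * t + of_real B / t + of_real (- 2 * \<beta>)"
      by (simp add: a2 b2 ab)
    finally show "exp ((u t)\<^sup>2) = Q t * of_real (exp (- 2 * \<beta>))"
      by (simp only: exp_add Q_def exp_of_real)
    have "(v t)\<^sup>2 = a\<^sup>2 * (csqrt t)\<^sup>2 + b\<^sup>2 / (csqrt t)\<^sup>2 + 2 * (a * b)"
      using r by (simp add: v_def power2_eq_square field_simps)
    also have "\<dots> = of_real A * t + of_real B / t + of_real (2 * \<beta>)"
      by (simp add: a2 b2 ab)
    finally show "exp ((v t)\<^sup>2) = Q t * of_real (exp (2 * \<beta>))"
      by (simp only: exp_add Q_def exp_of_real)
  qed
  have H_deriv: "(H has_field_derivative h t) (at t)" if t: "Re t > 0" for t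
  proof -
    define r where "r = csqrt t"
    have t0: "t \<noteq> 0" "t \<notin> \<real>\<^sub>\<le>\<^sub>0" using t by (auto simp: complex_nonpos_Reals_iff)
    have r0: "r \<noteq> 0" and r2: "r\<^sup>2 = t" using t0 by (auto simp: r_def)
    have dr: "(csqrt has_field_derivative 1 / (2 * r)) (at t)"
      using has_field_derivative_csqrt[OF t0(2)] by (simp add: r_def inverse_eq_divide)
    have dQ: "(Q has_field_derivative Q t * (of_real A - of_real B / t\<^sup>2)) (at t)"
      unfolding Q_def using t0 by (auto intro!: derivative_eq_intros simp: power2_eq_square)
    have db: "((\<lambda>t. b / csqrt t) has_field_derivative - (b / (2 * r * t))) (at t)"
    proof (rule DERIV_cong[OF DERIV_divide[OF DERIV_const dr]])
      show "csqrt t \<noteq> 0" using t0 by simp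
      show "(0 * csqrt t - b * (1 / (2 * r))) / (csqrt t * csqrt t) = - (b / (2 * r * t))"
        using r2 by (simp add: r_def[symmetric] power2_eq_square[symmetric])
    qed
    have du: "(u has_field_derivative (a + b / t) / (2 * r)) (at t)"
      unfolding u_def[abs_def] using r0 t0
      by (intro DERIV_cong[OF DERIV_diff[OF DERIV_cmult[OF dr] db]]) (simp add: field_simps)
    have dv: "(v has_field_derivative (a - b / t) / (2 * r)) (at t)"
      unfolding v_def[abs_def] using r0 t0
      by (intro DERIV_cong[OF DERIV_add[OF DERIV_cmult[OF dr] db]]) (simp add: field_simps)
    have dEu: "((\<lambda>t. E (u t)) has_field_derivative exp ((u t)\<^sup>2) * ((a + b / t) / (2 * r))) (at t)"
      by (rule DERIV_chain2[OF E_deriv du])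
    have dEv: "((\<lambda>t. E (v t)) has_field_derivative exp ((v t)\<^sup>2) * ((a - b / t) / (2 * r))) (at t)"
      by (rule DERIV_chain2[OF E_deriv dv])
    let ?D = "((1 / (2 * r) * Q t + Q t * (of_real A - of_real B / t\<^sup>2) * csqrt t) + (of_real ((2 * \<beta> - 1) * exp (2 * \<beta>)) * (exp ((u t)\<^sup>2) * ((a + b / t) / (2 * r)))
      - of_real ((2 * \<beta> + 1) * exp (- 2 * \<beta>)) * (exp ((v t)\<^sup>2) * ((a - b / t) / (2 * r)))) / (2 * a)) / of_real A"
    have "(H has_field_derivative ?D) (at t)"
      unfolding H_def[abs_def]
      by (intro DERIV_cdivide DERIV_add DERIV_diff DERIV_cmult DERIV_mult dr dQ dEu dEv)
    moreover have "?D = h t"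
    proof -
      have e1: "of_real (exp (2 * \<beta>)) * of_real (exp (- 2 * \<beta>)) = (1::complex)"
        by (simp flip: of_real_mult exp_add)
      have p1: "of_real ((2 * \<beta> - 1) * exp (2 * \<beta>)) * (Q t * of_real (exp (- 2 * \<beta>)) * ((a + b / t) / (2 * r)))
         = (of_real (exp (2 * \<beta>)) * of_real (exp (- 2 * \<beta>))) * (Q t * ((2 * of_real \<beta> - 1) * (a + b / t) / (2 * r)))"
        by (simp add: mult_ac)
      have p2: "of_real ((2 * \<beta> + 1) * exp (- 2 * \<beta>)) * (Q t * of_real (exp (2 * \<beta>)) * ((a - b / t) / (2 * r)))
         = (of_real (exp (2 * \<beta>)) * of_real (exp (- 2 * \<beta>))) * (Q t * ((2 * of_real \<beta> + 1) * (a - b / t) / (2 * r)))"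
        by (simp add: mult_ac)
      have p3: "(Q t * ((2 * of_real \<beta> - 1) * (a + b / t) / (2 * r)) - Q t * ((2 * of_real \<beta> + 1) * (a - b / t) / (2 * r))) / (2 * a)
          = Q t * ((2 * of_real \<beta> * b / t - a) / (2 * r * a))"
        using a0 r0 t0 by (simp add: field_simps)
      have p4: "(2 * of_real \<beta> * b / t - a) / (2 * r * a) = of_real B / (t * r) - 1 / (2 * r)"
        using a0 r0 t0 unfolding ab[symmetric] b2[symmetric] by (simp add: field_simps power2_eq_square)
      have "?D = (1 / (2 * r) * Q t + Q t * (of_real A - of_real B / t\<^sup>2) * r + Q t * (of_real B / (t * r) - 1 / (2 * r))) / of_real A"
        unfolding Qu[OF t0(1)] Qv[OF t0(1)] p1 p2 e1 mult_1 p3 p4 r_def[symmetric] ..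
      also have "\<dots> = Q t * (of_real A * r - of_real B * r / t\<^sup>2 + of_real B / (t * r)) / of_real A"
        by (simp add: algebra_simps)
      also have "of_real B * r / t\<^sup>2 = of_real B / (t * r)"
        unfolding r2[symmetric] using r0 by (simp add: field_simps power2_eq_square)
      also have "Q t * (of_real A * r - of_real B / (t * r) + of_real B / (t * r)) / of_real A = h t"
        using pos by (simp add: h_def Q_def r_def)
      finally show ?thesis .
    qed
    ultimately show ?thesis by simp
  qed
  define tp where "tp = Complex y X"
  define tm where "tm = Complex y (-X)"
  have "((\<lambda>x. \<i> * h (Complex y x)) has_integral (H (Complex y X) - H (Complex y (-X)))) {-X..X}"
  proof (rule fundamental_theorem_of_calculus)
    fix x :: real
    have "((\<lambda>x. Complex y x) has_vector_derivative \<i>) (at x within {-X..X})"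
      unfolding has_vector_derivative_complex_iff by (auto intro!: derivative_eq_intros)
    from field_vector_diff_chain_within[OF this, of H "h (Complex y x)"]
    show "((\<lambda>x. H (Complex y x)) has_vector_derivative \<i> * h (Complex y x)) (at x within {-X..X})"
      using H_deriv[of "Complex y x"] pos by (simp add: o_def has_field_derivative_at_within)
  qed (use pos in simp)
  from has_integral_mult_right[OF this, of "- \<i>"]
  have J: "integral {-X..X} (\<lambda>x. h (Complex y x)) = - \<i> * (H tp - H tm)"
    by (simp add: tp_def tm_def integral_unique)
  define P where "P = exp (A * y + B * y / R)"
  have R: "R > 0" using pos by (simp add: R_def add_pos_pos)
  have P1: "1 \<le> P" using pos R by (simp add: P_def)
  have normQ: "norm (Q tp) = P" "norm (Q tm) = P"
    using R by (simp_all add: Q_def P_def tp_def tm_def R_def Re_divide cmod_power2)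
  have normr: "norm (csqrt tp) = sqrt (sqrt R)" "norm (csqrt tm) = sqrt (sqrt R)"
    by (simp_all only: norm_csqrt tp_def tm_def R_def complex_norm power2_minus)
  have t0: "tp \<noteq> 0" "tm \<noteq> 0" using pos by (auto simp: tp_def tm_def complex_eq_iff)
  have E_le: "norm (E z) \<le> 1 + exp (Re (z\<^sup>2))" for z
  proof -
    have c: "norm (\<i> * of_real (sqrt pi / 2)) \<le> 1"
    proof -
      have "sqrt pi \<le> sqrt 4" using pi_less_4 by (intro real_sqrt_le_mono) simp
      then show ?thesis by (simp add: norm_mult)
    qed
    have *: "norm (E z) \<le> 1 + exp (Re (z\<^sup>2))" if "0 \<le> Im z" for z
      using E_tail[OF that] c norm_triangle_ineq[of "E z - \<i> * of_real (sqrt pi / 2)" "\<i> * of_real (sqrt pi / 2)"] by simp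
    show ?thesis using *[of z] *[of "- z"] by (cases "0 \<le> Im z") (auto simp: E_odd)
  qed
  \<comment> \<open>The end points of \<open>u\<close> lie in opposite closed half-planes. As
    \<open>E\<close> is odd, both contribute the limit \<open>\<i> * of_real (sqrt pi / 2)\<close>,
    and their sum is the complete Gaussian integral behind the main term.\<close>
  have Imup: "0 \<le> Im (u tp)" and Imum: "0 \<le> Im (- u tm)"
  proof -
    have "0 \<le> Im (csqrt tp)" using pos complex_Re_le_cmod[of "Complex y X"] by (simp add: tp_def)
    moreover have "Im (csqrt tm) \<le> 0" using pos complex_Re_le_cmod[of "Complex y (- X)"] by (simp add: tm_def)
    moreover have "Im (u t) = Im (csqrt t) * (sqrt A + sqrt B / ((Re (csqrt t))\<^sup>2 + (Im (csqrt t))\<^sup>2))" for t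
    proof -
      have "Im (of_real p * r - of_real q / r) = Im r * (p + q / ((Re r)\<^sup>2 + (Im r)\<^sup>2))" for p q r
        by (simp add: Im_divide distrib_left)
      then show ?thesis by (simp only: u_def a_def b_def)
    qed
    moreover have "0 \<le> sqrt A + sqrt B / ((Re (csqrt t))\<^sup>2 + (Im (csqrt t))\<^sup>2)" for t
      using pos by (intro add_nonneg_nonneg divide_nonneg_nonneg) auto
    ultimately show "0 \<le> Im (u tp)" "0 \<le> Im (- u tm)"
      by (simp_all only: uminus_complex.sel neg_0_le_iff_le mult_nonneg_nonneg mult_nonpos_nonneg)
  qed
  define c where "c = \<i> * of_real (sqrt pi / 2)"
  define ep where "ep = E (u tp) - c"
  define em where "em = E (- u tm) - c"
  have ep: "exp (2 * \<beta>) * norm ep \<le> P"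
  proof -
    have "norm ep \<le> norm (exp ((u tp)\<^sup>2))" using E_tail[OF Imup] by (simp add: ep_def c_def)
    also have "\<dots> = P * exp (- 2 * \<beta>)" unfolding Qu[OF t0(1)] by (simp add: norm_mult normQ)
    finally have "exp (2 * \<beta>) * norm ep \<le> exp (2 * \<beta>) * (P * exp (- 2 * \<beta>))" by (intro mult_left_mono) auto
    also have "\<dots> = P" by (simp add: exp_minus)
    finally show ?thesis .
  qed
  have em: "exp (2 * \<beta>) * norm em \<le> P"
  proof -
    have "norm em \<le> norm (exp ((u tm)\<^sup>2))" using E_tail[OF Imum] by (simp add: em_def c_def)
    also have "\<dots> = P * exp (- 2 * \<beta>)" unfolding Qu[OF t0(2)] by (simp add: norm_mult normQ)
    finally have "exp (2 * \<beta>) * norm em \<le> exp (2 * \<beta>) * (P * exp (- 2 * \<beta>))" by (intro mult_left_mono) auto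
    also have "\<dots> = P" by (simp add: exp_minus)
    finally show ?thesis .
  qed
  \<comment> \<open>The sign of \<open>Im (v t)\<close> is not controlled, so the cruder
    \<open>E_le\<close> is used; the coefficient \<open>exp (- 2 * \<beta>)\<close> compensates the
    size \<open>exp (2 * \<beta>)\<close> in \<open>Qv\<close>.\<close>
  have ev: "exp (- 2 * \<beta>) * norm (E (v t)) \<le> 2 * P" if "t \<in> {tp, tm}" for t
  proof -
    have t: "t \<noteq> 0" "norm (Q t) = P" using that t0 normQ by auto
    have "norm (E (v t)) \<le> 1 + norm (exp ((v t)\<^sup>2))" using E_le[of "v t"] by simp
    also have "\<dots> = 1 + P * exp (2 * \<beta>)" unfolding Qv[OF t(1)] by (simp add: norm_mult t)
    finally have "exp (- 2 * \<beta>) * norm (E (v t)) \<le> exp (- 2 * \<beta>) * (1 + P * exp (2 * \<beta>))" by (intro mult_left_mono) auto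
    also have "\<dots> = exp (- 2 * \<beta>) + P" by (simp add: exp_minus distrib_left)
    also have "\<dots> \<le> 1 + P" using \<beta> by simp
    finally show ?thesis using P1 by linarith
  qed
  have Hdiff: "of_real A * (H tp - H tm) = (csqrt tp * Q tp - csqrt tm * Q tm) +
      (of_real ((2 * \<beta> - 1) * exp (2 * \<beta>)) * (2 * c + ep + em) - of_real ((2 * \<beta> + 1) * exp (- 2 * \<beta>)) * (E (v tp) - E (v tm))) / (2 * a)"
  proof -
    have "E (u tm) = - E (- u tm)" by (simp add: E_odd)
    then have "E (u tp) - E (u tm) = 2 * c + ep + em" by (simp add: ep_def em_def)
    moreover have "of_real A * (H tp - H tm) = (csqrt tp * Q tp - csqrt tm * Q tm) +
      (of_real ((2 * \<beta> - 1) * exp (2 * \<beta>)) * (E (u tp) - E (u tm)) - of_real ((2 * \<beta> + 1) * exp (- 2 * \<beta>)) * (E (v tp) - E (v tm))) / (2 * a)"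
      using pos unfolding H_def by (simp add: right_diff_distrib) (simp add: algebra_simps add_divide_distrib diff_divide_distrib)
    ultimately show ?thesis by simp
  qed
  define Z where "Z = (csqrt tp * Q tp - csqrt tm * Q tm) +
      (of_real ((2 * \<beta> - 1) * exp (2 * \<beta>)) * (ep + em) - of_real ((2 * \<beta> + 1) * exp (- 2 * \<beta>)) * (E (v tp) - E (v tm))) / (2 * a)"
  have "of_real A * (integral {-X..X} (\<lambda>x. h (Complex y x)) - of_real (sqrt pi / (2 * A * sqrt A) * (2 * \<beta> - 1) * exp (2 * \<beta>))) = - \<i> * Z"
  proof -
    have eq: "of_real A * (H tp - H tm) = Z + of_real ((2 * \<beta> - 1) * exp (2 * \<beta>)) * c / a"
      unfolding Hdiff Z_def using a0 by (simp add: field_simps)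
    then have "of_real A * (- \<i> * (H tp - H tm)) = - \<i> * Z + of_real ((2 * \<beta> - 1) * exp (2 * \<beta>)) * (- \<i> * c) / a"
    proof -
      have "of_real A * (- \<i> * (H tp - H tm)) = - \<i> * (of_real A * (H tp - H tm))" by (simp only: mult_ac)
      also have "\<dots> = - \<i> * (Z + of_real ((2 * \<beta> - 1) * exp (2 * \<beta>)) * c / a)" by (simp only: eq)
      also have "\<dots> = - \<i> * Z + of_real ((2 * \<beta> - 1) * exp (2 * \<beta>)) * (- \<i> * c) / a"
        by (simp only: distrib_left times_divide_eq_right mult_ac)
      finally show ?thesis .
    qed
    moreover have "of_real ((2 * \<beta> - 1) * exp (2 * \<beta>)) * (- \<i> * c) / a = of_real A * of_real (sqrt pi / (2 * A * sqrt A) * (2 * \<beta> - 1) * exp (2 * \<beta>))"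
      using pos by (simp add: c_def a_def)
    ultimately show ?thesis unfolding J by (simp add: right_diff_distrib)
  qed
  then have "A * norm (integral {-X..X} (\<lambda>x. h (Complex y x)) - of_real (sqrt pi / (2 * A * sqrt A) * (2 * \<beta> - 1) * exp (2 * \<beta>))) = norm Z"
    using pos by (metis abs_of_pos norm_ii norm_minus_cancel norm_mult norm_of_real mult_1)
  moreover have "norm Z \<le> P * (2 * sqrt (sqrt R) + 3 * (2 * \<beta> + 1) / sqrt A)"
  proof -
    have z1: "norm (csqrt tp * Q tp - csqrt tm * Q tm) \<le> 2 * sqrt (sqrt R) * P"
      using norm_triangle_ineq4[of "csqrt tp * Q tp" "csqrt tm * Q tm"] unfolding norm_mult normQ normr by (simp add: mult_ac)
    have "norm (of_real ((2 * \<beta> - 1) * exp (2 * \<beta>)) * (ep + em)) = \<bar>2 * \<beta> - 1\<bar> * (exp (2 * \<beta>) * norm (ep + em))"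
      by (simp only: norm_mult norm_of_real abs_mult abs_exp_cancel mult.assoc)
    also have "\<dots> \<le> (2 * \<beta> + 1) * (2 * P)"
    proof (rule mult_mono)
      have "exp (2 * \<beta>) * norm (ep + em) \<le> exp (2 * \<beta>) * (norm ep + norm em)"
        by (intro mult_left_mono norm_triangle_ineq) auto
      then show "exp (2 * \<beta>) * norm (ep + em) \<le> 2 * P" using ep em by (simp add: distrib_left)
    qed (use \<beta> in auto)
    finally have z2: "norm (of_real ((2 * \<beta> - 1) * exp (2 * \<beta>)) * (ep + em)) \<le> (2 * \<beta> + 1) * (2 * P)" .
    have "norm (of_real ((2 * \<beta> + 1) * exp (- 2 * \<beta>)) * (E (v tp) - E (v tm))) = (2 * \<beta> + 1) * (exp (- 2 * \<beta>) * norm (E (v tp) - E (v tm)))"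
    proof -
      have "\<bar>2 * \<beta> + 1\<bar> = 2 * \<beta> + 1" using \<beta> by simp
      then show ?thesis by (simp only: norm_mult norm_of_real abs_mult abs_exp_cancel mult.assoc)
    qed
    also have "\<dots> \<le> (2 * \<beta> + 1) * (4 * P)"
    proof (rule mult_left_mono)
      have "exp (- 2 * \<beta>) * norm (E (v tp) - E (v tm)) \<le> exp (- 2 * \<beta>) * (norm (E (v tp)) + norm (E (v tm)))"
        by (intro mult_left_mono norm_triangle_ineq4) auto
      then show "exp (- 2 * \<beta>) * norm (E (v tp) - E (v tm)) \<le> 4 * P" using ev[of tp] ev[of tm] by (simp add: distrib_left)
    qed (use \<beta> in auto)
    finally have z3: "norm (of_real ((2 * \<beta> + 1) * exp (- 2 * \<beta>)) * (E (v tp) - E (v tm))) \<le> (2 * \<beta> + 1) * (4 * P)" .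
    have "norm (of_real ((2 * \<beta> - 1) * exp (2 * \<beta>)) * (ep + em) - of_real ((2 * \<beta> + 1) * exp (- 2 * \<beta>)) * (E (v tp) - E (v tm))) \<le> (2 * \<beta> + 1) * (2 * P) + (2 * \<beta> + 1) * (4 * P)"
      using z2 z3 by (intro order_trans[OF norm_triangle_ineq4] add_mono)
    then have "norm (of_real ((2 * \<beta> - 1) * exp (2 * \<beta>)) * (ep + em) - of_real ((2 * \<beta> + 1) * exp (- 2 * \<beta>)) * (E (v tp) - E (v tm))) / (2 * sqrt A) \<le> ((2 * \<beta> + 1) * (2 * P) + (2 * \<beta> + 1) * (4 * P)) / (2 * sqrt A)"
      using pos by (intro divide_right_mono) auto
    also have "(2 * \<beta> + 1) * (2 * P) + (2 * \<beta> + 1) * (4 * P) = 2 * (P * (3 * (2 * \<beta> + 1)))"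
      by (simp add: algebra_simps)
    also have "2 * (P * (3 * (2 * \<beta> + 1))) / (2 * sqrt A) = P * (3 * (2 * \<beta> + 1) / sqrt A)"
      by (subst mult_divide_mult_cancel_left) auto
    finally have z4: "norm ((of_real ((2 * \<beta> - 1) * exp (2 * \<beta>)) * (ep + em) - of_real ((2 * \<beta> + 1) * exp (- 2 * \<beta>)) * (E (v tp) - E (v tm))) / (2 * a)) \<le> P * (3 * (2 * \<beta> + 1) / sqrt A)"
      using pos by (simp add: norm_divide norm_mult a_def)
    show ?thesis unfolding Z_def using order_trans[OF norm_triangle_ineq add_mono[OF z1 z4]] by (simp add: algebra_simps)
  qed
  ultimately have "A * norm (integral {-X..X} (\<lambda>x. h (Complex y x)) - of_real (sqrt pi / (2 * A * sqrt A) * (2 * \<beta> - 1) * exp (2 * \<beta>))) \<le> P * (2 * sqrt (sqrt R) + 3 * (2 * \<beta> + 1) / sqrt A)" by simp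
  then show ?thesis using pos by (simp add: P_def field_simps)
qed

section \<open>Asymptotic estimate of the partition numbers\<close>

text \<open>Here \<open>z\<close> is the transformed point at either cusp, and \<open>B\<close> says
  that \<open>exp (of_real B / t)\<close> has modulus \<open>exp (pi / 12 * Re z)\<close>. Replacing
  \<open>exp (lambert z)\<close> by 1 costs a factor of order
  \<open>exp (- (2 * pi * Re z))\<close>, which is smaller than the reciprocal of that growth, so
  only the kernel \<open>exp (A * y)\<close> remains.\<close>

lemma major_arc_error:
  assumes A: "Re t = y" "0 < y" "norm t \<le> 1" and B: "B * y / (norm t)\<^sup>2 = pi / 12 * Re z" and z: "1 / 2 \<le> Re z"
  shows "norm (csqrt t * exp (of_real A * t + of_real B / t) * exp (lambert z)
           - csqrt t * exp (of_real A * t + of_real B / t)) \<le> 3 * exp (A * y)"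
proof -
  have reQ: "Re (of_real A * t + of_real B / t) = A * y + pi / 12 * Re z"
    using A B by (simp add: Re_divide cmod_power2)
  have "norm (csqrt t * exp (of_real A * t + of_real B / t) * exp (lambert z) - csqrt t * exp (of_real A * t + of_real B / t))
     = norm (csqrt t * (exp (of_real A * t + of_real B / t) * (exp (lambert z) - 1)))"
    by (simp add: algebra_simps)
  also have "\<dots> = norm (csqrt t) * (exp (A * y + pi / 12 * Re z) * norm (exp (lambert z) - 1))"
    by (simp only: norm_mult norm_exp_eq_Re reQ)
  also have "\<dots> \<le> 1 * (exp (A * y + pi / 12 * Re z) * (3 * exp (- (2 * pi * Re z))))"
    using norm_exp_lambert_minus_one_le[OF z] A by (intro mult_mono mult_nonneg_nonneg) (auto simp: norm_csqrt)
  also have "\<dots> = 3 * exp (A * y + (pi / 12 * Re z - 2 * pi * Re z))"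
  proof -
    have "exp (p + q) * (3 * exp (- r)) = 3 * exp (p + (q - r))" for p q r :: real
      by (simp flip: exp_add)
    then show ?thesis by simp
  qed
  also have "\<dots> \<le> 3 * exp (A * y)" using z by simp
  finally show ?thesis .
qed

lemma csqrt_double:
  assumes "Re w > 0"
  shows "csqrt (2 * w) = of_real (sqrt 2) * csqrt w"
proof (rule csqrt_unique)
  show "(of_real (sqrt 2) * csqrt w)\<^sup>2 = 2 * w" by (simp add: power_mult_distrib flip: of_real_power)
  have "Re (csqrt w) > 0"
    using assms complex_Re_le_cmod[of w] by simp
  then show "0 < Re (of_real (sqrt 2) * csqrt w) \<or> Re (of_real (sqrt 2) * csqrt w) = 0 \<and> 0 \<le> Im (of_real (sqrt 2) * csqrt w)"
    by (simp only: Re_complex_of_real Im_complex_of_real times_complex.sel) simp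
qed

lemma continuous_on_saddle_integrand:
  assumes "y > 0"
  shows "continuous_on S (\<lambda>x. csqrt (Complex y x) * exp (of_real A * Complex y x + of_real B / Complex y x))"
proof (intro continuous_intros)
  show "continuous_on S (\<lambda>x. csqrt (Complex y x))"
  proof (rule continuous_on_compose2[where g = csqrt and t = "{t. 0 < Re t}"])
    show "continuous_on {t. 0 < Re t} csqrt"
      by (intro continuous_at_imp_continuous_on ballI continuous_at_csqrt) (auto simp: complex_nonpos_Reals_iff)
  qed (use assms in \<open>auto intro!: continuous_intros\<close>)
  show "\<forall>x\<in>S. Complex y x \<noteq> 0" using assms by (auto simp: complex_eq_iff)
qed

text \<open>What the two cusps have in common. The condition on
  \<open>B * y / (y\<^sup>2 + X\<^sup>2)\<close> bounds the real part of \<open>B / t\<close> at the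
  end points, so the boundary terms of the exact evaluation stay comparable with
  \<open>exp (A * y)\<close>.\<close>

lemma major_arc_integral:
  fixes A B y X :: real
  assumes pos: "0 < y" "0 < X" and g: "continuous_on {-X..X} g"
    and R: "y\<^sup>2 + X\<^sup>2 \<le> 1" and X: "2 * X \<le> 1"
    and err: "\<And>x. x \<in> {-X..X} \<Longrightarrow>
       norm (g x - csqrt (Complex y x) * exp (of_real A * Complex y x + of_real B / Complex y x)) \<le> \<epsilon>"
    and AB: "14 \<le> A" "0 < B" "2 * (2 * sqrt (A * B) + 1) \<le> 8 * sqrt A"
    and R2: "B * y / (y\<^sup>2 + X\<^sup>2) \<le> 1 / 2" and \<epsilon>: "0 \<le> \<epsilon>"
  shows "norm (integral {-X..X} g - of_real (sqrt pi / (2 * A * sqrt A) * (2 * sqrt (A * B) - 1) * exp (2 * sqrt (A * B)))) \<le> \<epsilon> + 2 * exp (A * y)"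
proof -
  let ?h = "\<lambda>x. csqrt (Complex y x) * exp (of_real A * Complex y x + of_real B / Complex y x)"
  let ?M = "complex_of_real (sqrt pi / (2 * A * sqrt A) * (2 * sqrt (A * B) - 1) * exp (2 * sqrt (A * B)))"
  have cont: "continuous_on {-X..X} ?h" by (rule continuous_on_saddle_integrand[OF pos(1)])
  have "integral {-X..X} g - integral {-X..X} ?h = integral {-X..X} (\<lambda>x. g x - ?h x)"
    by (intro integral_diff[symmetric] integrable_continuous_interval g cont)
  also have "norm \<dots> \<le> \<epsilon> * (X - - X)"
    by (rule integral_bound) (use pos err g cont in \<open>auto intro!: continuous_on_diff\<close>)
  also have "\<dots> \<le> \<epsilon> * 1" using X \<epsilon> by (intro mult_left_mono) auto
  finally have e1: "norm (integral {-X..X} g - integral {-X..X} ?h) \<le> \<epsilon>" by simp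
  have "norm (integral {-X..X} ?h - ?M) \<le> exp (A * y + B * y / (y\<^sup>2 + X\<^sup>2)) / A *
     (2 * sqrt (sqrt (y\<^sup>2 + X\<^sup>2)) + 3 * (2 * sqrt (A * B) + 1) / sqrt A)"
    by (rule saddle_integral) (use pos AB in auto)
  \<comment> \<open>The factor 2 bounds exp (1/2). In the bracket, 2 comes from the root of R and 12
    from the quotient by \<open>sqrt A\<close>; their sum 14 is cancelled by
    \<open>14 \<le> A\<close>.\<close>
  also have "\<dots> \<le> (exp (A * y) * 2) / A * (2 * 1 + 12)"
  proof (intro mult_mono divide_right_mono add_mono)
    have "exp (B * y / (y\<^sup>2 + X\<^sup>2)) \<le> exp (1 / 2)" using R2 by simp
    also have "\<dots> \<le> 2" using exp_bound_lemma[of "1 / 2 :: real"] by simp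
    finally show "exp (A * y + B * y / (y\<^sup>2 + X\<^sup>2)) \<le> exp (A * y) * 2"
      unfolding exp_add by (intro mult_left_mono) auto
    show "sqrt (sqrt (y\<^sup>2 + X\<^sup>2)) \<le> 1" using R by simp
    show "3 * (2 * sqrt (A * B) + 1) / sqrt A \<le> 12" using AB by (simp add: divide_le_eq)
  qed (use AB in auto)
  also have "\<dots> = 2 * exp (A * y) * (14 / A)" by simp
  also have "\<dots> \<le> 2 * exp (A * y) * 1" using AB by (intro mult_left_mono) auto
  finally have e2: "norm (integral {-X..X} ?h - ?M) \<le> 2 * exp (A * y)" by simp
  show ?thesis
    using norm_triangle_ineq[of "integral {-X..X} g - integral {-X..X} ?h" "integral {-X..X} ?h - ?M"] e1 e2 by simp
qed

text \<open>The exponents of the main terms are \<open>2 * sqrt (A * (pi / 12)) = m\<close> and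
  \<open>2 * sqrt (A * (pi / 48)) = m / 2\<close>. The errors add up to
  \<open>15 * exp (m / 6)\<close> from the two major arcs and \<open>exp (m / 3) / 2\<close> from
  the rest, and m \<ge> 89 is ample for the former not to exceed the latter.\<close>

theorem part_num_estimate:
  fixes n :: nat
  defines "m \<equiv> mu n"
  assumes m: "89 \<le> m"
  shows "\<bar>real (part_num n) - pi\<^sup>2 / (6 * sqrt 3) * exp m / m\<^sup>2 *
            ((1 - 1 / m) + (-1) ^ n / sqrt 2 * (1 - 2 / m) * exp (- m / 2))\<bar> \<le> exp (m / 3)"
proof -
  define A where "A = 2 * pi * real n - pi / 12"
  define y where "y = pi / (18 * m)"
  \<comment> \<open>The arcs end where the transformed point has real part 1/2:
    \<open>(norm t)\<^sup>2 = 2 * y\<close> at the cusp 0 and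
    \<open>(norm w)\<^sup>2 = y / 2\<close> at the cusp 1/2. This value serves both sides, as a
    lower bound for \<open>major_arc_error\<close> and as an upper bound on the minor arcs.\<close>
  define X1 where "X1 = sqrt (2 * y - y\<^sup>2)"
  define X2 where "X2 = sqrt (y / 2 - y\<^sup>2)"
  define g where "g x = exp (2 * of_real pi * of_nat n * Complex y x) * exp (lambert (Complex y x))" for x
  have n: "24 * real n - 1 > 0"
  proof (rule ccontr)
    assume "\<not> ?thesis"
    then have "sqrt (24 * real n - 1) \<le> 0" by simp
    then have "mu n \<le> 0" by (simp add: mu_def mult_nonneg_nonpos)
    then show False using m by (simp add: m_def)
  qed
  have m2: "m\<^sup>2 = pi\<^sup>2 / 36 * (24 * real n - 1)"
    using n by (simp add: m_def mu_def power_mult_distrib power_divide)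
  have A_eq: "A = 3 * m\<^sup>2 / pi" unfolding m2 A_def by (simp add: field_simps power2_eq_square)
  have y: "0 < y" "y \<le> 1 / 100"
  proof -
    show "0 < y" using m by (simp add: y_def)
    have "pi / (18 * m) \<le> 4 / (18 * 89)" using m pi_less_4 by (intro frac_le) auto
    then show "y \<le> 1 / 100" by (simp add: y_def)
  qed
  have y2: "y\<^sup>2 \<le> y / 100" using y by (simp add: power2_eq_square)
  have Ay: "A * y = m / 6" using m by (simp add: A_eq y_def field_simps power2_eq_square)
  have By: "pi / 12 * (1 / (9 * y)) = m / 6" using m by (simp add: y_def)
  have X1: "0 < X1" "X1\<^sup>2 = 2 * y - y\<^sup>2" "X1 \<le> 1 / 4"
  proof -
    show "0 < X1" using y y2 by (simp add: X1_def)
    show "X1\<^sup>2 = 2 * y - y\<^sup>2" using y y2 by (simp add: X1_def)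
    then have "X1\<^sup>2 \<le> 1 / 16" using y zero_le_power2[of y] by linarith
    then have "X1\<^sup>2 \<le> (1 / 4)\<^sup>2" by (simp add: power_divide)
    then show "X1 \<le> 1 / 4" by (rule power2_le_imp_le) simp
  qed
  have X2: "0 < X2" "X2\<^sup>2 = y / 2 - y\<^sup>2" "X2 \<le> 1 / 8"
  proof -
    show "0 < X2" using y y2 by (simp add: X2_def)
    show "X2\<^sup>2 = y / 2 - y\<^sup>2" using y y2 by (simp add: X2_def)
    then have "X2\<^sup>2 \<le> 1 / 64" using y zero_le_power2[of y] by linarith
    then have "X2\<^sup>2 \<le> (1 / 8)\<^sup>2" by (simp add: power_divide)
    then show "X2 \<le> 1 / 8" by (rule power2_le_imp_le) simp
  qed
  have gcont: "continuous_on S g" for S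
    unfolding g_def using y by (intro continuous_intros continuous_on_lambert)
  have gint: "g integrable_on {a..b}" for a b
    by (intro integrable_continuous_interval gcont)

  have A14: "14 \<le> A" and sqrtA: "m / 2 \<le> sqrt A"
  proof -
    have "3 * m\<^sup>2 / 4 \<le> A" unfolding A_eq using pi_less_4 pi_gt_zero by (intro divide_left_mono) auto
    moreover have "89\<^sup>2 \<le> m\<^sup>2" using m by (intro power_mono) auto
    ultimately show "14 \<le> A" by simp
    have "m\<^sup>2 / 4 \<le> A" using \<open>3 * m\<^sup>2 / 4 \<le> A\<close> zero_le_power2[of m] by linarith
    then have "(m / 2)\<^sup>2 \<le> A" by (simp add: power_divide)
    then show "m / 2 \<le> sqrt A" by (rule real_le_rsqrt)
  qed
  have beta1: "sqrt (A * (pi / 12)) = m / 2"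
  proof (rule real_sqrt_unique)
    show "(m / 2)\<^sup>2 = A * (pi / 12)" by (simp add: A_eq power_divide)
  qed (use m in simp)
  have beta2: "sqrt (A * (pi / 48)) = m / 4"
  proof (rule real_sqrt_unique)
    show "(m / 4)\<^sup>2 = A * (pi / 48)" by (simp add: A_eq power_divide)
  qed (use m in simp)
  define C where "C = sqrt pi / (2 * A * sqrt A)"
  have C: "C * m = pi\<^sup>2 / (6 * sqrt 3) / m\<^sup>2"
  proof -
    have "sqrt A = sqrt 3 * m / sqrt pi" using m by (simp add: A_eq real_sqrt_divide real_sqrt_mult)
    then have "C = sqrt pi / (2 * (3 * m\<^sup>2 / pi) * (sqrt 3 * m / sqrt pi))" by (simp add: C_def A_eq)
    also have "\<dots> = (sqrt pi * sqrt pi) * pi / (6 * sqrt 3 * m\<^sup>2 * m)" by (simp add: field_simps)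
    also have "sqrt pi * sqrt pi = pi" by simp
    finally show ?thesis using m by (simp add: power2_eq_square)
  qed

  have I1: "norm (integral {-X1..X1} g - of_real (C * (m - 1) * exp m)) \<le> 3 * exp (m / 6) + 2 * exp (m / 6)"
  proof -
    have "norm (integral {-X1..X1} g - of_real (sqrt pi / (2 * A * sqrt A) * (2 * sqrt (A * (pi / 12)) - 1) * exp (2 * sqrt (A * (pi / 12))))) \<le> 3 * exp (A * y) + 2 * exp (A * y)"
    proof (rule major_arc_integral)
      fix x assume x: "x \<in> {-X1..X1}"
      define t where "t = Complex y x"
      have "x\<^sup>2 \<le> X1\<^sup>2" using x by (auto simp: abs_le_square_iff[symmetric])
      then have nt: "(norm t)\<^sup>2 \<le> 2 * y" using X1 by (simp add: t_def cmod_power2)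
      have t0: "t \<noteq> 0" using y by (auto simp: t_def complex_eq_iff)
      have Re1: "Re (1 / t) = y / (norm t)\<^sup>2" by (simp add: Re_inverse_eq t_def)
      have "g x = exp (2 * of_real pi * of_nat n * t) * (csqrt t * exp (of_real (pi / 12) * (1 / t - t)) * exp (lambert (1 / t)))"
        using exp_lambert_inversion[of t] y by (simp add: g_def t_def)
      also have "\<dots> = csqrt t * (exp (2 * of_real pi * of_nat n * t) * exp (of_real (pi / 12) * (1 / t - t))) * exp (lambert (1 / t))"
        by (simp only: mult_ac)
      also have "exp (2 * of_real pi * of_nat n * t) * exp (of_real (pi / 12) * (1 / t - t)) = exp (of_real A * t + of_real (pi / 12) / t)"
        unfolding exp_add[symmetric] by (rule arg_cong[of _ _ exp]) (simp add: A_def left_diff_distrib right_diff_distrib)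
      finally have geq: "g x = csqrt t * exp (of_real A * t + of_real (pi / 12) / t) * exp (lambert (1 / t))" .
      have "norm (csqrt t * exp (of_real A * t + of_real (pi / 12) / t) * exp (lambert (1 / t)) - csqrt t * exp (of_real A * t + of_real (pi / 12) / t)) \<le> 3 * exp (A * y)"
      proof (rule major_arc_error)
        show "Re t = y" "0 < y" using y by (auto simp: t_def)
        have "(norm t)\<^sup>2 \<le> 1\<^sup>2" using nt y by simp
        then show "norm t \<le> 1" by (rule power2_le_imp_le) simp
        show "pi / 12 * y / (norm t)\<^sup>2 = pi / 12 * Re (1 / t)" by (simp add: Re1)
        show "1 / 2 \<le> Re (1 / t)" using nt t0 y by (simp add: Re1 field_simps)
      qed
      then show "norm (g x - csqrt (Complex y x) * exp (of_real A * Complex y x + of_real (pi / 12) / Complex y x)) \<le> 3 * exp (A * y)"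
        by (simp only: geq t_def)
    next
      show "2 * (2 * sqrt (A * (pi / 12)) + 1) \<le> 8 * sqrt A" unfolding beta1 using sqrtA m by (simp add: field_simps)
      show "pi / 12 * y / (y\<^sup>2 + X1\<^sup>2) \<le> 1 / 2" using y X1 pi_less_4 by (simp add: field_simps)
      show "y\<^sup>2 + X1\<^sup>2 \<le> 1" using y X1 by simp
    qed (use y X1 gcont A14 in auto)
    then show ?thesis unfolding beta1 Ay C_def[symmetric] by simp
  qed

  have I3: "norm (integral {1 / 2 - X2..1 / 2 + X2} g - of_real ((-1) ^ n * sqrt 2 * (C * (m / 2 - 1) * exp (m / 2)))) \<le> 2 * (3 * exp (m / 6) + 2 * exp (m / 6))"
  proof -
    define k where "k = complex_of_real ((-1) ^ n * sqrt 2)"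
    have k: "k \<noteq> 0" "norm k = sqrt 2" by (auto simp: k_def norm_mult norm_power)
    \<comment> \<open>Division by \<open>k\<close> removes the sign and the factor
      \<open>sqrt 2\<close> of the transformation, so that \<open>g2\<close> has exactly the form of
      the saddle integrand; its error is afterwards multiplied by
      \<open>sqrt 2 \<le> 2\<close>.\<close>
    define g2 where "g2 x = g (x + 1 / 2) / k" for x
    have shift: "integral {1 / 2 - X2..1 / 2 + X2} g = k * integral {-X2..X2} g2"
    proof -
      have "(g has_integral (integral {- X2 + 1 / 2..X2 + 1 / 2} g)) {- X2 + 1 / 2..X2 + 1 / 2}"
        by (intro integrable_integral gint)
      then have "integral {-X2..X2} (g \<circ> (+) (1 / 2)) = integral {- X2 + 1 / 2..X2 + 1 / 2} g"
        unfolding has_integral_shift_Icc_real[symmetric] by (rule integral_unique)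
      then have "integral {1 / 2 - X2..1 / 2 + X2} g = integral {-X2..X2} (\<lambda>x. k * g2 x)"
        using k by (simp add: o_def g2_def add.commute)
      then show ?thesis by simp
    qed
    have "norm (integral {-X2..X2} g2 - of_real (sqrt pi / (2 * A * sqrt A) * (2 * sqrt (A * (pi / 48)) - 1) * exp (2 * sqrt (A * (pi / 48))))) \<le> 3 * exp (A * y) + 2 * exp (A * y)"
    proof (rule major_arc_integral)
      show "continuous_on {- X2..X2} g2"
        unfolding g2_def using k
        by (intro continuous_on_divide continuous_on_const continuous_on_compose2[OF gcont[of UNIV]] continuous_intros) auto
      fix x assume x: "x \<in> {-X2..X2}"
      define w where "w = Complex y x"
      have "x\<^sup>2 \<le> X2\<^sup>2" using x by (auto simp: abs_le_square_iff[symmetric])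
      then have nw: "(norm w)\<^sup>2 \<le> y / 2" using X2 by (simp add: w_def cmod_power2)
      have w0: "w \<noteq> 0" "Re w > 0" using y by (auto simp: w_def complex_eq_iff)
      have Re4: "Re (1 / (4 * w) - \<i> / 2) = y / (4 * (norm w)\<^sup>2)"
      proof -
        have "Re (1 / (4 * w)) = 4 * y / (4 * norm w)\<^sup>2"
          by (simp only: Re_inverse_eq norm_mult) (simp add: w_def)
        then show ?thesis by (simp add: power_mult_distrib)
      qed
      have tw: "Complex y (x + 1 / 2) = w + \<i> / 2" by (simp add: w_def complex_eq_iff)
      have sgn: "exp (2 * of_real pi * of_nat n * (w + \<i> / 2)) = of_real ((-1) ^ n) * exp (2 * of_real pi * of_nat n * w)"
      proof -
        have "2 * of_real pi * of_nat n * (w + \<i> / 2) = 2 * of_real pi * of_nat n * w + of_nat n * (\<i> * of_real pi)"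
          by (simp add: algebra_simps)
        moreover have "exp (of_nat n * (\<i> * of_real pi)) = of_real ((-1) ^ n)"
          by (simp add: exp_of_nat_mult)
        ultimately show ?thesis by (simp only: exp_add mult.commute)
      qed
      have "g (x + 1 / 2) = of_real ((-1) ^ n) * exp (2 * of_real pi * of_nat n * w) * ((of_real (sqrt 2) * csqrt w) * exp (of_real (pi / 12) * (1 / (4 * w) - w)) *
           exp (lambert (1 / (4 * w) - \<i> / 2)))"
        unfolding g_def tw sgn exp_lambert_half_cusp[OF w0(2)] csqrt_double[OF w0(2)] ..
      also have "\<dots> = k * (csqrt w * (exp (2 * of_real pi * of_nat n * w) * exp (of_real (pi / 12) * (1 / (4 * w) - w))) * exp (lambert (1 / (4 * w) - \<i> / 2)))"
        by (simp only: k_def of_real_mult mult_ac)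
      also have "exp (2 * of_real pi * of_nat n * w) * exp (of_real (pi / 12) * (1 / (4 * w) - w)) = exp (of_real A * w + of_real (pi / 48) / w)"
        unfolding exp_add[symmetric] by (rule arg_cong[of _ _ exp]) (simp add: A_def left_diff_distrib right_diff_distrib)
      finally have geq: "g2 x = csqrt w * exp (of_real A * w + of_real (pi / 48) / w) * exp (lambert (1 / (4 * w) - \<i> / 2))"
        using k by (simp add: g2_def)
      have "norm (csqrt w * exp (of_real A * w + of_real (pi / 48) / w) * exp (lambert (1 / (4 * w) - \<i> / 2)) - csqrt w * exp (of_real A * w + of_real (pi / 48) / w)) \<le> 3 * exp (A * y)"
      proof (rule major_arc_error)
        show "Re w = y" "0 < y" using y by (auto simp: w_def)
        have "(norm w)\<^sup>2 \<le> 1\<^sup>2" using nw y by simp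
        then show "norm w \<le> 1" by (rule power2_le_imp_le) simp
        show "pi / 48 * y / (norm w)\<^sup>2 = pi / 12 * Re (1 / (4 * w) - \<i> / 2)" unfolding Re4 by simp
        show "1 / 2 \<le> Re (1 / (4 * w) - \<i> / 2)" unfolding Re4 using nw w0 y by (simp add: field_simps)
      qed
      then show "norm (g2 x - csqrt (Complex y x) * exp (of_real A * Complex y x + of_real (pi / 48) / Complex y x)) \<le> 3 * exp (A * y)"
        by (simp only: geq w_def)
    next
      show "2 * (2 * sqrt (A * (pi / 48)) + 1) \<le> 8 * sqrt A" unfolding beta2 using sqrtA m by (simp add: field_simps)
      have "y\<^sup>2 + X2\<^sup>2 = y / 2" using X2 by simp
      then have "pi / 48 * y / (y\<^sup>2 + X2\<^sup>2) = pi / 24" using y by (simp only:) simp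
      then show "pi / 48 * y / (y\<^sup>2 + X2\<^sup>2) \<le> 1 / 2" using pi_less_4 by linarith
      show "y\<^sup>2 + X2\<^sup>2 \<le> 1" using y X2 by simp
    qed (use y X2 A14 in auto)
    then have e: "norm (integral {-X2..X2} g2 - of_real (C * (m / 2 - 1) * exp (m / 2))) \<le> 3 * exp (m / 6) + 2 * exp (m / 6)"
      unfolding beta2 Ay C_def[symmetric] by simp
    have "integral {1 / 2 - X2..1 / 2 + X2} g - of_real ((-1) ^ n * sqrt 2 * (C * (m / 2 - 1) * exp (m / 2))) = k * (integral {-X2..X2} g2 - of_real (C * (m / 2 - 1) * exp (m / 2)))"
      unfolding shift by (simp add: k_def right_diff_distrib)
    then have "norm (integral {1 / 2 - X2..1 / 2 + X2} g - of_real ((-1) ^ n * sqrt 2 * (C * (m / 2 - 1) * exp (m / 2)))) = sqrt 2 * norm (integral {-X2..X2} g2 - of_real (C * (m / 2 - 1) * exp (m / 2)))"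
      by (simp only: norm_mult k)
    also have "\<dots> \<le> 2 * (3 * exp (m / 6) + 2 * exp (m / 6))"
    proof (intro mult_mono e)
      have "sqrt 2 \<le> sqrt (2\<^sup>2)" by (intro real_sqrt_le_mono) simp
      then show "sqrt 2 \<le> 2" by simp
    qed auto
    finally show ?thesis .
  qed

  have minor: "norm (g x) \<le> exp (m / 3) / 2" if x: "X1 \<le> x" "x \<le> 1 - X1" "X2 \<le> \<bar>x - 1 / 2\<bar>" for x
  proof -
    have "norm (exp (lambert (Complex y x))) \<le> exp (pi / 12 * (1 / (9 * y) - y)) / 2"
    proof (rule norm_exp_lambert_minor_arc[OF y])
      fix j :: int
      have "X1 \<le> \<bar>x - of_int j\<bar>"
      proof (cases "j \<le> 0")
        case True
        then have "real_of_int j \<le> 0" by simp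
        then show ?thesis using x by linarith
      next
        case False
        then have "real_of_int j \<ge> 1" by simp
        then show ?thesis using x by linarith
      qed
      then have "X1\<^sup>2 \<le> \<bar>x - of_int j\<bar>\<^sup>2" using X1 by (intro power_mono) auto
      then show "2 * y - y\<^sup>2 \<le> (x - of_int j)\<^sup>2" using X1 by simp
    next
      fix j :: int assume "odd j"
      then have "j \<noteq> 0" "j \<noteq> 2" by auto
      then consider "j \<le> - 1" | "j = 1" | "j \<ge> 3" by linarith
      then have "X2 \<le> \<bar>x - of_int j / 2\<bar>"
      proof cases
        case 1
        then have "real_of_int j \<le> - 1" by linarith
        then show ?thesis using x X1 X2 by linarith
      next
        case 2
        then show ?thesis using x by simp
      next
        case 3
        then have "real_of_int j \<ge> 3" by linarith
        then show ?thesis using x X1 X2 by linarith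
      qed
      then have "X2\<^sup>2 \<le> \<bar>x - of_int j / 2\<bar>\<^sup>2" using X2 by (intro power_mono) auto
      then show "y / 2 - y\<^sup>2 \<le> (x - of_int j / 2)\<^sup>2" using X2 by simp
    qed
    then have "norm (g x) \<le> exp (2 * pi * real n * y) * (exp (pi / 12 * (1 / (9 * y) - y)) / 2)"
      unfolding g_def norm_mult by (intro mult_mono) auto
    also have "\<dots> = exp (A * y + pi / 12 * (1 / (9 * y))) / 2"
      by (simp add: A_def algebra_simps flip: exp_add)
    also have "\<dots> = exp (m / 3) / 2" unfolding Ay By by simp
    finally show ?thesis .
  qed
  have I2: "norm (integral {X1..1 / 2 - X2} g) \<le> exp (m / 3) / 2 * (1 / 2)"
  proof -
    have "norm (integral {X1..1 / 2 - X2} g) \<le> exp (m / 3) / 2 * (1 / 2 - X2 - X1)"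
    proof (rule integral_bound)
      show "norm (g x) \<le> exp (m / 3) / 2" if "x \<in> {X1..1 / 2 - X2}" for x
        using that X1 X2 by (intro minor) auto
    qed (use X1 X2 gcont in auto)
    also have "\<dots> \<le> exp (m / 3) / 2 * (1 / 2)" using X1 X2 by (intro mult_left_mono) auto
    finally show ?thesis .
  qed
  have I4: "norm (integral {1 / 2 + X2..1 - X1} g) \<le> exp (m / 3) / 2 * (1 / 2)"
  proof -
    have "norm (integral {1 / 2 + X2..1 - X1} g) \<le> exp (m / 3) / 2 * (1 - X1 - (1 / 2 + X2))"
    proof (rule integral_bound)
      show "norm (g x) \<le> exp (m / 3) / 2" if "x \<in> {1 / 2 + X2..1 - X1}" for x
        using that X1 X2 by (intro minor) auto
    qed (use X1 X2 gcont in auto)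
    also have "\<dots> \<le> exp (m / 3) / 2 * (1 / 2)" using X1 X2 by (intro mult_left_mono) auto
    finally show ?thesis .
  qed

  \<comment> \<open>The period starts at \<open>- X1\<close> so that the arc around the cusp 0 stays
    in one piece. The bounds \<open>X1 \<le> 1 / 4\<close> and \<open>X2 \<le> 1 / 8\<close> put the
    four pieces in order.\<close>
  have "of_nat (part_num n) = integral {-X1..-X1 + 1} g"
    unfolding g_def by (rule part_num_integral[OF y(1)])
  also have "-X1 + 1 = 1 - X1" by simp
  also have "integral {-X1..1 - X1} g = integral {-X1..X1} g + integral {X1..1 / 2 - X2} g + integral {1 / 2 - X2..1 / 2 + X2} g + integral {1 / 2 + X2..1 - X1} g"
  proof -
    have "integral {-X1..1 - X1} g = integral {-X1..X1} g + integral {X1..1 - X1} g"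
      using X1 by (intro Henstock_Kurzweil_Integration.integral_combine[symmetric] gint) auto
    also have "integral {X1..1 - X1} g = integral {X1..1 / 2 - X2} g + integral {1 / 2 - X2..1 - X1} g"
      using X1 X2 by (intro Henstock_Kurzweil_Integration.integral_combine[symmetric] gint) auto
    also have "integral {1 / 2 - X2..1 - X1} g = integral {1 / 2 - X2..1 / 2 + X2} g + integral {1 / 2 + X2..1 - X1} g"
      using X1 X2 by (intro Henstock_Kurzweil_Integration.integral_combine[symmetric] gint) auto
    finally show ?thesis by simp
  qed
  finally have total: "complex_of_real (real (part_num n)) = integral {-X1..X1} g + integral {X1..1 / 2 - X2} g + integral {1 / 2 - X2..1 / 2 + X2} g + integral {1 / 2 + X2..1 - X1} g"
    by simp
  define M where "M = C * (m - 1) * exp m + (-1) ^ n * sqrt 2 * (C * (m / 2 - 1) * exp (m / 2))"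
  have eq: "complex_of_real (real (part_num n) - M) = (integral {-X1..X1} g - of_real (C * (m - 1) * exp m)) + integral {X1..1 / 2 - X2} g + (integral {1 / 2 - X2..1 / 2 + X2} g - of_real ((-1) ^ n * sqrt 2 * (C * (m / 2 - 1) * exp (m / 2)))) + integral {1 / 2 + X2..1 - X1} g"
    unfolding of_real_diff total M_def of_real_add by simp
  have "\<bar>real (part_num n) - M\<bar> = norm (complex_of_real (real (part_num n) - M))"
    by (simp only: norm_of_real)
  also have "\<dots> \<le> (3 * exp (m / 6) + 2 * exp (m / 6)) + exp (m / 3) / 2 * (1 / 2) + 2 * (3 * exp (m / 6) + 2 * exp (m / 6)) + exp (m / 3) / 2 * (1 / 2)"
    unfolding eq by (rule norm_triangle_le[OF add_mono[OF norm_triangle_le[OF add_mono[OF norm_triangle_le[OF add_mono[OF I1 I2]] I3]] I4]])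
  also have "\<dots> = 15 * exp (m / 6) + exp (m / 3) / 2" by simp
  also have "\<dots> \<le> exp (m / 3)"
  proof -
    have e2: "(2::real) \<le> exp 1" using exp_ge_add_one_self[of 1] by simp
    have "(30::real) \<le> 2 ^ 14" by simp
    also have "(2::real) ^ 14 \<le> exp 1 ^ 14" by (intro power_mono e2) simp
    also have "exp 1 ^ 14 = exp (14::real)" by (simp flip: exp_of_nat_mult)
    also have "\<dots> \<le> exp (m / 6)" using m by simp
    finally have "30 * exp (m / 6) \<le> exp (m / 6) * exp (m / 6)" by (intro mult_right_mono) auto
    also have "\<dots> = exp (m / 3)" by (simp flip: exp_add)
    finally show ?thesis by simp
  qed
  finally have fin: "\<bar>real (part_num n) - M\<bar> \<le> exp (m / 3)" .
  have "M = pi\<^sup>2 / (6 * sqrt 3) * exp m / m\<^sup>2 * ((1 - 1 / m) + (-1) ^ n / sqrt 2 * (1 - 2 / m) * exp (- m / 2))"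
  proof -
    have m0: "m \<noteq> 0" using m by simp
    have s2: "sqrt 2 / 2 = 1 / sqrt 2" by (simp add: field_simps)
    have "exp (m / 2) = exp m * exp (- m / 2)" by (simp flip: exp_add)
    moreover have "m - 1 = m * (1 - 1 / m)" "m / 2 - 1 = m * (1 - 2 / m) / 2"
      using m0 by (simp_all add: right_diff_distrib diff_divide_distrib)
    ultimately have "M = C * (m * (1 - 1 / m)) * exp m +
        (-1) ^ n * sqrt 2 * (C * (m * (1 - 2 / m) / 2) * (exp m * exp (- m / 2)))"
      by (simp only: M_def)
    also have "\<dots> = C * m * exp m * ((1 - 1 / m) + (-1) ^ n * (sqrt 2 / 2) * (1 - 2 / m) * exp (- m / 2))"
      by (simp only: distrib_left mult_ac times_divide_eq_right times_divide_eq_left)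
    also have "\<dots> = pi\<^sup>2 / (6 * sqrt 3) / m\<^sup>2 * exp m * ((1 - 1 / m) + (-1) ^ n * (1 / sqrt 2) * (1 - 2 / m) * exp (- m / 2))"
      by (simp only: C s2)
    finally show ?thesis by simp
  qed
  then show ?thesis using fin by simp
qed

section \<open>Numerical bounds\<close>

text \<open>The inequality 1 + u \<le> exp u at u = (b - a) / a. It trades powers of m for an
  exponential, so that estimates for all large m reduce to one numerical check at a fixed
  \<open>a\<close> without any discussion of monotonicity.\<close>

lemma le_mult_exp_diff:
  fixes a b :: real
  assumes "0 < a"
  shows "b \<le> a * exp ((b - a) / a)"
proof -
  have "b = a * (1 + (b - a) / a)" using assms by (simp add: field_simps)
  also have "\<dots> \<le> a * exp ((b - a) / a)" using assms by (intro mult_left_mono exp_ge_add_one_self) auto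
  finally show ?thesis .
qed

lemma power_le_mult_exp_diff:
  fixes a b :: real
  assumes "0 < a" "0 \<le> b"
  shows "b ^ k \<le> a ^ k * exp (real k * ((b - a) / a))"
proof -
  have "b ^ k \<le> (a * exp ((b - a) / a)) ^ k" by (intro power_mono le_mult_exp_diff assms)
  then show ?thesis by (simp only: power_mult_distrib exp_of_nat_mult)
qed

lemma exp_1_lower: "2.71828 \<le> exp (1 :: real)"
proof -
  have "2.71828 \<le> 5837465777 / 2147483648 - inverse (2 ^ 32 :: real)" by simp
  also have "\<dots> \<le> exp 1" using e_approx_32 by linarith
  finally show ?thesis .
qed

text \<open>The constant 89.07 is just below \<open>\<mu>(1206) = 89.0779\<dots>\<close>, and \<open>0.70711\<close> just above \<open>1 / \<surd>2\<close>.\<close>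

lemma second_term_bound:
  fixes m :: real
  assumes "89.07 \<le> m"
  shows "m ^ 9 * (m - 2) * 0.70711 * exp (- m / 2) \<le> 0.993"
proof -
  let ?a = "89.07 :: real"
  have "m ^ 9 \<le> ?a ^ 9 * exp (real 9 * ((m - ?a) / ?a))"
    using assms by (intro power_le_mult_exp_diff) auto
  moreover have "m - 2 \<le> (?a - 2) * exp ((m - 2 - (?a - 2)) / (?a - 2))" by (rule le_mult_exp_diff) simp
  ultimately have "m ^ 9 * (m - 2) \<le> (?a ^ 9 * exp (real 9 * ((m - ?a) / ?a))) * ((?a - 2) * exp ((m - 2 - (?a - 2)) / (?a - 2)))"
    using assms by (intro mult_mono) auto
  also have "\<dots> = ?a ^ 9 * (?a - 2) * exp (real 9 * ((m - ?a) / ?a) + (m - 2 - (?a - 2)) / (?a - 2))"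
    by (simp only: exp_add mult_ac)
  \<comment> \<open>The rates add up to 9 / 89.07 + 1 / 87.07, far below 1/2.\<close>
  also have "\<dots> \<le> ?a ^ 9 * (?a - 2) * exp (m / 2 - ?a / 2)"
    using assms by (intro mult_left_mono) (auto simp: field_simps)
  finally have "m ^ 9 * (m - 2) * exp (- m / 2) \<le> (?a ^ 9 * (?a - 2) * exp (m / 2 - ?a / 2)) * exp (- m / 2)"
    by (intro mult_right_mono) auto
  also have "\<dots> = ?a ^ 9 * (?a - 2) * exp (- (?a / 2))"
    by (simp only: mult.assoc exp_add[symmetric]) simp
  finally have 1: "m ^ 9 * (m - 2) * exp (- m / 2) \<le> ?a ^ 9 * (?a - 2) * exp (- (?a / 2))" .
  \<comment> \<open>The split is 89.07 / 2 = 44 + 4 * 0.13375; each of the four small exponents is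
    handled by a quadratic Taylor bound.\<close>
  have "2.71828 ^ 44 * (1 + 0.13375 + 0.13375\<^sup>2 / 2) ^ 4 \<le> exp (1::real) ^ 44 * exp 0.13375 ^ 4"
    using exp_1_lower exp_lower_Taylor_quadratic[of "0.13375"] by (intro mult_mono power_mono) auto
  also have "exp (1::real) ^ 44 * exp 0.13375 ^ 4 = exp (?a / 2)"
    by (simp only: exp_of_nat_mult[symmetric] exp_add[symmetric]) simp
  finally have 2: "2.71828 ^ 44 * (1 + 0.13375 + 0.13375\<^sup>2 / 2) ^ 4 \<le> exp (?a / 2)" .
  have "?a ^ 9 * (?a - 2) * 0.70711 \<le> 0.993 * (2.71828 ^ 44 * (1 + 0.13375 + 0.13375\<^sup>2 / 2) ^ 4)"
    by (simp add: power2_eq_square power_divide)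
  also have "\<dots> \<le> 0.993 * exp (?a / 2)" using 2 by (intro mult_left_mono) auto
  finally have "?a ^ 9 * (?a - 2) * 0.70711 * exp (- (?a / 2)) \<le> 0.993 * exp (?a / 2) * exp (- (?a / 2))"
    by (intro mult_right_mono) auto
  also have "\<dots> = 0.993" by (simp only: mult.assoc exp_add[symmetric]) simp
  finally show ?thesis using 1 by (simp add: mult_ac)
qed

text \<open>This is the error \<open>exp (m / 3)\<close> relative to the leading size
  \<open>exp m / m\<^sup>2\<close>, in units of m^(-10); 1.1 bounds the reciprocal of the leading
  constant. The numerical check uses 2 * 89.07 / 3 = 59 + 0.38.\<close>

lemma remainder_bound:
  fixes m :: real
  assumes "89.07 \<le> m"
  shows "1.1 * m ^ 12 * exp (- (2 * m / 3)) \<le> 0.006"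
proof -
  let ?a = "89.07 :: real"
  have "m ^ 12 \<le> ?a ^ 12 * exp (real 12 * ((m - ?a) / ?a))"
    using assms by (intro power_le_mult_exp_diff) auto
  also have "\<dots> \<le> ?a ^ 12 * exp (2 * m / 3 - 2 * ?a / 3)"
    using assms by (intro mult_left_mono) (auto simp: field_simps)
  finally have "m ^ 12 * exp (- (2 * m / 3)) \<le> (?a ^ 12 * exp (2 * m / 3 - 2 * ?a / 3)) * exp (- (2 * m / 3))"
    by (intro mult_right_mono) auto
  also have "\<dots> = ?a ^ 12 * exp (- (2 * ?a / 3))"
    by (simp only: mult.assoc exp_add[symmetric]) simp
  finally have 1: "m ^ 12 * exp (- (2 * m / 3)) \<le> ?a ^ 12 * exp (- (2 * ?a / 3))" .
  have "2.71828 ^ 59 * (1 + 0.38) \<le> exp (1::real) ^ 59 * exp 0.38"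
    using exp_1_lower exp_ge_add_one_self[of "0.38 :: real"] by (intro mult_mono power_mono) auto
  also have "\<dots> = exp (2 * ?a / 3)"
    by (simp only: exp_of_nat_mult[symmetric] exp_add[symmetric]) simp
  finally have 2: "2.71828 ^ 59 * (1 + 0.38) \<le> exp (2 * ?a / 3)" .
  have "1.1 * ?a ^ 12 \<le> 0.006 * (2.71828 ^ 59 * (1 + 0.38))" by (simp add: power_divide)
  also have "\<dots> \<le> 0.006 * exp (2 * ?a / 3)" using 2 by (intro mult_left_mono) auto
  finally have "1.1 * ?a ^ 12 * exp (- (2 * ?a / 3)) \<le> 0.006 * exp (2 * ?a / 3) * exp (- (2 * ?a / 3))"
    by (intro mult_right_mono) auto
  also have "\<dots> = 0.006" by (simp only: mult.assoc exp_add[symmetric]) simp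
  finally show ?thesis using 1 by (simp add: mult_ac)
qed

section \<open>Two-sided bounds for p(n)\<close>

lemma mu_lower:
  assumes "1206 \<le> n"
  shows "89.07 \<le> mu n"
proof -
  \<comment> \<open>The square of 170.126 lies just below 24 * 1206 - 1 = 28943.\<close>
  have "170.126 \<le> sqrt (24 * real n - 1)"
    using assms by (intro real_le_rsqrt) (simp add: power2_eq_square)
  then have "3.1415 / 6 * 170.126 \<le> pi / 6 * sqrt (24 * real n - 1)"
    using pi_approx by (intro mult_mono) auto
  then show ?thesis by (simp add: mu_def)
qed

text \<open>After extracting exp x / x^2 the polynomials become 1 - 1/x -/+ x^(-10). The window
  x^(-10) has to hold both the term of the cusp 1/2, at most 0.993 of it, and the remainder, at most
  0.006 of it; together 0.999 < 1. The range begins at 1206 because the ratio at 1207 involves the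
  preceding partition number.\<close>

theorem part_num_bounds:
  assumes "1206 \<le> n"
  defines "x \<equiv> mu n"
  shows "pi\<^sup>2 / (6 * sqrt 3) * (exp x * (x ^ 10 - x ^ 9 - 1) / x ^ 12) < real (part_num n)"
    and "real (part_num n) < pi\<^sup>2 / (6 * sqrt 3) * (exp x * (x ^ 10 - x ^ 9 + 1) / x ^ 12)"
proof -
  define K where "K = pi\<^sup>2 / (6 * sqrt 3)"
  define \<delta> where "\<delta> = (-1) ^ n / sqrt 2 * (1 - 2 / x) * exp (- x / 2)"
  have x: "89.07 \<le> x" using mu_lower[OF assms(1)] by (simp add: x_def)
  then have x0: "x > 0" by simp
  have K: "K > 0" by (simp add: K_def)
  have K': "1 / K \<le> 1.1"
  proof -
    have "sqrt 3 \<le> 1.74" by (rule real_le_lsqrt) (auto simp: power2_eq_square)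
    moreover have "3.1415\<^sup>2 \<le> pi\<^sup>2" using pi_approx by (intro power_mono) auto
    ultimately have "6 * sqrt 3 \<le> 1.1 * pi\<^sup>2" by (simp add: power2_eq_square)
    then show ?thesis by (simp add: K_def divide_le_eq)
  qed
  have est: "\<bar>real (part_num n) - K * exp x / x\<^sup>2 * ((1 - 1 / x) + \<delta>)\<bar> \<le> exp (x / 3)"
    using part_num_estimate[of n] x by (simp add: x_def K_def \<delta>_def)
  have s2: "1 / sqrt 2 \<le> 0.70711"
  proof -
    have "1.41421 \<le> sqrt 2" by (rule real_le_rsqrt) (simp add: power2_eq_square)
    then have "1 / sqrt 2 \<le> 1 / 1.41421" by (intro divide_left_mono) auto
    also have "\<dots> \<le> 0.70711" by simp
    finally show ?thesis .
  qed
  have d: "x ^ 10 * \<bar>\<delta>\<bar> \<le> 0.993"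
  proof -
    have "x ^ 10 * \<bar>\<delta>\<bar> = x ^ 9 * (x - 2) * exp (- x / 2) * (1 / sqrt 2)"
    proof -
      have "\<bar>\<delta>\<bar> = 1 / sqrt 2 * (1 - 2 / x) * exp (- x / 2)"
        using x by (simp add: \<delta>_def abs_mult power_abs)
      moreover have "x ^ 10 = x ^ 9 * x" by (simp add: eval_nat_numeral)
      moreover have "x * (1 - 2 / x) = x - 2" using x0 by (simp add: field_simps)
      ultimately show ?thesis by (metis (no_types, opaque_lifting) mult.assoc mult.commute)
    qed
    also have "\<dots> \<le> x ^ 9 * (x - 2) * exp (- x / 2) * 0.70711" using x s2 by (intro mult_left_mono) auto
    also have "\<dots> \<le> 0.993" using second_term_bound[OF x] by (simp add: mult_ac)
    finally show ?thesis .
  qed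
  define G where "G = K * exp x / x\<^sup>2"
  have G: "G > 0" using K x0 by (simp add: G_def)
  have rem: "x ^ 10 * exp (x / 3) \<le> 0.006 * G"
  proof -
    have "exp x * exp (- (2 * x / 3)) = exp (x / 3)" by (simp flip: exp_add)
    then have "x ^ 10 * exp (x / 3) = G * ((1 / K) * x ^ 12 * exp (- (2 * x / 3)))"
      using K x0 by (simp add: G_def field_simps power_add[symmetric])
    also have "\<dots> \<le> G * (1.1 * x ^ 12 * exp (- (2 * x / 3)))"
      using K' G x0 by (intro mult_left_mono mult_right_mono) auto
    also have "\<dots> \<le> G * 0.006" using remainder_bound[OF x] G by (intro mult_left_mono) auto
    finally show ?thesis by simp
  qed
  have main: "\<bar>real (part_num n) - G * (1 - 1 / x)\<bar> < G / x ^ 10"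
  proof -
    have "\<bar>real (part_num n) - G * (1 - 1 / x)\<bar> \<le> exp (x / 3) + G * \<bar>\<delta>\<bar>"
    proof -
      have "real (part_num n) - G * (1 - 1 / x) = (real (part_num n) - G * ((1 - 1 / x) + \<delta>)) + G * \<delta>"
        by (simp add: algebra_simps)
      moreover have "\<bar>G * \<delta>\<bar> = G * \<bar>\<delta>\<bar>" using G by (simp add: abs_mult)
      ultimately show ?thesis using est unfolding G_def[symmetric] by linarith
    qed
    then have "x ^ 10 * \<bar>real (part_num n) - G * (1 - 1 / x)\<bar> \<le> x ^ 10 * exp (x / 3) + G * (x ^ 10 * \<bar>\<delta>\<bar>)"
      using x0 mult_left_mono[of _ _ "x ^ 10"] by (fastforce simp: algebra_simps)
    also have "\<dots> \<le> 0.006 * G + G * 0.993" using rem d G by (intro add_mono mult_left_mono) auto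
    also have "\<dots> < G" using G by simp
    finally show ?thesis using x0 by (simp add: field_simps)
  qed
  have "G * (1 - 1 / x) - G / x ^ 10 = K * (exp x * (x ^ 10 - x ^ 9 - 1) / x ^ 12)"
    "G * (1 - 1 / x) + G / x ^ 10 = K * (exp x * (x ^ 10 - x ^ 9 + 1) / x ^ 12)"
  proof -
    have "x ^ 12 = x\<^sup>2 * x ^ 10" "x ^ 10 = x * x ^ 9" by (simp_all flip: power_add power_Suc)
    then show "G * (1 - 1 / x) - G / x ^ 10 = K * (exp x * (x ^ 10 - x ^ 9 - 1) / x ^ 12)"
      "G * (1 - 1 / x) + G / x ^ 10 = K * (exp x * (x ^ 10 - x ^ 9 + 1) / x ^ 12)"
      using x0 unfolding G_def by (simp_all add: field_simps)
  qed
  then show "pi\<^sup>2 / (6 * sqrt 3) * (exp x * (x ^ 10 - x ^ 9 - 1) / x ^ 12) < real (part_num n)"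
    "real (part_num n) < pi\<^sup>2 / (6 * sqrt 3) * (exp x * (x ^ 10 - x ^ 9 + 1) / x ^ 12)"
    using main unfolding K_def by linarith+
qed

section \<open>Passage to the ratio of partition numbers\<close>

lemma ratio_strict_mono:
  fixes a b c a' b' c' :: real
  assumes "0 < a" "a < a'" "0 < b" "b < b'" "0 < c'" "c' < c"
  shows "a * b / c\<^sup>2 < a' * b' / c'\<^sup>2"
proof -
  have "a * b < a' * b'" using assms by (intro mult_strict_mono) auto
  moreover have "c'\<^sup>2 \<le> c\<^sup>2" using assms by (intro power_mono) auto
  ultimately show ?thesis using assms by (intro frac_less) auto
qed

theorem theorem2p1:
  fixes n :: nat
  assumes "n \<ge> 1207"
  shows "f_bound n < u_ratio n \<and> u_ratio n < g_bound n"
proof -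
  define K where "K = pi\<^sup>2 / (6 * sqrt 3)"
  have K: "K > 0" by (simp add: K_def)
  define L where "L x = K * (exp x * (x ^ 10 - x ^ 9 - 1) / x ^ 12)" for x :: real
  define U where "U x = K * (exp x * (x ^ 10 - x ^ 9 + 1) / x ^ 12)" for x :: real
  define x where "x = mu (n - 1)"
  define y where "y = mu n"
  define z where "z = mu (n + 1)"
  have ge: "89.07 \<le> x" "89.07 \<le> y" "89.07 \<le> z"
    unfolding x_def y_def z_def using assms by (intro mu_lower; simp)+
  have px: "L x < real (part_num (n - 1))" "real (part_num (n - 1)) < U x"
    and py: "L y < real (part_num n)" "real (part_num n) < U y"
    and pz: "L z < real (part_num (n + 1))" "real (part_num (n + 1)) < U z"
    unfolding L_def U_def K_def x_def y_def z_def using assms by (intro part_num_bounds; simp)+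
  \<comment> \<open>Positivity of the lower bounds is what allows them to be multiplied and, in the
    upper estimate, to be divided by.\<close>
  have Lpos: "0 < L t" if "89.07 \<le> t" for t
  proof -
    have "1 \<le> t ^ 9" using that by (intro one_le_power) simp
    then have "1 * 2 \<le> t ^ 9 * (t - 1)" using that by (intro mult_mono) auto
    moreover have "t ^ 10 - t ^ 9 = t ^ 9 * (t - 1)" by (simp add: algebra_simps eval_nat_numeral)
    ultimately have "0 < t ^ 10 - t ^ 9 - 1" by simp
    then show ?thesis using that K by (simp add: L_def)
  qed
  have e: "exp (x - 2 * y + z) = exp x * exp z / (exp y)\<^sup>2"
    by (simp add: exp_add exp_diff power2_eq_square exp_double)
  \<comment> \<open>The constant \<open>K\<close> cancels between the two factors of the numerator
    and the square in the denominator. Exponentials and polynomials are kept as variables so that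
    both bounds are instances of one identity.\<close>
  have quot: "ex * ez / ey\<^sup>2 * ((a * w ^ 24 * c) / (p * b\<^sup>2 * q)) =
      (K * (ez * c / q)) * (K * (ex * a / p)) / (K * (ey * b / w ^ 12))\<^sup>2"
    for ex ey ez a b c p q w :: real
  proof -
    have "w ^ 24 = (w ^ 12)\<^sup>2" by (simp flip: power_mult)
    then show ?thesis using K by (simp add: power_mult_distrib power_divide power2_eq_square mult_ac)
  qed
  have "f_bound n = L z * L x / (U y)\<^sup>2"
    unfolding f_bound_def Let_def x_def[symmetric] y_def[symmetric] z_def[symmetric] e L_def U_def
    by (rule quot)
  moreover have "g_bound n = U z * U x / (L y)\<^sup>2"
    unfolding g_bound_def Let_def x_def[symmetric] y_def[symmetric] z_def[symmetric] e L_def U_def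
    by (rule quot)
  moreover have "L z * L x / (U y)\<^sup>2 < u_ratio n"
    unfolding u_ratio_def using px py pz Lpos[OF ge(1)] Lpos[OF ge(2)] Lpos[OF ge(3)]
    by (intro ratio_strict_mono) auto
  moreover have "u_ratio n < U z * U x / (L y)\<^sup>2"
    unfolding u_ratio_def using px py pz Lpos[OF ge(1)] Lpos[OF ge(2)] Lpos[OF ge(3)]
    by (intro ratio_strict_mono) auto
  ultimately show ?thesis by simp
qed

end
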